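(* Let $R$ be a commutative Noetherian ring with non-zero identity and $I$ a proper ideal of $R$. Let $N$ be a weakly Laskerian $R$-module and $M$ a finitely generated $R$-module. Assume that $N$ is Cohen-Macaulay with respect to $I$, and that either $\operatorname{cd}_I N=0$ or $\operatorname{cd}_I N\geq\max\{1,\,h_I(M,N)\}$. Then the set $\operatorname{Ass}_R H^{\operatorname{cd}_I N}_I(M,N)$ of associated primes is finite.
   Context: An $R$-module $N$ is weakly Laskerian if $\operatorname{Ass}_R(N/U)$ is finite for every $R$-submodule $U$ of $N$. For $R$-modules $M,N$ and $i\ge 0$, the generalized local cohomology module is $H^i_I(M,N)=\varinjlim_q \operatorname{Ext}^i_R(M/I^qM,N)$; $H^i_I(N)=H^i_I(R,N)$ is ordinary local cohomology. Set $\operatorname{depth}_I N=\inf\{i\ge 0\mid H^i_I(N)\ne 0\}$ and $\operatorname{cd}_I N=\sup\{i\ge 0\mid H^i_I(N)\ne 0\}$. $N$ is Cohen-Macaulay with respect to $I$ if $\operatorname{depth}_I N=\operatorname{cd}_I N$. For $R$-modules $A,B$ set $e_R(A,B)=\sup\{i\ge 0\mid \operatorname{Ext}^i_R(A,B)\neq 0\}$, and $h_I(M,N)=\sup_{q\geq 0}\{e_R(M,H^q_I(N))\}$ (possibly $\infty$). Conventions: $\inf\emptyset=+\infty$, $\sup\emptyset=-\infty$. *)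

theory Defs
  imports "HOL-Algebra.Module" "HOL-Algebra.Ideal_Product" "HOL-Algebra.Ring_Divisibility"
    "HOL-Library.Extended_Real"
begin

text \<open>
  Modules are records of type \<open>('r, 'm) module\<close> satisfying the predicate \<^const>\<open>module\<close>. Such a
  record carries the irrelevant ring fields \<open>mult\<close> and \<open>one\<close>; they are left undefined below.
\<close>

section \<open>Submodules, quotients, associated primes\<close>

definition mod_span ::
    "('r, 'x) ring_scheme \<Rightarrow> ('r, 'm, 'y) module_scheme \<Rightarrow> 'm set \<Rightarrow> 'm set" where
  "mod_span R M S = \<Inter> {U. submodule U R M \<and> S \<subseteq> U}"

definition fin_gen_module :: "('r, 'x) ring_scheme \<Rightarrow> ('r, 'm, 'y) module_scheme \<Rightarrow> bool" where
  "fin_gen_module R M \<longleftrightarrow>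
     module R M \<and> (\<exists>S. finite S \<and> S \<subseteq> carrier M \<and> mod_span R M S = carrier M)"

definition ideal_smult ::
    "('r, 'x) ring_scheme \<Rightarrow> 'r set \<Rightarrow> ('r, 'm, 'y) module_scheme \<Rightarrow> 'm set" where
  "ideal_smult R J M = mod_span R M {a \<odot>\<^bsub>M\<^esub> x | a x. a \<in> J \<and> x \<in> carrier M}"

definition quot_module :: "('r, 'm, 'y) module_scheme \<Rightarrow> 'm set \<Rightarrow> ('r, 'm set) module" where
  "quot_module M U =
     \<lparr>carrier = a_rcosets\<^bsub>M\<^esub> U, monoid.mult = undefined, one = undefined,
      ring.zero = U, ring.add = set_add M, smult = (\<lambda>r C. \<Union>x\<in>C. U +>\<^bsub>M\<^esub> (r \<odot>\<^bsub>M\<^esub> x))\<rparr>"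

definition annihilator ::
    "('r, 'x) ring_scheme \<Rightarrow> ('r, 'm, 'y) module_scheme \<Rightarrow> 'm \<Rightarrow> 'r set" where
  "annihilator R M x = {r \<in> carrier R. r \<odot>\<^bsub>M\<^esub> x = \<zero>\<^bsub>M\<^esub>}"

definition Ass :: "('r, 'x) ring_scheme \<Rightarrow> ('r, 'm, 'y) module_scheme \<Rightarrow> 'r set set" where
  "Ass R M = {P. primeideal P R \<and> (\<exists>x\<in>carrier M. P = annihilator R M x)}"

definition weakly_Laskerian :: "('r, 'x) ring_scheme \<Rightarrow> ('r, 'm, 'y) module_scheme \<Rightarrow> bool" where
  "weakly_Laskerian R N \<longleftrightarrow>
     module R N \<and> (\<forall>U. submodule U R N \<longrightarrow> finite (Ass R (quot_module N U)))"

definition nonzero_module :: "('r, 'm, 'y) module_scheme \<Rightarrow> bool" where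
  "nonzero_module M \<longleftrightarrow> carrier M \<noteq> {\<zero>\<^bsub>M\<^esub>}"

definition ring_module :: "('r, 'x) ring_scheme \<Rightarrow> ('r, 'r) module" where
  "ring_module R =
     \<lparr>carrier = carrier R, monoid.mult = monoid.mult R, one = one R,
      ring.zero = ring.zero R, ring.add = ring.add R, smult = monoid.mult R\<rparr>"


section \<open>Homomorphisms and free modules\<close>

definition Hom_module ::
    "('r, 'x) ring_scheme \<Rightarrow> ('r, 'm, 'y) module_scheme \<Rightarrow> ('r, 'n, 'z) module_scheme
      \<Rightarrow> ('r, 'm \<Rightarrow> 'n) module" where
  "Hom_module R A B =
     \<lparr>carrier = {f \<in> carrier A \<rightarrow>\<^sub>E carrier B.
        (\<forall>x\<in>carrier A. \<forall>y\<in>carrier A. f (x \<oplus>\<^bsub>A\<^esub> y) = f x \<oplus>\<^bsub>B\<^esub> f y) \<and>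
        (\<forall>r\<in>carrier R. \<forall>x\<in>carrier A. f (r \<odot>\<^bsub>A\<^esub> x) = r \<odot>\<^bsub>B\<^esub> f x)},
      monoid.mult = undefined, one = undefined,
      ring.zero = (\<lambda>x\<in>carrier A. \<zero>\<^bsub>B\<^esub>),
      ring.add = (\<lambda>f g. \<lambda>x\<in>carrier A. f x \<oplus>\<^bsub>B\<^esub> g x),
      smult = (\<lambda>r f. \<lambda>x\<in>carrier A. r \<odot>\<^bsub>B\<^esub> f x)\<rparr>"

definition supp :: "('r, 'x) ring_scheme \<Rightarrow> ('b \<Rightarrow> 'r) \<Rightarrow> 'b set" where
  "supp R u = {x. u x \<noteq> \<zero>\<^bsub>R\<^esub>}"

text \<open>The free module on the set \<open>X\<close>: finitely supported functions.\<close>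

definition free_module :: "('r, 'x) ring_scheme \<Rightarrow> 'b set \<Rightarrow> ('r, 'b \<Rightarrow> 'r) module" where
  "free_module R X =
     \<lparr>carrier = {u. range u \<subseteq> carrier R \<and> finite (supp R u) \<and> supp R u \<subseteq> X},
      monoid.mult = undefined, one = undefined,
      ring.zero = (\<lambda>_. \<zero>\<^bsub>R\<^esub>),
      ring.add = (\<lambda>u v x. u x \<oplus>\<^bsub>R\<^esub> v x),
      smult = (\<lambda>r u x. r \<otimes>\<^bsub>R\<^esub> u x)\<rparr>"

definition single :: "('r, 'x) ring_scheme \<Rightarrow> 'b \<Rightarrow> 'b \<Rightarrow> 'r" where
  "single R y = (\<lambda>x. if x = y then \<one>\<^bsub>R\<^esub> else \<zero>\<^bsub>R\<^esub>)"

text \<open>The linear extension to a free module of a map \<open>\<phi>\<close> given on the basis.\<close>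

definition lin_ext ::
    "('r, 'x) ring_scheme \<Rightarrow> ('r, 'm, 'y) module_scheme \<Rightarrow> ('b \<Rightarrow> 'm) \<Rightarrow> ('b \<Rightarrow> 'r) \<Rightarrow> 'm" where
  "lin_ext R M \<phi> u = (\<Oplus>\<^bsub>M\<^esub>x\<in>supp R u. u x \<odot>\<^bsub>M\<^esub> \<phi> x)"


section \<open>The standard free resolution\<close>

text \<open>
  Ext is computed from a functorial free resolution \<open>\<dots> \<rightarrow> F\<^sub>1 \<rightarrow> F\<^sub>0 \<rightarrow> A \<rightarrow> 0\<close>. The module
  \<open>F\<^sub>0\<close> is free on the underlying set of \<open>A\<close>, and \<open>F\<^bsub>n+1\<^esub>\<close> is free on the set of all formal
  linear combinations of basis elements of \<open>F\<^sub>n\<close> whose value in \<open>F\<^sub>n\<close> is a cycle; the boundary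
  map sends such a combination to its value. The type \<open>gen\<close> accommodates the bases of all
  \<open>F\<^sub>n\<close> simultaneously.
\<close>

datatype (dead 'r, 'a) gen = Elt 'a | Comb "('r \<times> ('r, 'a) gen) list"
  for map: gen_map

primrec comb_val :: "('r, 'x) ring_scheme \<Rightarrow> ('r \<times> 'b) list \<Rightarrow> 'b \<Rightarrow> 'r" where
  "comb_val R [] = (\<lambda>_. \<zero>\<^bsub>R\<^esub>)"
| "comb_val R (p # ps) = (\<lambda>x. (if x = snd p then fst p else \<zero>\<^bsub>R\<^esub>) \<oplus>\<^bsub>R\<^esub> comb_val R ps x)"

definition augmentation ::
    "('r, 'x) ring_scheme \<Rightarrow> ('r, 'a, 'y) module_scheme \<Rightarrow> (('r, 'a) gen \<Rightarrow> 'r) \<Rightarrow> 'a" where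
  "augmentation R A = lin_ext R A (\<lambda>g. case g of Elt a \<Rightarrow> a | Comb l \<Rightarrow> \<zero>\<^bsub>A\<^esub>)"

definition boundary ::
    "('r, 'x) ring_scheme \<Rightarrow> (('r, 'a) gen \<Rightarrow> 'r) \<Rightarrow> ('r, 'a) gen \<Rightarrow> 'r" where
  "boundary R = lin_ext R (free_module R UNIV)
     (\<lambda>g. case g of Elt a \<Rightarrow> (\<lambda>_. \<zero>\<^bsub>R\<^esub>) | Comb l \<Rightarrow> comb_val R l)"

primrec res_basis ::
    "('r, 'x) ring_scheme \<Rightarrow> ('r, 'a, 'y) module_scheme \<Rightarrow> nat \<Rightarrow> ('r, 'a) gen set" where
  "res_basis R A 0 = Elt ` carrier A"
| "res_basis R A (Suc n) =
     {Comb l | l. set l \<subseteq> carrier R \<times> res_basis R A n \<and>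
        (if n = 0 then augmentation R A (comb_val R l) = \<zero>\<^bsub>A\<^esub>
         else boundary R (comb_val R l) = (\<lambda>_. \<zero>\<^bsub>R\<^esub>))}"

definition res_module ::
    "('r, 'x) ring_scheme \<Rightarrow> ('r, 'a, 'y) module_scheme \<Rightarrow> nat
      \<Rightarrow> ('r, ('r, 'a) gen \<Rightarrow> 'r) module" where
  "res_module R A n = free_module R (res_basis R A n)"

text \<open>The chain map of standard resolutions induced by a linear map \<open>f\<close>.\<close>

definition res_map ::
    "('r, 'x) ring_scheme \<Rightarrow> ('a \<Rightarrow> 'b) \<Rightarrow> (('r, 'a) gen \<Rightarrow> 'r) \<Rightarrow> ('r, 'b) gen \<Rightarrow> 'r" where
  "res_map R f = lin_ext R (free_module R UNIV) (\<lambda>g. single R (gen_map f g))"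


subsection \<open>Exactness\<close>

lemma module_free_module:
  assumes "cring R"
  shows "module R (free_module R X)"
proof -
  interpret cring R by fact
  have fin: "finite (supp R (\<lambda>x. u x \<oplus>\<^bsub>R\<^esub> v x)) \<and> supp R (\<lambda>x. u x \<oplus>\<^bsub>R\<^esub> v x) \<subseteq> supp R u \<union> supp R v"
    if "finite (supp R u)" "finite (supp R v)" for u v :: "_ \<Rightarrow> _"
  proof -
    have "supp R (\<lambda>x. u x \<oplus>\<^bsub>R\<^esub> v x) \<subseteq> supp R u \<union> supp R v" by (auto simp: supp_def)
    then show ?thesis using that by (meson finite_UnI finite_subset)
  qed
  have fin2: "finite (supp R (\<lambda>x. r \<otimes>\<^bsub>R\<^esub> u x)) \<and> supp R (\<lambda>x. r \<otimes>\<^bsub>R\<^esub> u x) \<subseteq> supp R u"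
    if "finite (supp R u)" "r \<in> carrier R" for u :: "_ \<Rightarrow> _" and r
  proof -
    have "supp R (\<lambda>x. r \<otimes>\<^bsub>R\<^esub> u x) \<subseteq> supp R u" using that by (auto simp: supp_def)
    then show ?thesis using that by (meson finite_subset)
  qed
  show ?thesis
  proof (rule moduleI)
    show "abelian_group (free_module R X)"
    proof (rule abelian_groupI)
      fix u assume u: "u \<in> carrier (free_module R X)"
      have "supp R (\<lambda>x. \<ominus>\<^bsub>R\<^esub> u x) \<subseteq> supp R u" using u by (auto simp: supp_def)
      with u show "\<exists>v\<in>carrier (free_module R X). v \<oplus>\<^bsub>free_module R X\<^esub> u = \<zero>\<^bsub>free_module R X\<^esub>"
        by (intro bexI[of _ "\<lambda>x. \<ominus>\<^bsub>R\<^esub> u x"])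
          (auto simp: free_module_def l_neg image_subset_iff intro: finite_subset)
    next
      fix u v assume "u \<in> carrier (free_module R X)" "v \<in> carrier (free_module R X)"
      then show "u \<oplus>\<^bsub>free_module R X\<^esub> v \<in> carrier (free_module R X)"
        using fin[of u v] by (auto simp: free_module_def image_subset_iff)
    qed (auto simp: free_module_def image_subset_iff supp_def a_ac)
  next
    fix r u assume "r \<in> carrier R" "u \<in> carrier (free_module R X)"
    then show "r \<odot>\<^bsub>free_module R X\<^esub> u \<in> carrier (free_module R X)"
      using fin2[of u r] by (auto simp: free_module_def image_subset_iff)
  qed (auto simp: assms free_module_def image_subset_iff l_distr r_distr m_assoc)
qed

lemma lin_ext_superset:
  assumes "module R M" "u \<in> carrier (free_module R X)" "finite S" "supp R u \<subseteq> S"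
    "\<And>x. x \<in> S \<Longrightarrow> \<phi> x \<in> carrier M"
  shows "lin_ext R M \<phi> u = (\<Oplus>\<^bsub>M\<^esub>x\<in>S. u x \<odot>\<^bsub>M\<^esub> \<phi> x)"
proof -
  interpret module R M by fact
  show ?thesis unfolding lin_ext_def
    by (rule M.add.finprod_mono_neutral_cong_left)
      (use assms in \<open>auto simp: supp_def free_module_def image_subset_iff\<close>)
qed

lemma free_module_mono: "X \<subseteq> Y \<Longrightarrow> carrier (free_module R X) \<subseteq> carrier (free_module R Y)"
  by (auto simp: free_module_def)

lemma finsum_mem:
  assumes "abelian_monoid M" "K \<subseteq> carrier M" "\<zero>\<^bsub>M\<^esub> \<in> K"
    "\<And>x y. x \<in> K \<Longrightarrow> y \<in> K \<Longrightarrow> x \<oplus>\<^bsub>M\<^esub> y \<in> K" "\<And>i. i \<in> S \<Longrightarrow> f i \<in> K"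
  shows "(\<Oplus>\<^bsub>M\<^esub>i\<in>S. f i) \<in> K"
proof -
  interpret abelian_monoid M by fact
  show ?thesis using assms(5)
  proof (induction S rule: infinite_finite_induct)
    case (insert x F)
    then show ?case using assms(2-4)
      by (subst finsum_insert) (auto simp: Pi_def)
  qed (use assms in auto)
qed

lemma lin_ext_mem:
  assumes M: "module R M" and "submodule K R M" and u: "u \<in> carrier (free_module R X)"
    and "\<And>x. x \<in> X \<Longrightarrow> \<phi> x \<in> K"
  shows "lin_ext R M \<phi> u \<in> K"
proof -
  interpret module R M by fact
  interpret K: submodule K R M by fact
  note K = submoduleE[OF \<open>submodule K R M\<close>]
  show ?thesis unfolding lin_ext_def
  proof (rule finsum_mem)
    show "abelian_monoid M" by (rule M.abelian_monoid_axioms)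
    show "\<zero>\<^bsub>M\<^esub> \<in> K" using K.one_closed by simp
    fix x assume "x \<in> supp R u"
    then have "x \<in> X" "u x \<in> carrier R" using u by (auto simp: free_module_def)
    then show "u x \<odot>\<^bsub>M\<^esub> \<phi> x \<in> K" using assms(4) K(4) by simp
  qed (use K(1,5) in simp_all)
qed

lemma lin_ext_add:
  assumes M: "module R M" and u: "u \<in> carrier (free_module R X)" "v \<in> carrier (free_module R X)"
    and \<phi>: "\<And>x. x \<in> X \<Longrightarrow> \<phi> x \<in> carrier M"
  shows "lin_ext R M \<phi> (u \<oplus>\<^bsub>free_module R X\<^esub> v) = lin_ext R M \<phi> u \<oplus>\<^bsub>M\<^esub> lin_ext R M \<phi> v"
proof -
  interpret module R M by fact
  interpret F: module R "free_module R X" by (rule module_free_module) (rule R.is_cring)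
  let ?S = "supp R u \<union> supp R v"
  have S: "finite ?S" "?S \<subseteq> X" and c: "\<And>x. u x \<in> carrier R" "\<And>x. v x \<in> carrier R"
    using u by (auto simp: free_module_def)
  have S': "supp R (u \<oplus>\<^bsub>free_module R X\<^esub> v) \<subseteq> ?S"
    by (auto simp: supp_def free_module_def)
  have "lin_ext R M \<phi> (u \<oplus>\<^bsub>free_module R X\<^esub> v) =
      (\<Oplus>\<^bsub>M\<^esub>x\<in>?S. (u \<oplus>\<^bsub>free_module R X\<^esub> v) x \<odot>\<^bsub>M\<^esub> \<phi> x)"
    using S S' \<phi> u by (intro lin_ext_superset[OF M]) auto
  also have "\<dots> = (\<Oplus>\<^bsub>M\<^esub>x\<in>?S. u x \<odot>\<^bsub>M\<^esub> \<phi> x \<oplus>\<^bsub>M\<^esub> v x \<odot>\<^bsub>M\<^esub> \<phi> x)"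
    using S \<phi> c by (intro M.finsum_cong') (auto simp: free_module_def smult_l_distr subset_iff)
  also have "\<dots> = (\<Oplus>\<^bsub>M\<^esub>x\<in>?S. u x \<odot>\<^bsub>M\<^esub> \<phi> x) \<oplus>\<^bsub>M\<^esub> (\<Oplus>\<^bsub>M\<^esub>x\<in>?S. v x \<odot>\<^bsub>M\<^esub> \<phi> x)"
    using S \<phi> c by (intro M.finsum_addf) (auto simp: subset_iff)
  also have "\<dots> = lin_ext R M \<phi> u \<oplus>\<^bsub>M\<^esub> lin_ext R M \<phi> v"
    using S \<phi> u by (subst (1 2) lin_ext_superset[OF M, where S = ?S]) auto
  finally show ?thesis .
qed

lemma lin_ext_smult:
  assumes M: "module R M" and u: "u \<in> carrier (free_module R X)" and r: "r \<in> carrier R"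
    and \<phi>: "\<And>x. x \<in> X \<Longrightarrow> \<phi> x \<in> carrier M"
  shows "lin_ext R M \<phi> (r \<odot>\<^bsub>free_module R X\<^esub> u) = r \<odot>\<^bsub>M\<^esub> lin_ext R M \<phi> u"
proof -
  interpret module R M by fact
  interpret F: module R "free_module R X" by (rule module_free_module) (rule R.is_cring)
  let ?S = "supp R u"
  have S: "finite ?S" "?S \<subseteq> X" and c: "\<And>x. u x \<in> carrier R"
    using u by (auto simp: free_module_def)
  have S': "supp R (r \<odot>\<^bsub>free_module R X\<^esub> u) \<subseteq> ?S"
    using r by (auto simp: supp_def free_module_def)
  have "lin_ext R M \<phi> (r \<odot>\<^bsub>free_module R X\<^esub> u) =
      (\<Oplus>\<^bsub>M\<^esub>x\<in>?S. (r \<odot>\<^bsub>free_module R X\<^esub> u) x \<odot>\<^bsub>M\<^esub> \<phi> x)"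
    using S S' \<phi> u r by (intro lin_ext_superset[OF M]) auto
  also have "\<dots> = (\<Oplus>\<^bsub>M\<^esub>x\<in>?S. r \<odot>\<^bsub>M\<^esub> (u x \<odot>\<^bsub>M\<^esub> \<phi> x))"
    using S \<phi> c r by (intro M.finsum_cong') (auto simp: free_module_def smult_assoc1 subset_iff)
  also have "\<dots> = r \<odot>\<^bsub>M\<^esub> lin_ext R M \<phi> u"
    unfolding lin_ext_def using S \<phi> c r by (subst finsum_smult_ldistr) (auto simp: subset_iff)
  finally show ?thesis .
qed

lemma lin_ext_kernel:
  assumes M: "module R M" and \<phi>: "\<And>x. x \<in> X \<Longrightarrow> \<phi> x \<in> carrier M" and "X \<subseteq> Y"
  shows "submodule {u \<in> carrier (free_module R X). lin_ext R M \<phi> u = \<zero>\<^bsub>M\<^esub>} R (free_module R Y)"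
proof -
  interpret module R M by fact
  interpret F: module R "free_module R X" by (rule module_free_module) (rule R.is_cring)
  interpret G: module R "free_module R Y" by (rule module_free_module) (rule R.is_cring)
  have eq: "add (free_module R Y) = add (free_module R X)"
    "\<zero>\<^bsub>free_module R Y\<^esub> = \<zero>\<^bsub>free_module R X\<^esub>"
    "smult (free_module R Y) = smult (free_module R X)"
    by (auto simp: free_module_def)
  show ?thesis
  proof (rule G.submoduleI)
    fix u assume u: "u \<in> {u \<in> carrier (free_module R X). lin_ext R M \<phi> u = \<zero>\<^bsub>M\<^esub>}"
    have "\<ominus>\<^bsub>free_module R Y\<^esub> u = (\<ominus>\<^bsub>R\<^esub> \<one>\<^bsub>R\<^esub>) \<odot>\<^bsub>free_module R X\<^esub> u"
      using u subsetD[OF free_module_mono[OF \<open>X \<subseteq> Y\<close>], of u R]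
        G.smult_l_minus[of "\<one>\<^bsub>R\<^esub>" u] G.smult_one[of u]
      by (simp add: eq)
    then show "\<ominus>\<^bsub>free_module R Y\<^esub> u \<in> {u \<in> carrier (free_module R X). lin_ext R M \<phi> u = \<zero>\<^bsub>M\<^esub>}"
      using u \<phi> by (simp add: lin_ext_smult[OF M])
  next
    show "\<zero>\<^bsub>free_module R Y\<^esub> \<in> {u \<in> carrier (free_module R X). lin_ext R M \<phi> u = \<zero>\<^bsub>M\<^esub>}"
      using F.zero_closed by (simp add: eq lin_ext_def) (simp add: free_module_def supp_def)
  qed (use \<phi> free_module_mono[OF \<open>X \<subseteq> Y\<close>] in \<open>auto simp: eq lin_ext_add[OF M] lin_ext_smult[OF M]\<close>)
qed

lemma single_closed:
  assumes "cring R" "x \<in> X"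
  shows "single R x \<in> carrier (free_module R X)"
proof -
  interpret cring R by fact
  have "supp R (single R x) \<subseteq> {x}" by (auto simp: supp_def single_def)
  then show ?thesis using assms
    by (auto simp: free_module_def single_def intro: finite_subset)
qed

lemma lin_ext_single:
  assumes M: "module R M" and \<phi>: "\<phi> x \<in> carrier M"
  shows "lin_ext R M \<phi> (single R x) = \<phi> x"
proof -
  interpret module R M by fact
  have "lin_ext R M \<phi> (single R x) = (\<Oplus>\<^bsub>M\<^esub>y\<in>{x}. single R x y \<odot>\<^bsub>M\<^esub> \<phi> y)"
    by (rule lin_ext_superset[OF M single_closed[where X = "{x}"]])
      (use \<phi> R.is_cring in \<open>auto simp: supp_def single_def\<close>)
  then show ?thesis using \<phi> by (simp add: single_def)
qed

lemma comb_val_closed: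
  assumes "cring R" "set l \<subseteq> carrier R \<times> X"
  shows "comb_val R l \<in> carrier (free_module R X)"
proof -
  interpret cring R by fact
  interpret F: module R "free_module R X" by (rule module_free_module) fact
  show ?thesis using assms(2)
  proof (induction l)
    case Nil
    then show ?case using F.zero_closed by (simp add: free_module_def)
  next
    case (Cons p l)
    have "supp R (\<lambda>x. if x = snd p then fst p else \<zero>\<^bsub>R\<^esub>) \<subseteq> {snd p}" by (auto simp: supp_def)
    then have "(\<lambda>x. if x = snd p then fst p else \<zero>\<^bsub>R\<^esub>) \<in> carrier (free_module R X)"
      using Cons.prems by (auto simp: free_module_def intro: finite_subset)
    from F.a_closed[OF this Cons.IH] Cons.prems show ?case
      by (simp add: free_module_def)
  qed
qed

lemma comb_val_surj:
  assumes "cring R" "u \<in> carrier (free_module R X)"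
  shows "\<exists>l. set l \<subseteq> carrier R \<times> X \<and> comb_val R l = u"
proof -
  interpret cring R by fact
  have "\<exists>l. set l \<subseteq> carrier R \<times> X \<and> comb_val R l = (\<lambda>x. if x \<in> S then u x else \<zero>\<^bsub>R\<^esub>)"
    if "finite S" "S \<subseteq> X" for S using that
  proof (induction S)
    case (insert y S)
    then obtain l where l: "set l \<subseteq> carrier R \<times> X" "comb_val R l = (\<lambda>x. if x \<in> S then u x else \<zero>\<^bsub>R\<^esub>)"
      by auto
    with insert assms show ?case
      by (intro exI[of _ "(u y, y) # l"]) (auto simp: fun_eq_iff free_module_def image_subset_iff)
  qed (auto intro: exI[of _ "[]"])
  moreover have "(\<lambda>x. if x \<in> supp R u then u x else \<zero>\<^bsub>R\<^esub>) = u"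
    by (auto simp: supp_def)
  moreover have "finite (supp R u)" "supp R u \<subseteq> X"
    using assms(2) by (simp_all add: free_module_def)
  ultimately show ?thesis by metis
qed

text \<open>
  Together, \<open>augmentation_surj\<close> and \<open>boundary_image\<close> say that the sequence
  \<open>\<dots> \<rightarrow> F\<^sub>1 \<rightarrow> F\<^sub>0 \<rightarrow> A \<rightarrow> 0\<close> is exact.
\<close>

theorem augmentation_surj:
  assumes "module R A"
  shows "augmentation R A ` carrier (res_module R A 0) = carrier A"
proof -
  interpret module R A by fact
  show ?thesis
  proof (intro equalityI subsetI)
    fix a assume "a \<in> augmentation R A ` carrier (res_module R A 0)"
    then show "a \<in> carrier A"
      by (auto simp: res_module_def augmentation_def
          intro!: lin_ext_mem[OF assms carrier_is_submodule])
  next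
    fix a assume a: "a \<in> carrier A"
    then have "augmentation R A (single R (Elt a)) = a"
      unfolding augmentation_def by (subst lin_ext_single[OF assms]) auto
    moreover have "single R (Elt a) \<in> carrier (res_module R A 0)"
      using a R.is_cring by (auto simp: res_module_def intro!: single_closed)
    ultimately show "a \<in> augmentation R A ` carrier (res_module R A 0)" by (metis imageI)
  qed
qed

theorem boundary_image:
  assumes "module R A"
  shows "boundary R ` carrier (res_module R A (Suc n)) =
    {u \<in> carrier (res_module R A n).
       if n = 0 then augmentation R A u = \<zero>\<^bsub>A\<^esub> else boundary R u = (\<lambda>_. \<zero>\<^bsub>R\<^esub>)}" (is "_ = ?Z")
proof -
  interpret module R A by fact
  interpret F: module R "free_module R (UNIV :: ('a, 'c) gen set)" by (rule module_free_module) (rule R.is_cring)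
  have Z: "submodule ?Z R (free_module R UNIV)"
  proof (cases n)
    case 0
    have "submodule {u \<in> carrier (free_module R (res_basis R A 0)).
        augmentation R A u = \<zero>\<^bsub>A\<^esub>} R (free_module R UNIV)"
      unfolding augmentation_def by (intro lin_ext_kernel[OF assms] subset_UNIV) auto
    with 0 show ?thesis by (simp only: res_module_def simp_thms if_True)
  next
    case (Suc m)
    then have n: "n \<noteq> 0" by simp
    have "(case g of Elt a \<Rightarrow> (\<lambda>_. \<zero>\<^bsub>R\<^esub>) | Comb l \<Rightarrow> comb_val R l) \<in> carrier (free_module R UNIV)"
      if "g \<in> res_basis R A n" for g
      using that Suc by (auto intro!: comb_val_closed R.is_cring)
    then have "submodule {u \<in> carrier (free_module R (res_basis R A n)).
        boundary R u = \<zero>\<^bsub>free_module R UNIV\<^esub>} R (free_module R UNIV)"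
      unfolding boundary_def by (intro lin_ext_kernel[OF F.module_axioms] subset_UNIV)
    moreover have "\<zero>\<^bsub>free_module R (UNIV :: ('a, 'c) gen set)\<^esub> = (\<lambda>_. \<zero>\<^bsub>R\<^esub>)"
      by (simp add: free_module_def)
    ultimately show ?thesis using n by (simp only: res_module_def if_False)
  qed
  have Zb: "comb_val R l \<in> ?Z" if "Comb l \<in> res_basis R A (Suc n)" for l
  proof -
    from that have "set l \<subseteq> carrier R \<times> res_basis R A n \<and>
      (if n = 0 then augmentation R A (comb_val R l) = \<zero>\<^bsub>A\<^esub>
       else boundary R (comb_val R l) = (\<lambda>_. \<zero>\<^bsub>R\<^esub>))"
      unfolding res_basis.simps by blast
    then show ?thesis
      using comb_val_closed[OF R.is_cring] unfolding res_module_def by blast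
  qed
  have Comb: "\<exists>l. g = Comb l" if "g \<in> res_basis R A (Suc n)" for g
    using that by auto
  show ?thesis
  proof (intro equalityI subsetI)
    fix u assume "u \<in> boundary R ` carrier (res_module R A (Suc n))"
    then obtain v where v: "v \<in> carrier (free_module R (res_basis R A (Suc n)))" "u = boundary R v"
      unfolding res_module_def by blast
    have "(case g of Elt a \<Rightarrow> (\<lambda>_. \<zero>\<^bsub>R\<^esub>) | Comb l \<Rightarrow> comb_val R l) \<in> ?Z"
      if "g \<in> res_basis R A (Suc n)" for g
    proof -
      from Comb[OF that] obtain l where "g = Comb l" by blast
      with Zb[of l] that show ?thesis by (simp only: gen.case)
    qed
    from lin_ext_mem[OF F.module_axioms Z v(1) this] v(2) show "u \<in> ?Z"
      by (simp only: boundary_def)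
  next
    fix u assume u: "u \<in> ?Z"
    then have "u \<in> carrier (free_module R (res_basis R A n))"
      unfolding res_module_def by blast
    from comb_val_surj[OF R.is_cring this]
    obtain l where l: "set l \<subseteq> carrier R \<times> res_basis R A n" "comb_val R l = u"
      by blast
    from u have "if n = 0 then augmentation R A u = \<zero>\<^bsub>A\<^esub> else boundary R u = (\<lambda>_. \<zero>\<^bsub>R\<^esub>)"
      by blast
    with l have b: "Comb l \<in> res_basis R A (Suc n)"
      unfolding res_basis.simps by blast
    have "boundary R (single R (Comb l :: ('a, 'c) gen)) = u"
      unfolding boundary_def using l(2) comb_val_closed[OF R.is_cring, of l UNIV] l(1)
      by (subst lin_ext_single[OF F.module_axioms]) auto
    moreover have "single R (Comb l) \<in> carrier (res_module R A (Suc n))"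
      using b unfolding res_module_def by (intro single_closed R.is_cring)
    ultimately show "u \<in> boundary R ` carrier (res_module R A (Suc n))"
      by (intro image_eqI[where x = "single R (Comb l)"]) simp_all
  qed
qed


section \<open>Ext\<close>

definition cochains ::
    "('r, 'x) ring_scheme \<Rightarrow> ('r, 'a, 'y) module_scheme \<Rightarrow> ('r, 'b, 'z) module_scheme \<Rightarrow> nat
      \<Rightarrow> ('r, (('r, 'a) gen \<Rightarrow> 'r) \<Rightarrow> 'b) module" where
  "cochains R A B i = Hom_module R (res_module R A i) B"

definition cocycles ::
    "('r, 'x) ring_scheme \<Rightarrow> ('r, 'a, 'y) module_scheme \<Rightarrow> ('r, 'b, 'z) module_scheme \<Rightarrow> nat
      \<Rightarrow> ((('r, 'a) gen \<Rightarrow> 'r) \<Rightarrow> 'b) set" where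
  "cocycles R A B i =
     {f \<in> carrier (cochains R A B i).
        \<forall>u\<in>carrier (res_module R A (Suc i)). f (boundary R u) = \<zero>\<^bsub>B\<^esub>}"

primrec coboundaries ::
    "('r, 'x) ring_scheme \<Rightarrow> ('r, 'a, 'y) module_scheme \<Rightarrow> ('r, 'b, 'z) module_scheme \<Rightarrow> nat
      \<Rightarrow> ((('r, 'a) gen \<Rightarrow> 'r) \<Rightarrow> 'b) set" where
  "coboundaries R A B 0 = {\<zero>\<^bsub>cochains R A B 0\<^esub>}"
| "coboundaries R A B (Suc i) =
     (\<lambda>f. \<lambda>u\<in>carrier (res_module R A (Suc i)). f (boundary R u)) ` carrier (cochains R A B i)"

type_synonym ('r, 'a, 'b) ext = "((('r, 'a) gen \<Rightarrow> 'r) \<Rightarrow> 'b) set"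

definition Ext ::
    "('r, 'x) ring_scheme \<Rightarrow> nat \<Rightarrow> ('r, 'a, 'y) module_scheme \<Rightarrow> ('r, 'b, 'z) module_scheme
      \<Rightarrow> ('r, ('r, 'a, 'b) ext) module" where
  "Ext R i A B =
     quot_module ((cochains R A B i)\<lparr>carrier := cocycles R A B i\<rparr>) (coboundaries R A B i)"

text \<open>The map \<open>Ext\<^sup>i(A', B) \<rightarrow> Ext\<^sup>i(A, B)\<close> induced by a linear map \<open>f : A \<rightarrow> A'\<close>.\<close>

definition Ext_map ::
    "('r, 'x) ring_scheme \<Rightarrow> nat \<Rightarrow> ('r, 'a, 'y) module_scheme \<Rightarrow> ('r, 'b, 'z) module_scheme
      \<Rightarrow> ('a \<Rightarrow> 'c) \<Rightarrow> ('r, 'c, 'b) ext \<Rightarrow> ('r, 'a, 'b) ext" where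
  "Ext_map R i A B f C =
     (\<Union>\<psi>\<in>C. coboundaries R A B i +>\<^bsub>cochains R A B i\<^esub>
        (\<lambda>u\<in>carrier (res_module R A i). \<psi> (res_map R f u)))"


section \<open>Direct limits of sequences of modules\<close>

text \<open>
  The limit of \<open>E 0 \<rightarrow> E 1 \<rightarrow> E 2 \<rightarrow> \<dots>\<close> with transition maps \<open>t q : E q \<rightarrow> E (q + 1)\<close>;
  \<open>fold t [p..<n]\<close> is the composite transition map \<open>E p \<rightarrow> E n\<close> for \<open>p \<le> n\<close>.
\<close>

definition dlim_rel ::
    "(nat \<Rightarrow> ('r, 'e, 'y) module_scheme) \<Rightarrow> (nat \<Rightarrow> 'e \<Rightarrow> 'e) \<Rightarrow> ((nat \<times> 'e) \<times> (nat \<times> 'e)) set" where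
  "dlim_rel E t =
     {((p, x), (q, y)). x \<in> carrier (E p) \<and> y \<in> carrier (E q) \<and>
        (\<exists>n. p \<le> n \<and> q \<le> n \<and> fold t [p..<n] x = fold t [q..<n] y)}"

definition direct_limit ::
    "(nat \<Rightarrow> ('r, 'e, 'y) module_scheme) \<Rightarrow> (nat \<Rightarrow> 'e \<Rightarrow> 'e) \<Rightarrow> ('r, (nat \<times> 'e) set) module" where
  "direct_limit E t =
     \<lparr>carrier = (SIGMA q:UNIV. carrier (E q)) // dlim_rel E t,
      monoid.mult = undefined, one = undefined,
      ring.zero = dlim_rel E t `` {(0, \<zero>\<^bsub>E 0\<^esub>)},
      ring.add = (\<lambda>C D. \<Union>(p, x)\<in>C. \<Union>(q, y)\<in>D. dlim_rel E t `` {(max p q,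
        fold t [p..<max p q] x \<oplus>\<^bsub>E (max p q)\<^esub> fold t [q..<max p q] y)}),
      smult = (\<lambda>r C. \<Union>(q, x)\<in>C. dlim_rel E t `` {(q, r \<odot>\<^bsub>E q\<^esub> x)})\<rparr>"


section \<open>Generalized local cohomology\<close>

text \<open>\<open>ideal_pow_mod R I M q\<close> is \<open>I\<^sup>q M\<close>.\<close>

definition ideal_pow_mod ::
    "('r, 'x) ring_scheme \<Rightarrow> 'r set \<Rightarrow> ('r, 'm, 'y) module_scheme \<Rightarrow> nat \<Rightarrow> 'm set" where
  "ideal_pow_mod R I M q = ideal_smult R (I [^]\<^bsub>ideals_set R\<^esub> q) M"

text \<open>
  The transition maps are induced by the projections \<open>M/I\<^bsup>q+1\<^esup>M \<rightarrow> M/I\<^sup>qM\<close>, which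
  enlarge a coset \<open>C\<close> of \<open>I\<^bsup>q+1\<^esup>M\<close> to the coset \<open>I\<^sup>qM + C\<close> of \<open>I\<^sup>qM\<close>.
\<close>

definition gen_local_cohomology ::
    "('r, 'x) ring_scheme \<Rightarrow> 'r set \<Rightarrow> nat
      \<Rightarrow> ('r, 'm, 'y) module_scheme \<Rightarrow> ('r, 'n, 'z) module_scheme
      \<Rightarrow> ('r, (nat \<times> ('r, 'm set, 'n) ext) set) module" where
  "gen_local_cohomology R I i M N =
     direct_limit
       (\<lambda>q. Ext R i (quot_module M (ideal_pow_mod R I M q)) N)
       (\<lambda>q. Ext_map R i (quot_module M (ideal_pow_mod R I M (Suc q))) N
          (\<lambda>C. ideal_pow_mod R I M q <+>\<^bsub>M\<^esub> C))"

definition local_cohomology ::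
    "('r, 'x) ring_scheme \<Rightarrow> 'r set \<Rightarrow> nat \<Rightarrow> ('r, 'n, 'z) module_scheme
      \<Rightarrow> ('r, (nat \<times> ('r, 'r set, 'n) ext) set) module" where
  "local_cohomology R I i N = gen_local_cohomology R I i (ring_module R) N"

text \<open>In \<^typ>\<open>ereal\<close> the infimum of the empty set is \<open>\<infinity>\<close> and the supremum is \<open>-\<infinity>\<close>.\<close>

definition depth_wrt ::
    "('r, 'x) ring_scheme \<Rightarrow> 'r set \<Rightarrow> ('r, 'n, 'z) module_scheme \<Rightarrow> ereal" where
  "depth_wrt R I N = Inf {ereal (real i) | i. nonzero_module (local_cohomology R I i N)}"

definition cd_wrt ::
    "('r, 'x) ring_scheme \<Rightarrow> 'r set \<Rightarrow> ('r, 'n, 'z) module_scheme \<Rightarrow> ereal" where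
  "cd_wrt R I N = Sup {ereal (real i) | i. nonzero_module (local_cohomology R I i N)}"

definition Cohen_Macaulay_wrt ::
    "('r, 'x) ring_scheme \<Rightarrow> 'r set \<Rightarrow> ('r, 'n, 'z) module_scheme \<Rightarrow> bool" where
  "Cohen_Macaulay_wrt R I N \<longleftrightarrow> depth_wrt R I N = cd_wrt R I N"

definition ext_sup ::
    "('r, 'x) ring_scheme \<Rightarrow> ('r, 'a, 'y) module_scheme \<Rightarrow> ('r, 'b, 'z) module_scheme
      \<Rightarrow> ereal" where
  "ext_sup R A B = Sup {ereal (real i) | i. nonzero_module (Ext R i A B)}"

definition h_inv ::
    "('r, 'x) ring_scheme \<Rightarrow> 'r set \<Rightarrow> ('r, 'm, 'y) module_scheme \<Rightarrow> ('r, 'n, 'z) module_scheme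
      \<Rightarrow> ereal" where
  "h_inv R I M N = Sup {ext_sup R M (local_cohomology R I q N) | q :: nat. True}"

end

theory Submission
  imports Defs
begin

text \<open>
  By the Cohen-Macaulay hypothesis only \<open>H\<^sup>c\<^sub>I(N)\<close> with \<open>c = cd\<^sub>I N\<close> is nonzero. By induction on
  \<open>i < c\<close>, \<open>Ext\<^sup>i(A, N) = 0\<close> for every finitely generated module \<open>A\<close> that is killed by a power of \<open>I\<close>:
  once this holds in degree \<open>i - 1\<close>, the system \<open>Ext\<^sup>i(R/I\<^sup>q, N)\<close> has injective transition maps and
  limit \<open>0\<close>, so its terms vanish, and filtrations with cyclic factors give the general case.

  Hence \<open>Ext\<^sup>c(-, N)\<close> is left exact on such modules, and \<open>H\<^sup>c\<^sub>I(M, N)\<close> is an increasing union of the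
  modules \<open>Ext\<^sup>c(M/I\<^sup>qM, N)\<close>. An associated prime \<open>P\<close> of it is the annihilator of some
  \<open>x \<in> Ext\<^sup>c(M/I\<^sup>qM, N)\<close>, and \<open>P\<close> contains \<open>I\<close>. Thus \<open>I\<close> kills \<open>x\<close>, which forces \<open>x\<close> to come from
  \<open>Ext\<^sup>c(M/IM, N)\<close>. This module is weakly Laskerian because \<open>M/IM\<close> is finitely generated, so it
  has only finitely many associated primes.
\<close>

section \<open>Linear maps, quotients and submodules\<close>

text \<open>The standard resolution is functorial but not exact: F_0 is free on the underlying set,
  so for 0 -> K -> B -> C -> 0 the resolutions do not form a short exact sequence of complexes. The
  long exact sequence comes instead from the mapping cone of the inclusion of the resolution of K
  into that of B; it is exact over C and hence comparable with the resolution of C. Ext is handled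
  mostly as cocycles modulo coboundaries, so that two lifts of a map only have to agree up to a
  coboundary. A class x killed by I descends from A = M/I^qM to A/IA = M/IM (q >= 1) because it
  vanishes on IA: for a in I, pulling x back along the surjection A -> aA gives a x = 0, and this
  pullback is injective in degree c, as Ext^(c-1) vanishes on the kernel. Since I is finitely
  generated, IA is assembled from finitely many such aA. Ext^c(M/IM, N) is weakly Laskerian by
  dimension shifting down to Hom(R/J, N), which embeds in N.\<close>

definition linmap ::
    "('r, 'x) ring_scheme \<Rightarrow> ('r, 'a, 'y) module_scheme \<Rightarrow> ('r, 'b, 'z) module_scheme
      \<Rightarrow> ('a \<Rightarrow> 'b) \<Rightarrow> bool" where
  "linmap R A B f \<longleftrightarrow> f \<in> carrier A \<rightarrow> carrier B \<and>
     (\<forall>x\<in>carrier A. \<forall>y\<in>carrier A. f (x \<oplus>\<^bsub>A\<^esub> y) = f x \<oplus>\<^bsub>B\<^esub> f y) \<and>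
     (\<forall>r\<in>carrier R. \<forall>x\<in>carrier A. f (r \<odot>\<^bsub>A\<^esub> x) = r \<odot>\<^bsub>B\<^esub> f x)"

lemma linmapI:
  assumes "\<And>x. x \<in> carrier A \<Longrightarrow> f x \<in> carrier B"
    and "\<And>x y. x \<in> carrier A \<Longrightarrow> y \<in> carrier A \<Longrightarrow> f (x \<oplus>\<^bsub>A\<^esub> y) = f x \<oplus>\<^bsub>B\<^esub> f y"
    and "\<And>r x. r \<in> carrier R \<Longrightarrow> x \<in> carrier A \<Longrightarrow> f (r \<odot>\<^bsub>A\<^esub> x) = r \<odot>\<^bsub>B\<^esub> f x"
  shows "linmap R A B f"
  using assms by (auto simp: linmap_def)

lemma linmap_closed: "linmap R A B f \<Longrightarrow> x \<in> carrier A \<Longrightarrow> f x \<in> carrier B"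
  by (auto simp: linmap_def)

lemma linmap_add:
  "linmap R A B f \<Longrightarrow> x \<in> carrier A \<Longrightarrow> y \<in> carrier A \<Longrightarrow> f (x \<oplus>\<^bsub>A\<^esub> y) = f x \<oplus>\<^bsub>B\<^esub> f y"
  by (auto simp: linmap_def)

lemma linmap_smult:
  "linmap R A B f \<Longrightarrow> r \<in> carrier R \<Longrightarrow> x \<in> carrier A \<Longrightarrow> f (r \<odot>\<^bsub>A\<^esub> x) = r \<odot>\<^bsub>B\<^esub> f x"
  by (auto simp: linmap_def)

lemma (in module) minus_eq_smult:
  "x \<in> carrier M \<Longrightarrow> \<ominus>\<^bsub>M\<^esub> x = (\<ominus> \<one>) \<odot>\<^bsub>M\<^esub> x"
  by (simp add: smult_l_minus)

lemma (in module) diff_zero: "x \<in> carrier M \<Longrightarrow> x \<ominus>\<^bsub>M\<^esub> \<zero>\<^bsub>M\<^esub> = x"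
  by (simp add: M.minus_eq M.add.inv_one)

lemma (in module) diff_self: "x \<in> carrier M \<Longrightarrow> x \<ominus>\<^bsub>M\<^esub> x = \<zero>\<^bsub>M\<^esub>"
  by (simp add: M.minus_eq M.r_neg)

lemma (in module) diff_add_cancel:
  "x \<in> carrier M \<Longrightarrow> y \<in> carrier M \<Longrightarrow> (x \<ominus>\<^bsub>M\<^esub> y) \<oplus>\<^bsub>M\<^esub> y = x"
  by (simp add: M.minus_eq M.a_assoc M.l_neg)

lemma (in module) add_diff_cancel:
  "x \<in> carrier M \<Longrightarrow> y \<in> carrier M \<Longrightarrow> (x \<oplus>\<^bsub>M\<^esub> y) \<ominus>\<^bsub>M\<^esub> y = x"
  by (simp add: M.minus_eq M.a_assoc M.r_neg)

lemma (in module) add_diff_cancel_left: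
  "x \<in> carrier M \<Longrightarrow> y \<in> carrier M \<Longrightarrow> (y \<oplus>\<^bsub>M\<^esub> x) \<ominus>\<^bsub>M\<^esub> y = x"
  using add_diff_cancel[of x y] by (simp add: M.a_comm)

lemma (in module) diff_eq_zero_iff:
  assumes "x \<in> carrier M" "y \<in> carrier M"
  shows "x \<ominus>\<^bsub>M\<^esub> y = \<zero>\<^bsub>M\<^esub> \<longleftrightarrow> x = y"
  using assms diff_add_cancel[of x y] diff_self[of x] by auto

lemma (in module) smult_diff:
  assumes "a \<in> carrier R" "x \<in> carrier M" "y \<in> carrier M"
  shows "a \<odot>\<^bsub>M\<^esub> (x \<ominus>\<^bsub>M\<^esub> y) = a \<odot>\<^bsub>M\<^esub> x \<ominus>\<^bsub>M\<^esub> a \<odot>\<^bsub>M\<^esub> y"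
  using assms by (simp add: M.minus_eq smult_r_distr smult_r_minus)

lemma linmap_zero:
  assumes "module R A" "module R B" "linmap R A B f"
  shows "f \<zero>\<^bsub>A\<^esub> = \<zero>\<^bsub>B\<^esub>"
proof -
  interpret A: module R A by fact
  interpret B: module R B by fact
  have "f (\<zero>\<^bsub>R\<^esub> \<odot>\<^bsub>A\<^esub> \<zero>\<^bsub>A\<^esub>) = \<zero>\<^bsub>R\<^esub> \<odot>\<^bsub>B\<^esub> f \<zero>\<^bsub>A\<^esub>"
    by (rule linmap_smult[OF assms(3)]) auto
  then show ?thesis using linmap_closed[OF assms(3)] by simp
qed

lemma linmap_minus:
  assumes "module R A" "module R B" "linmap R A B f" "x \<in> carrier A"
  shows "f (\<ominus>\<^bsub>A\<^esub> x) = \<ominus>\<^bsub>B\<^esub> f x"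
proof -
  interpret A: module R A by fact
  interpret B: module R B by fact
  show ?thesis
    using assms(4) linmap_closed[OF assms(3)]
    by (simp add: A.minus_eq_smult B.minus_eq_smult linmap_smult[OF assms(3)])
qed

lemma linmap_diff:
  assumes "module R A" "module R B" "linmap R A B f" "x \<in> carrier A" "y \<in> carrier A"
  shows "f (x \<ominus>\<^bsub>A\<^esub> y) = f x \<ominus>\<^bsub>B\<^esub> f y"
proof -
  interpret A: module R A by fact
  interpret B: module R B by fact
  show ?thesis
    using assms linmap_closed[OF assms(3)]
    by (simp add: A.minus_eq B.minus_eq linmap_add[OF assms(3)] linmap_minus)
qed

lemma linmap_cong:
  assumes "\<And>x. x \<in> carrier A \<Longrightarrow> f x = g x" "module R A"
  shows "linmap R A B f \<longleftrightarrow> linmap R A B g"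
proof -
  interpret A: module R A by fact
  show ?thesis unfolding linmap_def using assms(1) by (auto simp: Pi_def)
qed

lemma linmap_id: "linmap R A A (\<lambda>x. x)"
  by (auto simp: linmap_def)

lemma linmap_comp:
  "linmap R A B f \<Longrightarrow> linmap R B C g \<Longrightarrow> linmap R A C (\<lambda>x. g (f x))"
  by (auto simp: linmap_def Pi_def)

lemma linmap_const_zero:
  assumes "module R B"
  shows "linmap R A B (\<lambda>_. \<zero>\<^bsub>B\<^esub>)"
proof -
  interpret B: module R B by fact
  show ?thesis by (auto simp: linmap_def)
qed

lemma linmap_plus:
  assumes "module R B" "linmap R A B f" "linmap R A B g"
  shows "linmap R A B (\<lambda>x. f x \<oplus>\<^bsub>B\<^esub> g x)"
proof -
  interpret B: module R B by fact
  show ?thesis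
    using assms(2,3) by (auto simp: linmap_def Pi_def B.M.a_ac B.smult_r_distr)
qed

lemma linmap_scale:
  assumes "module R B" "linmap R A B f" "r \<in> carrier R"
  shows "linmap R A B (\<lambda>x. r \<odot>\<^bsub>B\<^esub> f x)"
proof -
  interpret B: module R B by fact
  show ?thesis
    using assms(2,3)
    by (auto simp: linmap_def Pi_def B.smult_r_distr B.smult_assoc1[symmetric] B.R.m_comm)
qed

lemma linmap_subtract:
  assumes "module R A" "module R B" "linmap R A B f" "linmap R A B g"
  shows "linmap R A B (\<lambda>x. f x \<ominus>\<^bsub>B\<^esub> g x)"
proof -
  interpret B: module R B by fact
  have "linmap R A B (\<lambda>x. f x \<oplus>\<^bsub>B\<^esub> (\<ominus>\<^bsub>R\<^esub> \<one>\<^bsub>R\<^esub>) \<odot>\<^bsub>B\<^esub> g x)"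
    using assms by (intro linmap_plus linmap_scale) auto
  moreover have "f x \<ominus>\<^bsub>B\<^esub> g x = f x \<oplus>\<^bsub>B\<^esub> (\<ominus>\<^bsub>R\<^esub> \<one>\<^bsub>R\<^esub>) \<odot>\<^bsub>B\<^esub> g x" if "x \<in> carrier A" for x
    using linmap_closed[OF assms(4) that] by (simp add: B.minus_eq B.minus_eq_smult)
  ultimately show ?thesis by (simp cong: linmap_cong[OF _ assms(1)])
qed

lemma linmap_from_sub:
  "linmap R A B f \<Longrightarrow> U \<subseteq> carrier A \<Longrightarrow> linmap R (A\<lparr>carrier := U\<rparr>) B f"
  by (auto simp: linmap_def subset_iff)

lemma linmap_into_sub:
  "linmap R A B f \<Longrightarrow> (\<And>x. x \<in> carrier A \<Longrightarrow> f x \<in> U) \<Longrightarrow> linmap R A (B\<lparr>carrier := U\<rparr>) f"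
  by (auto simp: linmap_def)

lemma linmap_out_of_sub:
  "linmap R A (B\<lparr>carrier := U\<rparr>) f \<Longrightarrow> U \<subseteq> carrier B \<Longrightarrow> linmap R A B f"
  by (auto simp: linmap_def)

lemma linmap_smult_self:
  assumes "module R B" "r \<in> carrier R"
  shows "linmap R B B (\<lambda>x. r \<odot>\<^bsub>B\<^esub> x)"
  using linmap_scale[OF assms(1) linmap_id assms(2)] .

text \<open>Negation is multiplication by -1, so closure under it follows from the other conditions;
  membership of zero replaces nonemptiness.\<close>

lemma submodule_iff:
  assumes "module R M"
  shows "submodule U R M \<longleftrightarrow> U \<subseteq> carrier M \<and> \<zero>\<^bsub>M\<^esub> \<in> U \<and>
    (\<forall>x\<in>U. \<forall>y\<in>U. x \<oplus>\<^bsub>M\<^esub> y \<in> U) \<and> (\<forall>r\<in>carrier R. \<forall>x\<in>U. r \<odot>\<^bsub>M\<^esub> x \<in> U)"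
proof -
  interpret module R M by fact
  show ?thesis
  proof
    assume "submodule U R M"
    note E = submoduleE[OF this]
    obtain x where "x \<in> U" using E(2) by auto
    then have "\<zero>\<^bsub>R\<^esub> \<odot>\<^bsub>M\<^esub> x \<in> U" "x \<in> carrier M" using E(1,4) by auto
    with E show "U \<subseteq> carrier M \<and> \<zero>\<^bsub>M\<^esub> \<in> U \<and>
      (\<forall>x\<in>U. \<forall>y\<in>U. x \<oplus>\<^bsub>M\<^esub> y \<in> U) \<and> (\<forall>r\<in>carrier R. \<forall>x\<in>U. r \<odot>\<^bsub>M\<^esub> x \<in> U)" by auto
  next
    assume *: "U \<subseteq> carrier M \<and> \<zero>\<^bsub>M\<^esub> \<in> U \<and>
      (\<forall>x\<in>U. \<forall>y\<in>U. x \<oplus>\<^bsub>M\<^esub> y \<in> U) \<and> (\<forall>r\<in>carrier R. \<forall>x\<in>U. r \<odot>\<^bsub>M\<^esub> x \<in> U)"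
    show "submodule U R M"
      by (rule submoduleI) (use * in \<open>auto simp: minus_eq_smult subset_iff\<close>)
  qed
qed

lemma submodule_props:
  assumes "module R M" "submodule U R M"
  shows "U \<subseteq> carrier M" "\<zero>\<^bsub>M\<^esub> \<in> U"
    and "\<And>x y. x \<in> U \<Longrightarrow> y \<in> U \<Longrightarrow> x \<oplus>\<^bsub>M\<^esub> y \<in> U"
    and "\<And>r x. r \<in> carrier R \<Longrightarrow> x \<in> U \<Longrightarrow> r \<odot>\<^bsub>M\<^esub> x \<in> U"
    and "\<And>x y. x \<in> U \<Longrightarrow> y \<in> U \<Longrightarrow> x \<ominus>\<^bsub>M\<^esub> y \<in> U"
proof -
  interpret module R M by fact
  note U = assms(2)[unfolded submodule_iff[OF assms(1)]]
  from U show "U \<subseteq> carrier M" "\<zero>\<^bsub>M\<^esub> \<in> U"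
    "\<And>x y. x \<in> U \<Longrightarrow> y \<in> U \<Longrightarrow> x \<oplus>\<^bsub>M\<^esub> y \<in> U"
    "\<And>r x. r \<in> carrier R \<Longrightarrow> x \<in> U \<Longrightarrow> r \<odot>\<^bsub>M\<^esub> x \<in> U" by auto
  fix x y assume "x \<in> U" "y \<in> U"
  with U show "x \<ominus>\<^bsub>M\<^esub> y \<in> U" using submoduleE(3)[OF assms(2)] by (auto simp: M.minus_eq)
qed

lemma module_submodule:
  "module R M \<Longrightarrow> submodule U R M \<Longrightarrow> module R (M\<lparr>carrier := U\<rparr>)"
  by (rule submodule.submodule_is_module)

lemma submodule_kernel:
  assumes "module R A" "module R B" "linmap R A B f"
  shows "submodule {x \<in> carrier A. f x = \<zero>\<^bsub>B\<^esub>} R A"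
proof -
  interpret A: module R A by fact
  interpret B: module R B by fact
  show ?thesis
    by (auto simp: submodule_iff[OF assms(1)] linmap_zero[OF assms] linmap_add[OF assms(3)]
        linmap_smult[OF assms(3)])
qed

lemma submodule_vimage:
  assumes "module R A" "module R B" "linmap R A B f" "submodule U R B"
  shows "submodule {x \<in> carrier A. f x \<in> U} R A"
proof -
  interpret A: module R A by fact
  interpret B: module R B by fact
  show ?thesis
    using submodule_props[OF assms(2,4)]
    by (auto simp: submodule_iff[OF assms(1)] linmap_zero[OF assms(1-3)] linmap_add[OF assms(3)]
        linmap_smult[OF assms(3)])
qed

text \<open>Sums of this shape occur throughout: adjoining a generator x (f r = r x), adjoining aA
  (f z = a z), and both auxiliary submodules \<open>W\<close> and \<open>V3\<close> in
  \<open>wl_exact\<close>.\<close>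

lemma submodule_image_plus:
  assumes "module R A" "module R B" "linmap R A B f" "submodule U R B"
  shows "submodule {u \<oplus>\<^bsub>B\<^esub> f z | u z. u \<in> U \<and> z \<in> carrier A} R B"
proof -
  interpret A: module R A by fact
  interpret B: module R B by fact
  note U = submodule_props[OF assms(2,4)]
  note f = linmap_closed[OF assms(3)]
  show ?thesis unfolding submodule_iff[OF assms(2)]
  proof (intro conjI ballI)
    show "{u \<oplus>\<^bsub>B\<^esub> f z | u z. u \<in> U \<and> z \<in> carrier A} \<subseteq> carrier B" using U(1) f by auto
    show "\<zero>\<^bsub>B\<^esub> \<in> {u \<oplus>\<^bsub>B\<^esub> f z | u z. u \<in> U \<and> z \<in> carrier A}"
      using U(2) linmap_zero[OF assms(1-3)]
      by (auto intro!: exI[of _ "\<zero>\<^bsub>B\<^esub>"] exI[of _ "\<zero>\<^bsub>A\<^esub>"])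
  next
    fix x y assume "x \<in> {u \<oplus>\<^bsub>B\<^esub> f z | u z. u \<in> U \<and> z \<in> carrier A}"
      "y \<in> {u \<oplus>\<^bsub>B\<^esub> f z | u z. u \<in> U \<and> z \<in> carrier A}"
    then obtain u z v w where *: "x = u \<oplus>\<^bsub>B\<^esub> f z" "y = v \<oplus>\<^bsub>B\<^esub> f w" "u \<in> U" "v \<in> U"
      "z \<in> carrier A" "w \<in> carrier A" by blast
    then have "x \<oplus>\<^bsub>B\<^esub> y = (u \<oplus>\<^bsub>B\<^esub> v) \<oplus>\<^bsub>B\<^esub> f (z \<oplus>\<^bsub>A\<^esub> w)"
      using U(1) f by (auto simp: linmap_add[OF assms(3)] B.M.a_ac subset_iff)
    then show "x \<oplus>\<^bsub>B\<^esub> y \<in> {u \<oplus>\<^bsub>B\<^esub> f z | u z. u \<in> U \<and> z \<in> carrier A}"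
      using * U(3) by blast
  next
    fix r x assume r: "r \<in> carrier R" and "x \<in> {u \<oplus>\<^bsub>B\<^esub> f z | u z. u \<in> U \<and> z \<in> carrier A}"
    then obtain u z where *: "x = u \<oplus>\<^bsub>B\<^esub> f z" "u \<in> U" "z \<in> carrier A" by blast
    then have "r \<odot>\<^bsub>B\<^esub> x = r \<odot>\<^bsub>B\<^esub> u \<oplus>\<^bsub>B\<^esub> f (r \<odot>\<^bsub>A\<^esub> z)"
      using r U(1) f by (auto simp: linmap_smult[OF assms(3)] B.smult_r_distr subset_iff)
    then show "r \<odot>\<^bsub>B\<^esub> x \<in> {u \<oplus>\<^bsub>B\<^esub> f z | u z. u \<in> U \<and> z \<in> carrier A}"
      using * r U(4) A.smult_closed by blast
  qed
qed

lemma submodule_zero: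
  assumes "module R A"
  shows "submodule {\<zero>\<^bsub>A\<^esub>} R A"
proof -
  interpret A: module R A by fact
  show ?thesis by (auto simp: submodule_iff[OF assms])
qed

subsection \<open>Quotients\<close>

lemma abelian_subgroup_submodule:
  assumes "module R M" "submodule U R M"
  shows "abelian_subgroup U M"
proof -
  interpret module R M by fact
  show ?thesis
    using submodule.axioms(1)[OF assms(2)]
    by (intro abelian_subgroupI3 additive_subgroupI M.abelian_group_axioms)
qed

lemma mem_rcos_iff:
  assumes "module R M" "submodule U R M" "x \<in> carrier M" "y \<in> carrier M"
  shows "y \<in> U +>\<^bsub>M\<^esub> x \<longleftrightarrow> y \<ominus>\<^bsub>M\<^esub> x \<in> U"
proof -
  interpret U: abelian_subgroup U M by (rule abelian_subgroup_submodule) fact+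
  show ?thesis using U.a_rcos_module[of x y] assms by (simp add: a_minus_def)
qed

lemma rcos_eq_iff:
  assumes "module R M" "submodule U R M" "x \<in> carrier M" "y \<in> carrier M"
  shows "U +>\<^bsub>M\<^esub> x = U +>\<^bsub>M\<^esub> y \<longleftrightarrow> x \<ominus>\<^bsub>M\<^esub> y \<in> U"
proof -
  interpret U: abelian_subgroup U M by (rule abelian_subgroup_submodule) fact+
  show ?thesis using mem_rcos_iff[OF assms(1,2,4,3)]
    by (metis U.a_repr_independence' U.a_repr_independenceD assms(3,4))
qed

lemma rcos_eq_self_iff:
  assumes "module R M" "submodule U R M" "x \<in> carrier M"
  shows "U +>\<^bsub>M\<^esub> x = U \<longleftrightarrow> x \<in> U"
proof -
  interpret M: module R M by fact
  have "U +>\<^bsub>M\<^esub> \<zero>\<^bsub>M\<^esub> = U" using submodule_props(1)[OF assms(1,2)] by simp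
  moreover have "x \<ominus>\<^bsub>M\<^esub> \<zero>\<^bsub>M\<^esub> = x"
    using assms(3) by (rule M.diff_zero)
  ultimately show ?thesis using rcos_eq_iff[OF assms M.M.zero_closed] by simp
qed

lemma quot_module_carrier:
  "carrier (quot_module M U) = {U +>\<^bsub>M\<^esub> x | x. x \<in> carrier M}"
  by (auto simp: quot_module_def A_RCOSETS_def' )

lemma quot_module_closed: "x \<in> carrier M \<Longrightarrow> U +>\<^bsub>M\<^esub> x \<in> carrier (quot_module M U)"
  by (auto simp only: quot_module_carrier)

lemma quot_moduleE:
  assumes "C \<in> carrier (quot_module M U)"
  obtains x where "x \<in> carrier M" "C = U +>\<^bsub>M\<^esub> x"
  using assms by (auto simp only: quot_module_carrier)

lemma quot_module_simps:
  assumes "module R M" "submodule U R M"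
  shows "\<zero>\<^bsub>quot_module M U\<^esub> = U"
    and "x \<in> carrier M \<Longrightarrow> y \<in> carrier M \<Longrightarrow>
      (U +>\<^bsub>M\<^esub> x) \<oplus>\<^bsub>quot_module M U\<^esub> (U +>\<^bsub>M\<^esub> y) = U +>\<^bsub>M\<^esub> (x \<oplus>\<^bsub>M\<^esub> y)"
    and "r \<in> carrier R \<Longrightarrow> x \<in> carrier M \<Longrightarrow>
      r \<odot>\<^bsub>quot_module M U\<^esub> (U +>\<^bsub>M\<^esub> x) = U +>\<^bsub>M\<^esub> (r \<odot>\<^bsub>M\<^esub> x)"
proof -
  interpret M: module R M by fact
  interpret U: abelian_subgroup U M by (rule abelian_subgroup_submodule) fact+
  note U = submodule_props[OF assms]
  show "\<zero>\<^bsub>quot_module M U\<^esub> = U" by (simp add: quot_module_def)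
  show "(U +>\<^bsub>M\<^esub> x) \<oplus>\<^bsub>quot_module M U\<^esub> (U +>\<^bsub>M\<^esub> y) = U +>\<^bsub>M\<^esub> (x \<oplus>\<^bsub>M\<^esub> y)"
    if "x \<in> carrier M" "y \<in> carrier M"
    using that by (simp add: quot_module_def U.a_rcos_sum)
  assume r: "r \<in> carrier R" and x: "x \<in> carrier M"
  \<comment> \<open>The scalar action is a union over representatives; all representatives give the
    same coset, so the union collapses.\<close>
  have "U +>\<^bsub>M\<^esub> (r \<odot>\<^bsub>M\<^esub> y) = U +>\<^bsub>M\<^esub> (r \<odot>\<^bsub>M\<^esub> x)" if "y \<in> U +>\<^bsub>M\<^esub> x" for y
  proof -
    have y: "y \<in> carrier M" using that x U.a_elemrcos_carrier M.M.abelian_group_axioms by blast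
    then have "y \<ominus>\<^bsub>M\<^esub> x \<in> U" using that mem_rcos_iff[OF assms x] by simp
    then have "r \<odot>\<^bsub>M\<^esub> y \<ominus>\<^bsub>M\<^esub> r \<odot>\<^bsub>M\<^esub> x \<in> U" using U(4) r x y by (simp flip: M.smult_diff)
    then show ?thesis using rcos_eq_iff[OF assms] r x y by simp
  qed
  note eq = this
  have "U +>\<^bsub>M\<^esub> x \<noteq> {}" using U.a_rcos_self[OF x] by blast
  then have "(\<Union>y\<in>U +>\<^bsub>M\<^esub> x. U +>\<^bsub>M\<^esub> (r \<odot>\<^bsub>M\<^esub> y)) = U +>\<^bsub>M\<^esub> (r \<odot>\<^bsub>M\<^esub> x)"
    by (rule SUP_eq_const[OF _ eq])
  then show "r \<odot>\<^bsub>quot_module M U\<^esub> (U +>\<^bsub>M\<^esub> x) = U +>\<^bsub>M\<^esub> (r \<odot>\<^bsub>M\<^esub> x)"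
    by (simp only: quot_module_def module.select_convs)
qed

lemma module_quot_module:
  assumes "module R M" "submodule U R M"
  shows "module R (quot_module M U)"
proof -
  interpret M: module R M by fact
  note Q = quot_module_simps[OF assms]
  note cl = quot_module_closed[of _ M U] and elim = quot_moduleE[of _ M U]
  have z: "\<zero>\<^bsub>quot_module M U\<^esub> = U +>\<^bsub>M\<^esub> \<zero>\<^bsub>M\<^esub>"
    using submodule_props(1)[OF assms] by (simp add: Q(1))
  show ?thesis
  proof (rule moduleI)
    show "abelian_group (quot_module M U)"
    proof (rule abelian_groupI)
      fix C assume "C \<in> carrier (quot_module M U)"
      then obtain x where x: "x \<in> carrier M" "C = U +>\<^bsub>M\<^esub> x" by (rule elim)
      then show "\<exists>D\<in>carrier (quot_module M U). D \<oplus>\<^bsub>quot_module M U\<^esub> C = \<zero>\<^bsub>quot_module M U\<^esub>"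
        by (intro bexI[of _ "U +>\<^bsub>M\<^esub> (\<ominus>\<^bsub>M\<^esub> x)"]) (simp_all only: Q(2) z M.M.l_neg cl M.M.a_inv_closed)
    qed ((elim elim)?, simp_all only: Q(2) z M.M.a_ac M.M.l_zero M.M.r_zero M.M.zero_closed M.M.a_closed cl)+
  qed ((elim elim)?, simp_all only: Q(2,3) M.smult_l_distr M.smult_r_distr M.smult_assoc1 M.smult_one M.R.one_closed
      M.smult_closed M.M.a_closed M.R.a_closed M.R.m_closed M.R.is_cring cl)+
qed

lemma linmap_quot:
  assumes "module R M" "submodule U R M"
  shows "linmap R M (quot_module M U) (\<lambda>x. U +>\<^bsub>M\<^esub> x)"
  by (rule linmapI) (simp_all add: quot_module_simps[OF assms] quot_module_closed)

lemma quot_map_eq_zero_iff: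
  assumes "module R M" "submodule U R M" "x \<in> carrier M"
  shows "U +>\<^bsub>M\<^esub> x = \<zero>\<^bsub>quot_module M U\<^esub> \<longleftrightarrow> x \<in> U"
  by (simp add: quot_module_simps(1)[OF assms(1,2)] rcos_eq_self_iff[OF assms])

text \<open>The transition maps of the direct system add V to a coset as a set; this identifies them
  with the projection M/U -> M/V.\<close>

lemma set_add_rcos:
  assumes "module R M" "submodule U R M" "submodule V R M" "U \<subseteq> V" "x \<in> carrier M"
  shows "V <+>\<^bsub>M\<^esub> (U +>\<^bsub>M\<^esub> x) = V +>\<^bsub>M\<^esub> x"
proof -
  interpret M: module R M by fact
  note U = submodule_props[OF assms(1,2)]
  note V = submodule_props[OF assms(1,3)]
  have "V <+>\<^bsub>M\<^esub> (U +>\<^bsub>M\<^esub> x) = (V <+>\<^bsub>M\<^esub> U) +>\<^bsub>M\<^esub> x"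
    using M.a_setmult_rcos_assoc[of V U x] U(1) V(1) assms(5) by simp
  also have "V <+>\<^bsub>M\<^esub> U = V"
  proof
    show "V <+>\<^bsub>M\<^esub> U \<subseteq> V" using V(3) assms(4) by (auto simp: set_add_def')
    show "V \<subseteq> V <+>\<^bsub>M\<^esub> U"
    proof
      fix v assume "v \<in> V"
      then have "v = v \<oplus>\<^bsub>M\<^esub> \<zero>\<^bsub>M\<^esub>" using V(1) by auto
      then show "v \<in> V <+>\<^bsub>M\<^esub> U" using \<open>v \<in> V\<close> U(2) by (auto simp: set_add_def')
    qed
  qed
  finally show ?thesis .
qed

lemma linmap_quot_quot:
  assumes "module R M" "submodule U R M" "submodule V R M" "U \<subseteq> V"
  shows "linmap R (quot_module M U) (quot_module M V) (\<lambda>C. V <+>\<^bsub>M\<^esub> C)"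
proof -
  interpret M: module R M by fact
  note simps = quot_module_simps(2,3)[OF assms(1,2)] quot_module_simps(2,3)[OF assms(1,3)]
    set_add_rcos[OF assms] quot_module_closed M.M.a_closed M.smult_closed
  show ?thesis
    by (rule linmapI; elim quot_moduleE; simp only: simps)
qed

subsection \<open>Associated primes relative to a submodule\<close>

text \<open>Associated primes of Z/U through representatives in Z, so that arguments about quotients
  of quotients stay inside Z.\<close>

definition Ass_rel ::
    "('r, 'x) ring_scheme \<Rightarrow> ('r, 'm, 'y) module_scheme \<Rightarrow> 'm set \<Rightarrow> 'r set set" where
  "Ass_rel R Z U = {P. primeideal P R \<and> (\<exists>x\<in>carrier Z. P = {r \<in> carrier R. r \<odot>\<^bsub>Z\<^esub> x \<in> U})}"

lemma Ass_quot_module: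
  assumes "module R M" "submodule U R M"
  shows "Ass R (quot_module M U) = Ass_rel R M U"
proof -
  interpret M: module R M by fact
  have "annihilator R (quot_module M U) (U +>\<^bsub>M\<^esub> x) = {r \<in> carrier R. r \<odot>\<^bsub>M\<^esub> x \<in> U}"
    if "x \<in> carrier M" for x
    unfolding annihilator_def
    by (rule Collect_cong)
      (use that quot_map_eq_zero_iff[OF assms, of "_ \<odot>\<^bsub>M\<^esub> x"] in
        \<open>simp add: quot_module_simps(3)[OF assms] cong: conj_cong\<close>)
  note ann = this
  show ?thesis
  proof (intro equalityI subsetI)
    fix P assume "P \<in> Ass R (quot_module M U)"
    then obtain C where P: "primeideal P R" "C \<in> carrier (quot_module M U)"
      "P = annihilator R (quot_module M U) C" by (auto simp only: Ass_def)
    from P(2) obtain x where x: "x \<in> carrier M" "C = U +>\<^bsub>M\<^esub> x" by (rule quot_moduleE)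
    then show "P \<in> Ass_rel R M U" using P ann[OF x(1)] by (auto simp only: Ass_rel_def)
  next
    fix P assume "P \<in> Ass_rel R M U"
    then obtain x where P: "primeideal P R" "x \<in> carrier M"
      "P = {r \<in> carrier R. r \<odot>\<^bsub>M\<^esub> x \<in> U}" by (auto simp only: Ass_rel_def)
    then have "P = annihilator R (quot_module M U) (U +>\<^bsub>M\<^esub> x)" using ann by simp
    then show "P \<in> Ass R (quot_module M U)"
      using P quot_module_closed[OF P(2), of U] by (auto simp only: Ass_def)
  qed
qed

text \<open>\<open>wl R Z U\<close> says that \<open>Z/U\<close> is weakly Laskerian.\<close>

definition wl :: "('r, 'x) ring_scheme \<Rightarrow> ('r, 'm, 'y) module_scheme \<Rightarrow> 'm set \<Rightarrow> bool" where
  "wl R Z U \<longleftrightarrow> (\<forall>V. submodule V R Z \<longrightarrow> U \<subseteq> V \<longrightarrow> finite (Ass_rel R Z V))"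

lemma weakly_Laskerian_wl:
  assumes "weakly_Laskerian R N"
  shows "wl R N U"
  using assms by (auto simp: weakly_Laskerian_def wl_def Ass_quot_module)

lemma primeideal_ne_carrier: "primeideal P R \<Longrightarrow> P \<noteq> carrier R"
  using primeideal.I_notcarr by blast

lemma wl_carrier:
  assumes "module R Z" "carrier Z \<subseteq> U"
  shows "wl R Z U"
proof -
  interpret Z: module R Z by fact
  have "Ass_rel R Z V = {}" if "submodule V R Z" "U \<subseteq> V" for V
  proof -
    have "{r \<in> carrier R. r \<odot>\<^bsub>Z\<^esub> x \<in> V} = carrier R" if "x \<in> carrier Z" for x
      using that assms(2) \<open>U \<subseteq> V\<close> by auto
    then show ?thesis by (auto simp: Ass_rel_def dest: primeideal_ne_carrier)
  qed
  then show ?thesis by (simp add: wl_def)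
qed

text \<open>
  Let \<open>P\<close> be an associated prime of a quotient of \<open>Z\<^sub>2/U\<^sub>2\<close>, say the annihilator of \<open>y\<close>. If some
  \<open>r \<notin> P\<close> moves \<open>y\<close> into the image of \<open>Z\<^sub>1\<close>, then \<open>P\<close> is associated to a quotient of \<open>Z\<^sub>1/U\<^sub>1\<close>, and
  otherwise to a quotient of \<open>Z\<^sub>3/U\<^sub>3\<close>.
\<close>

lemma wl_exact:
  assumes M: "module R Z1" "module R Z2" "module R Z3"
    and U: "submodule U3 R Z3"
    and \<alpha>: "linmap R Z1 Z2 \<alpha>" "\<And>x. x \<in> U1 \<Longrightarrow> \<alpha> x \<in> U2" "U1 \<subseteq> carrier Z1"
    and \<beta>: "linmap R Z2 Z3 \<beta>"
    and ex: "\<And>y. y \<in> carrier Z2 \<Longrightarrow> \<beta> y \<in> U3 \<Longrightarrow> \<exists>x\<in>carrier Z1. y \<ominus>\<^bsub>Z2\<^esub> \<alpha> x \<in> U2"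
    and wl: "wl R Z1 U1" "wl R Z3 U3"
  shows "wl R Z2 U2"
  unfolding wl_def
proof (intro allI impI)
  fix V assume V: "submodule V R Z2" "U2 \<subseteq> V"
  interpret Z1: module R Z1 by fact
  interpret Z2: module R Z2 by fact
  interpret Z3: module R Z3 by fact
  note V' = submodule_props[OF M(2) V(1)]
  \<comment> \<open>W/V is isomorphic to Z1/V1. By \<open>key\<close>, \<open>W\<close> is the full
    preimage of \<open>V3\<close>, so Z2/W embeds in Z3/V3.\<close>
  define W where "W = {u \<oplus>\<^bsub>Z2\<^esub> \<alpha> z | u z. u \<in> V \<and> z \<in> carrier Z1}"
  define V1 where "V1 = {x \<in> carrier Z1. \<alpha> x \<in> V}"
  define V3 where "V3 = {u \<oplus>\<^bsub>Z3\<^esub> \<beta> z | u z. u \<in> U3 \<and> z \<in> carrier (Z2\<lparr>carrier := W\<rparr>)}"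
  have W: "submodule W R Z2"
    unfolding W_def by (rule submodule_image_plus[OF M(1,2) \<alpha>(1) V(1)])
  note W' = submodule_props[OF M(2) W]
  have VW: "V \<subseteq> W"
  proof
    fix v assume "v \<in> V"
    then have "v = v \<oplus>\<^bsub>Z2\<^esub> \<alpha> \<zero>\<^bsub>Z1\<^esub>"
      using V'(1) linmap_zero[OF M(1,2) \<alpha>(1)] by auto
    then show "v \<in> W" using \<open>v \<in> V\<close> unfolding W_def by blast
  qed
  have imW: "\<alpha> x \<in> W" if "x \<in> carrier Z1" for x
  proof -
    have "\<alpha> x = \<zero>\<^bsub>Z2\<^esub> \<oplus>\<^bsub>Z2\<^esub> \<alpha> x" using linmap_closed[OF \<alpha>(1) that] by simp
    then show ?thesis unfolding W_def using that V'(2) by blast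
  qed
  have "submodule V1 R Z1" unfolding V1_def by (rule submodule_vimage[OF M(1,2) \<alpha>(1) V(1)])
  moreover have "U1 \<subseteq> V1" using \<alpha> V(2) by (auto simp: V1_def)
  ultimately have fin1: "finite (Ass_rel R Z1 V1)" using wl(1) by (simp add: wl_def)
  have V3: "submodule V3 R Z3" unfolding V3_def
    by (rule submodule_image_plus[OF module_submodule[OF M(2) W] M(3) _ U])
      (rule linmap_from_sub[OF \<beta> W'(1)])
  have "U3 \<subseteq> V3"
  proof
    fix v assume "v \<in> U3"
    then have "v = v \<oplus>\<^bsub>Z3\<^esub> \<beta> \<zero>\<^bsub>Z2\<^esub>"
      using submodule_props(1)[OF M(3) U] linmap_zero[OF M(2,3) \<beta>] by auto
    then show "v \<in> V3" using \<open>v \<in> U3\<close> W'(2) unfolding V3_def by auto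
  qed
  with V3 have fin3: "finite (Ass_rel R Z3 V3)" using wl(2) by (simp add: wl_def)
  \<comment> \<open>If \<open>\<beta>\<close> y and \<open>\<beta>\<close> w agree modulo
    \<open>U3\<close>, exactness writes y - w as \<open>\<alpha>\<close> x modulo \<open>U2\<close>;
    and \<open>U2\<close>, w and the image of \<open>\<alpha>\<close> all lie in
    \<open>W\<close>.\<close>
  have key: "\<beta> y \<in> V3 \<longleftrightarrow> y \<in> W" if y: "y \<in> carrier Z2" for y
  proof
    assume "y \<in> W"
    then show "\<beta> y \<in> V3" using submodule_props(2)[OF M(3) U] linmap_closed[OF \<beta> y]
      unfolding V3_def by (auto intro!: exI[of _ "\<zero>\<^bsub>Z3\<^esub>"] exI[of _ y])
  next
    assume "\<beta> y \<in> V3"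
    then obtain u w where uw: "\<beta> y = u \<oplus>\<^bsub>Z3\<^esub> \<beta> w" "u \<in> U3" "w \<in> W" unfolding V3_def by auto
    have w: "w \<in> carrier Z2" and u: "u \<in> carrier Z3"
      using uw W'(1) submodule_props(1)[OF M(3) U] by auto
    have "\<beta> (y \<ominus>\<^bsub>Z2\<^esub> w) = u"
      using uw(1) u y w linmap_closed[OF \<beta> w]
      by (simp add: linmap_diff[OF M(2,3) \<beta>] Z3.M.minus_eq Z3.M.a_assoc Z3.M.r_neg)
    then obtain x where x: "x \<in> carrier Z1" "(y \<ominus>\<^bsub>Z2\<^esub> w) \<ominus>\<^bsub>Z2\<^esub> \<alpha> x \<in> U2"
      using ex[of "y \<ominus>\<^bsub>Z2\<^esub> w"] y w uw(2) by auto
    have "((y \<ominus>\<^bsub>Z2\<^esub> w) \<ominus>\<^bsub>Z2\<^esub> \<alpha> x) \<oplus>\<^bsub>Z2\<^esub> \<alpha> x \<oplus>\<^bsub>Z2\<^esub> w = y"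
      using y w linmap_closed[OF \<alpha>(1) x(1)]
      by (simp add: a_minus_def Z2.M.a_assoc Z2.M.l_neg)
    moreover have "((y \<ominus>\<^bsub>Z2\<^esub> w) \<ominus>\<^bsub>Z2\<^esub> \<alpha> x) \<oplus>\<^bsub>Z2\<^esub> \<alpha> x \<oplus>\<^bsub>Z2\<^esub> w \<in> W"
      using x V(2) VW imW[OF x(1)] uw(3) by (intro W'(3)) auto
    ultimately show "y \<in> W" by simp
  qed
  have "Ass_rel R Z2 V \<subseteq> Ass_rel R Z1 V1 \<union> Ass_rel R Z3 V3"
  proof
    fix P assume "P \<in> Ass_rel R Z2 V"
    then obtain y where P: "primeideal P R" and y: "y \<in> carrier Z2"
      and Py: "P = {r \<in> carrier R. r \<odot>\<^bsub>Z2\<^esub> y \<in> V}" by (auto simp: Ass_rel_def)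
    have memP: "t \<in> P \<longleftrightarrow> t \<in> carrier R \<and> t \<odot>\<^bsub>Z2\<^esub> y \<in> V" for t using Py by blast
    interpret P: primeideal P R by fact
    show "P \<in> Ass_rel R Z1 V1 \<union> Ass_rel R Z3 V3"
    proof (cases "\<exists>r\<in>carrier R. r \<notin> P \<and> r \<odot>\<^bsub>Z2\<^esub> y \<in> W")
      case True
      then obtain r u x where r: "r \<in> carrier R" "r \<notin> P" "r \<odot>\<^bsub>Z2\<^esub> y = u \<oplus>\<^bsub>Z2\<^esub> \<alpha> x"
        "u \<in> V" "x \<in> carrier Z1" unfolding W_def by auto
      \<comment> \<open>P is prime and r lies outside it, so s is in P iff s r is; modulo
        \<open>V\<close> the element r y equals \<open>\<alpha>\<close> x, whose annihilator is
        computed in Z1/V1.\<close>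
      have "s \<in> P \<longleftrightarrow> s \<odot>\<^bsub>Z1\<^esub> x \<in> V1" if s: "s \<in> carrier R" for s
      proof -
        have \<alpha>x: "\<alpha> x \<in> carrier Z2" and u: "u \<in> carrier Z2"
          using r V'(1) linmap_closed[OF \<alpha>(1)] by auto
        have "s \<in> P \<longleftrightarrow> s \<otimes>\<^bsub>R\<^esub> r \<in> P"
          using P.I_prime[OF s r(1)] r(1,2) P.I_r_closed by blast
        also have "\<dots> \<longleftrightarrow> (s \<otimes>\<^bsub>R\<^esub> r) \<odot>\<^bsub>Z2\<^esub> y \<in> V" using memP[of "s \<otimes>\<^bsub>R\<^esub> r"] s r(1) by blast
        also have "(s \<otimes>\<^bsub>R\<^esub> r) \<odot>\<^bsub>Z2\<^esub> y = s \<odot>\<^bsub>Z2\<^esub> u \<oplus>\<^bsub>Z2\<^esub> s \<odot>\<^bsub>Z2\<^esub> \<alpha> x"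
          using s r(1,3) y u \<alpha>x by (simp add: Z2.smult_assoc1 Z2.smult_r_distr)
        also have "\<dots> \<in> V \<longleftrightarrow> s \<odot>\<^bsub>Z2\<^esub> \<alpha> x \<in> V"
        proof
          assume "s \<odot>\<^bsub>Z2\<^esub> u \<oplus>\<^bsub>Z2\<^esub> s \<odot>\<^bsub>Z2\<^esub> \<alpha> x \<in> V"
          then have "(s \<odot>\<^bsub>Z2\<^esub> u \<oplus>\<^bsub>Z2\<^esub> s \<odot>\<^bsub>Z2\<^esub> \<alpha> x) \<ominus>\<^bsub>Z2\<^esub> s \<odot>\<^bsub>Z2\<^esub> u \<in> V"
            using V'(4)[OF s r(4)] by (rule V'(5))
          moreover have "(s \<odot>\<^bsub>Z2\<^esub> u \<oplus>\<^bsub>Z2\<^esub> s \<odot>\<^bsub>Z2\<^esub> \<alpha> x) \<ominus>\<^bsub>Z2\<^esub> s \<odot>\<^bsub>Z2\<^esub> u = s \<odot>\<^bsub>Z2\<^esub> \<alpha> x"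
            using s u \<alpha>x by (simp add: Z2.add_diff_cancel_left)
          ultimately show "s \<odot>\<^bsub>Z2\<^esub> \<alpha> x \<in> V" by simp
        qed (use V'(3,4) r s in auto)
        also have "\<dots> \<longleftrightarrow> s \<odot>\<^bsub>Z1\<^esub> x \<in> V1"
          using s r by (simp add: V1_def linmap_smult[OF \<alpha>(1)])
        finally show ?thesis .
      qed
      then have "P = {s \<in> carrier R. s \<odot>\<^bsub>Z1\<^esub> x \<in> V1}" using P.a_subset by blast
      then show ?thesis using P r(5) unfolding Ass_rel_def by blast
    next
      case False
      \<comment> \<open>No r outside P moves y into \<open>W\<close>, so the annihilator does not
        grow when \<open>V\<close> is replaced by \<open>W\<close>.\<close>
      then have "P = {r \<in> carrier R. r \<odot>\<^bsub>Z2\<^esub> y \<in> W}" using VW P.a_subset memP by blast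
      also have "\<dots> = {r \<in> carrier R. r \<odot>\<^bsub>Z3\<^esub> \<beta> y \<in> V3}"
        using y key by (auto simp flip: linmap_smult[OF \<beta>])
      finally show ?thesis using P linmap_closed[OF \<beta> y] unfolding Ass_rel_def by blast
    qed
  qed
  then show "finite (Ass_rel R Z2 V)" using fin1 fin3 finite_subset by blast
qed

section \<open>Maps out of the standard resolution\<close>

lemma linmap_lin_ext:
  assumes M: "module R M" and \<phi>: "\<And>x. x \<in> X \<Longrightarrow> \<phi> x \<in> carrier M"
  shows "linmap R (free_module R X) M (lin_ext R M \<phi>)"
proof -
  interpret M: module R M by fact
  show ?thesis
    by (rule linmapI) (simp_all add: lin_ext_mem[OF M M.carrier_is_submodule _ \<phi>]
        lin_ext_add[OF M _ _ \<phi>] lin_ext_smult[OF M _ _ \<phi>])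
qed

lemma free_module_simps [simp]:
  "\<zero>\<^bsub>free_module R X\<^esub> = (\<lambda>_. \<zero>\<^bsub>R\<^esub>)"
  "add (free_module R X) = (\<lambda>u v x. u x \<oplus>\<^bsub>R\<^esub> v x)"
  "smult (free_module R X) = (\<lambda>r u x. r \<otimes>\<^bsub>R\<^esub> u x)"
  by (simp_all add: free_module_def)

lemma free_module_value: "u \<in> carrier (free_module R X) \<Longrightarrow> u x \<in> carrier R"
  by (auto simp: free_module_def)

lemma comb_val_Cons_single:
  assumes "cring R" "fst p \<in> carrier R" "set l \<subseteq> carrier R \<times> X"
  shows "comb_val R (p # l) =
    (fst p \<odot>\<^bsub>free_module R X\<^esub> single R (snd p)) \<oplus>\<^bsub>free_module R X\<^esub> comb_val R l"
proof -
  interpret cring R by fact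
  show ?thesis using assms by (auto simp: fun_eq_iff single_def)
qed

text \<open>Every element is the value of a list of coefficient-generator pairs, so induction over
  lists replaces sums over finite supports.\<close>

lemma free_module_linmap_eq:
  assumes "module R M" "linmap R (free_module R X) M f" "linmap R (free_module R X) M g"
    and "\<And>x. x \<in> X \<Longrightarrow> f (single R x) = g (single R x)"
    and "u \<in> carrier (free_module R X)"
  shows "f u = g u"
proof -
  interpret M: module R M by fact
  have F: "module R (free_module R X)" by (rule module_free_module) (rule M.R.is_cring)
  interpret F: module R "free_module R X" by (rule F)
  obtain l where l: "set l \<subseteq> carrier R \<times> X" "comb_val R l = u"
    using comb_val_surj[OF M.R.is_cring assms(5)] by blast
  have "f (comb_val R l) = g (comb_val R l)" using l(1)
  proof (induction l)
    case Nil
    then show ?case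
      using linmap_zero[OF F assms(1,2)] linmap_zero[OF F assms(1,3)] by simp
  next
    case (Cons p l)
    have p: "fst p \<in> carrier R" "snd p \<in> X" and l: "set l \<subseteq> carrier R \<times> X"
      using Cons.prems by auto
    have s: "single R (snd p) \<in> carrier (free_module R X)"
      by (rule single_closed[OF M.R.is_cring p(2)])
    have c: "comb_val R l \<in> carrier (free_module R X)"
      by (rule comb_val_closed[OF M.R.is_cring l])
    have ps: "fst p \<odot>\<^bsub>free_module R X\<^esub> single R (snd p) \<in> carrier (free_module R X)"
      by (rule F.smult_closed[OF p(1) s])
    show ?case
      unfolding comb_val_Cons_single[OF M.R.is_cring p(1) l]
        linmap_add[OF assms(2) ps c] linmap_add[OF assms(3) ps c]
        linmap_smult[OF assms(2) p(1) s] linmap_smult[OF assms(3) p(1) s]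
        assms(4)[OF p(2)] Cons.IH[OF l] ..
  qed
  then show ?thesis using l(2) by simp
qed

text \<open>Projectivity of free modules: preimages are chosen on the basis and extended linearly.
  Only the image of \<open>h\<close> has to lie in the image of \<open>D\<close>, which is what
  exactness of a complex supplies.\<close>

lemma free_module_lift:
  assumes Q: "module R Q" and Q': "module R Q'" and D: "linmap R Q' Q D"
    and h: "linmap R (free_module R X) Q h"
    and im: "\<And>u. u \<in> carrier (free_module R X) \<Longrightarrow> h u \<in> D ` carrier Q'"
  shows "\<exists>k. linmap R (free_module R X) Q' k \<and> (\<forall>u\<in>carrier (free_module R X). D (k u) = h u)"
proof -
  interpret Q: module R Q by fact
  have "\<forall>x\<in>X. \<exists>q\<in>carrier Q'. D q = h (single R x)"
  proof
    fix x assume "x \<in> X"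
    then have "h (single R x) \<in> D ` carrier Q'"
      by (intro im single_closed Q.R.is_cring)
    then show "\<exists>q\<in>carrier Q'. D q = h (single R x)" by force
  qed
  then obtain \<phi> where \<phi>: "\<And>x. x \<in> X \<Longrightarrow> \<phi> x \<in> carrier Q'" "\<And>x. x \<in> X \<Longrightarrow> D (\<phi> x) = h (single R x)"
    by metis
  have k: "linmap R (free_module R X) Q' (lin_ext R Q' \<phi>)" by (rule linmap_lin_ext[OF Q' \<phi>(1)])
  have "D (lin_ext R Q' \<phi> u) = h u" if "u \<in> carrier (free_module R X)" for u
  proof (rule free_module_linmap_eq[OF Q linmap_comp[OF k D] h _ that])
    fix x assume "x \<in> X"
    then show "D (lin_ext R Q' \<phi> (single R x)) = h (single R x)"
      using \<phi> by (simp add: lin_ext_single[OF Q'])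
  qed
  with k show ?thesis by blast
qed

subsection \<open>The standard resolution\<close>

lemma module_res_module: "cring R \<Longrightarrow> module R (res_module R A n)"
  unfolding res_module_def by (rule module_free_module)

lemma res_module_simps [simp]:
  "\<zero>\<^bsub>res_module R A n\<^esub> = (\<lambda>_. \<zero>\<^bsub>R\<^esub>)"
  "add (res_module R A n) = (\<lambda>u v x. u x \<oplus>\<^bsub>R\<^esub> v x)"
  "smult (res_module R A n) = (\<lambda>r u x. r \<otimes>\<^bsub>R\<^esub> u x)"
  by (simp_all add: res_module_def)

lemma linmap_augmentation:
  assumes "module R A"
  shows "linmap R (res_module R A 0) A (augmentation R A)"
  unfolding res_module_def augmentation_def by (rule linmap_lin_ext[OF assms]) auto

lemma augmentation_single:
  assumes "module R A" "a \<in> carrier A"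
  shows "augmentation R A (single R (Elt a)) = a"
  unfolding augmentation_def using assms by (simp add: lin_ext_single)

text \<open>F_0 is spanned by \<open>Elt\<close> generators, which \<open>boundary\<close> sends to
  zero. The uniform treatment of coboundaries in all degrees relies on this convention.\<close>

lemma boundary_eq_zero:
  assumes "cring R" "u \<in> carrier (res_module R A 0)"
  shows "boundary R u = (\<lambda>_. \<zero>\<^bsub>R\<^esub>)"
proof -
  have F: "module R (free_module R (UNIV :: ('a, 'c) gen set))"
    by (rule module_free_module) fact
  have "boundary R u \<in> {\<zero>\<^bsub>free_module R (UNIV :: ('a, 'c) gen set)\<^esub>}"
    unfolding boundary_def
    by (rule lin_ext_mem[OF F submodule_zero[OF F] assms(2)[unfolded res_module_def]]) auto
  then show ?thesis by simp
qed

lemma res_basis_Suc: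
  assumes "g \<in> res_basis R A (Suc n)"
  obtains l where "g = Comb l" "set l \<subseteq> carrier R \<times> res_basis R A n"
    "n = 0 \<Longrightarrow> augmentation R A (comb_val R l) = \<zero>\<^bsub>A\<^esub>"
    "n \<noteq> 0 \<Longrightarrow> boundary R (comb_val R l) = (\<lambda>_. \<zero>\<^bsub>R\<^esub>)"
proof -
  obtain l where l: "g = Comb l" "set l \<subseteq> carrier R \<times> res_basis R A n"
    "if n = 0 then augmentation R A (comb_val R l) = \<zero>\<^bsub>A\<^esub> else boundary R (comb_val R l) = (\<lambda>_. \<zero>\<^bsub>R\<^esub>)"
    using assms unfolding res_basis.simps by blast
  show thesis by (rule that[OF l(1,2)]) (use l(3) in simp_all)
qed

lemma res_basis_SucI:
  assumes "set l \<subseteq> carrier R \<times> res_basis R A n"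
    and "if n = 0 then augmentation R A (comb_val R l) = \<zero>\<^bsub>A\<^esub>
      else boundary R (comb_val R l) = (\<lambda>_. \<zero>\<^bsub>R\<^esub>)"
  shows "Comb l \<in> res_basis R A (Suc n)"
  using assms unfolding res_basis.simps by blast

lemma linmap_boundary_Suc:
  assumes "module R A"
  shows "linmap R (res_module R A (Suc n)) (res_module R A n) (boundary R)"
proof -
  interpret A: module R A by fact
  have F: "module R (free_module R (UNIV :: ('a, 'c) gen set))"
    by (rule module_free_module) (rule A.R.is_cring)
  have c: "(case g of Elt a \<Rightarrow> (\<lambda>_. \<zero>\<^bsub>R\<^esub>) | Comb l \<Rightarrow> comb_val R l) \<in> carrier (free_module R UNIV)"
    if g: "g \<in> res_basis R A (Suc n)" for g
  proof -
    obtain l where "g = Comb l" "set l \<subseteq> carrier R \<times> res_basis R A n"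
      by (rule res_basis_Suc[OF g])
    then show ?thesis using comb_val_closed[OF A.R.is_cring, of l UNIV] by force
  qed
  have "linmap R (res_module R A (Suc n)) (free_module R UNIV) (boundary R)"
    unfolding res_module_def boundary_def by (rule linmap_lin_ext[OF F c])
  moreover have "boundary R u \<in> carrier (res_module R A n)"
    if "u \<in> carrier (res_module R A (Suc n))" for u
    using boundary_image[OF assms, of n] that by blast
  ultimately show ?thesis by (auto simp: linmap_def Pi_def)
qed

text \<open>
  With truncated subtraction this also covers \<open>n = 0\<close>, where the boundary map is \<open>0 : F\<^sub>0 \<rightarrow> F\<^sub>0\<close>;
  this avoids a case distinction in the definition of coboundaries.
\<close>

lemma linmap_boundary:
  assumes "module R A"
  shows "linmap R (res_module R A n) (res_module R A (n - 1)) (boundary R)"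
proof (cases n)
  case 0
  interpret A: module R A by fact
  interpret F: module R "res_module R A 0" by (rule module_res_module) (rule A.R.is_cring)
  have "linmap R (res_module R A 0) (res_module R A 0) (boundary R)"
    by (rule linmap_cong[THEN iffD2, OF boundary_eq_zero[OF A.R.is_cring] F.module_axioms])
      (use linmap_const_zero[OF F.module_axioms, of "res_module R A 0"] in simp_all)
  then show ?thesis by (simp add: 0)
qed (simp add: linmap_boundary_Suc[OF assms])

lemma boundary_boundary:
  assumes "module R A" "u \<in> carrier (res_module R A n)"
  shows "boundary R (boundary R u) = (\<lambda>_. \<zero>\<^bsub>R\<^esub>)"
proof -
  interpret A: module R A by fact
  show ?thesis
  proof (cases n)
    case 0
    have "boundary R u \<in> carrier (res_module R A 0)"
      using linmap_closed[OF linmap_boundary[OF assms(1), of 0]] assms(2) 0 by simp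
    then show ?thesis by (rule boundary_eq_zero[OF A.R.is_cring])
  next
    case (Suc m)
    show ?thesis
    proof (cases m)
      case 0
      \<comment> \<open>In the lowest degree this holds because \<open>boundary\<close> is zero on
        F_0; the complex condition that matters there is
        \<open>augmentation_boundary\<close>.\<close>
      then have "boundary R u \<in> carrier (res_module R A 0)"
        using linmap_closed[OF linmap_boundary_Suc[OF assms(1)]] assms(2) Suc by simp
      then show ?thesis by (rule boundary_eq_zero[OF A.R.is_cring])
    next
      case (Suc k)
      then show ?thesis using boundary_image[OF assms(1), of m] assms(2) \<open>n = Suc m\<close> by auto
    qed
  qed
qed

lemma augmentation_boundary:
  assumes "module R A" "u \<in> carrier (res_module R A 1)"
  shows "augmentation R A (boundary R u) = \<zero>\<^bsub>A\<^esub>"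
  using boundary_image[OF assms(1), of 0] assms(2) by auto

lemma res_exact_0:
  assumes "module R A" "u \<in> carrier (res_module R A 0)" "augmentation R A u = \<zero>\<^bsub>A\<^esub>"
  shows "\<exists>v\<in>carrier (res_module R A 1). boundary R v = u"
proof -
  have "u \<in> boundary R ` carrier (res_module R A (Suc 0))"
    unfolding boundary_image[OF assms(1)] using assms(2,3) by simp
  then show ?thesis by auto
qed

lemma res_exact_Suc:
  assumes "module R A" "u \<in> carrier (res_module R A (Suc n))" "boundary R u = (\<lambda>_. \<zero>\<^bsub>R\<^esub>)"
  shows "\<exists>v\<in>carrier (res_module R A (Suc (Suc n))). boundary R v = u"
proof -
  have "u \<in> boundary R ` carrier (res_module R A (Suc (Suc n)))"
    unfolding boundary_image[OF assms(1)] using assms(2,3) by simp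
  then show ?thesis by auto
qed

lemma augmentation_surjE:
  assumes "module R A" "a \<in> carrier A"
  obtains u where "u \<in> carrier (res_module R A 0)" "augmentation R A u = a"
  using augmentation_surj[OF assms(1)] assms(2) by (metis imageE)

subsection \<open>Functoriality\<close>

lemma res_map_linmap:
  fixes R :: "('r, 'x) ring_scheme" and f :: "'m \<Rightarrow> 'n"
  assumes "cring R" "gen_map f ` X \<subseteq> Y"
  shows "linmap R (free_module R X) (free_module R Y) (res_map R f)"
proof -
  interpret cring R by fact
  have F: "module R (free_module R (UNIV :: ('r, 'n) gen set))" by (rule module_free_module) fact
  have s: "single R (gen_map f g) \<in> carrier (free_module R Y)" if "g \<in> X" for g
    using assms that by (intro single_closed) auto
  have 1: "linmap R (free_module R X) (free_module R UNIV) (res_map R f)"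
    unfolding res_map_def by (rule linmap_lin_ext[OF F]) (rule single_closed[OF assms(1)], simp)
  have "submodule (carrier (free_module R Y)) R (free_module R UNIV)"
  proof -
    interpret Y: module R "free_module R Y" by (rule module_free_module) fact
    have "carrier (free_module R Y) \<subseteq> carrier (free_module R UNIV)"
      by (rule free_module_mono) simp
    then show ?thesis unfolding submodule_iff[OF F]
      using Y.M.zero_closed Y.M.a_closed Y.smult_closed by simp
  qed
  then have "res_map R f u \<in> carrier (free_module R Y)" if "u \<in> carrier (free_module R X)" for u
    unfolding res_map_def by (rule lin_ext_mem[OF F _ that s])
  with 1 show ?thesis by (auto simp: linmap_def Pi_def)
qed

lemma res_map_single:
  assumes "cring R"
  shows "res_map R f (single R g) = single R (gen_map f g)"
  unfolding res_map_def
  by (rule lin_ext_single[OF module_free_module[OF assms]]) (rule single_closed[OF assms], simp)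

text \<open>\<open>gen_map\<close> acts entrywise on a formal combination while
  \<open>boundary\<close> returns its value; this compatibility is what makes \<open>res_map\<close>
  commute with \<open>boundary\<close>.\<close>

lemma res_map_comb_val:
  fixes R :: "('r, 'x) ring_scheme" and f :: "'m \<Rightarrow> 'n"
  assumes "cring R" "set l \<subseteq> carrier R \<times> X"
  shows "res_map R f (comb_val R l) = comb_val R (map (map_prod id (gen_map f)) l)"
  using assms(2)
proof (induction l)
  case Nil
  have F: "module R (free_module R X)" "module R (free_module R (UNIV :: ('r, 'n) gen set))"
    by (rule module_free_module[OF assms(1)])+
  have "linmap R (free_module R X) (free_module R UNIV) (res_map R f)"
    by (rule res_map_linmap[OF assms(1)]) simp
  from linmap_zero[OF F this] show ?case by simp
next
  case (Cons p l)
  have p: "fst p \<in> carrier R" "snd p \<in> X" and l: "set l \<subseteq> carrier R \<times> X"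
    using Cons.prems by auto
  interpret F: module R "free_module R X" by (rule module_free_module[OF assms(1)])
  have s: "single R (snd p) \<in> carrier (free_module R X)"
    by (rule single_closed[OF assms(1) p(2)])
  have c: "comb_val R l \<in> carrier (free_module R X)"
    by (rule comb_val_closed[OF assms(1) l])
  have ps: "fst p \<odot>\<^bsub>free_module R X\<^esub> single R (snd p) \<in> carrier (free_module R X)"
    by (rule F.smult_closed[OF p(1) s])
  have lm: "linmap R (free_module R X) (free_module R UNIV) (res_map R f)"
    by (rule res_map_linmap[OF assms(1)]) simp
  have p': "fst (map_prod id (gen_map f) p) \<in> carrier R"
    "set (map (map_prod id (gen_map f)) l) \<subseteq> carrier R \<times> UNIV"
    using p l by auto
  show ?case
    unfolding comb_val_Cons_single[OF assms(1) p(1) l] linmap_add[OF lm ps c]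
      linmap_smult[OF lm p(1) s] res_map_single[OF assms(1)] Cons.IH[OF l] list.map
      comb_val_Cons_single[OF assms(1) p'] by simp
qed

lemma augmentation_res_map:
  assumes "module R A" "module R B" "linmap R A B f"
  shows "gen_map f ` res_basis R A 0 \<subseteq> res_basis R B 0"
    and "u \<in> carrier (res_module R A 0) \<Longrightarrow>
      augmentation R B (res_map R f u) = f (augmentation R A u)"
proof -
  interpret A: module R A by fact
  show g: "gen_map f ` res_basis R A 0 \<subseteq> res_basis R B 0"
    using linmap_closed[OF assms(3)] by auto
  assume u: "u \<in> carrier (res_module R A 0)"
  have 1: "linmap R (free_module R (res_basis R A 0)) B (\<lambda>u. augmentation R B (res_map R f u))"
    using linmap_comp[OF res_map_linmap[OF A.R.is_cring g] linmap_augmentation[OF assms(2), unfolded res_module_def]] .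
  have 2: "linmap R (free_module R (res_basis R A 0)) B (\<lambda>u. f (augmentation R A u))"
    using linmap_comp[OF linmap_augmentation[OF assms(1), unfolded res_module_def] assms(3)] .
  show "augmentation R B (res_map R f u) = f (augmentation R A u)"
  proof (rule free_module_linmap_eq[OF assms(2) 1 2 _ u[unfolded res_module_def]])
    fix x assume "x \<in> res_basis R A 0"
    then obtain a where "x = Elt a" "a \<in> carrier A" by auto
    then show "augmentation R B (res_map R f (single R x)) = f (augmentation R A (single R x))"
      using linmap_closed[OF assms(3)]
      by (simp add: res_map_single[OF A.R.is_cring] augmentation_single assms)
  qed
qed

lemma boundary_single_Comb:
  assumes "cring R" "set l \<subseteq> carrier R \<times> UNIV"
  shows "boundary R (single R (Comb l)) = comb_val R l"
  unfolding boundary_def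
  by (subst lin_ext_single[OF module_free_module[OF assms(1)]])
    (use comb_val_closed[OF assms] in simp_all)

text \<open>The basis inclusions are assumptions because their own proof in degree n + 2 uses this
  commutation on F_(n+1), inside an induction.\<close>

lemma boundary_res_map_on_basis:
  assumes "module R A" "module R B" "linmap R A B f"
    and g: "gen_map f ` res_basis R A n \<subseteq> res_basis R B n"
    and g': "gen_map f ` res_basis R A (Suc n) \<subseteq> res_basis R B (Suc n)"
    and u: "u \<in> carrier (res_module R A (Suc n))"
  shows "boundary R (res_map R f u) = res_map R f (boundary R u)"
proof -
  interpret A: module R A by fact
  have 1: "linmap R (free_module R (res_basis R A (Suc n))) (res_module R B n)
      (\<lambda>u. boundary R (res_map R f u))"
    using linmap_comp[OF res_map_linmap[OF A.R.is_cring g']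
        linmap_boundary_Suc[OF assms(2), of n, unfolded res_module_def]]
    by (simp add: res_module_def)
  have 2: "linmap R (free_module R (res_basis R A (Suc n))) (res_module R B n)
      (\<lambda>u. res_map R f (boundary R u))"
    using linmap_comp[OF linmap_boundary_Suc[OF assms(1), of n, unfolded res_module_def]
        res_map_linmap[OF A.R.is_cring g]]
    by (simp add: res_module_def)
  show ?thesis
  proof (rule free_module_linmap_eq[OF module_res_module[OF A.R.is_cring] 1 2 _ u[unfolded res_module_def]])
    fix x assume "x \<in> res_basis R A (Suc n)"
    from res_basis_Suc[OF this]
    obtain l where l: "x = Comb l" "set l \<subseteq> carrier R \<times> res_basis R A n" by metis
    then have "set l \<subseteq> carrier R \<times> UNIV" "set (map (map_prod id (gen_map f)) l) \<subseteq> carrier R \<times> UNIV"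
      by auto
    then show "boundary R (res_map R f (single R x)) = res_map R f (boundary R (single R x))"
      using l(1) res_map_comb_val[OF A.R.is_cring l(2), of f]
      by (simp add: res_map_single[OF A.R.is_cring] boundary_single_Comb[OF A.R.is_cring])
  qed
qed

text \<open>A generator of degree m + 1 is a combination whose value is a cycle. Its image has value
  \<open>res_map R f\<close> of that cycle, again a cycle by commutation with the boundary on F_m
  (with the augmentation when m = 0). That commutation needs the inclusions in degrees m - 1 and m,
  hence strong induction.\<close>

lemma gen_map_res_basis:
  assumes "module R A" "module R B" "linmap R A B f"
  shows "gen_map f ` res_basis R A n \<subseteq> res_basis R B n"
proof (induction n rule: less_induct)
  case (less n)
  interpret A: module R A by fact
  show ?case
  proof (cases n)
    case 0
    then show ?thesis using augmentation_res_map(1)[OF assms] by simp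
  next
    case (Suc m)
    show ?thesis
    proof
      fix y assume "y \<in> gen_map f ` res_basis R A n"
      then obtain x where x: "x \<in> res_basis R A (Suc m)" "y = gen_map f x" using Suc by auto
      from x(1) obtain l where l: "x = Comb l" "set l \<subseteq> carrier R \<times> res_basis R A m"
        "m = 0 \<Longrightarrow> augmentation R A (comb_val R l) = \<zero>\<^bsub>A\<^esub>"
        "m \<noteq> 0 \<Longrightarrow> boundary R (comb_val R l) = (\<lambda>_. \<zero>\<^bsub>R\<^esub>)" by (rule res_basis_Suc) blast
      let ?l = "map (map_prod id (gen_map f)) l"
      have c: "comb_val R l \<in> carrier (res_module R A m)"
        unfolding res_module_def by (rule comb_val_closed[OF A.R.is_cring l(2)])
      have rm: "comb_val R ?l = res_map R f (comb_val R l)"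
        using res_map_comb_val[OF A.R.is_cring l(2), of f] by simp
      have sub: "set ?l \<subseteq> carrier R \<times> res_basis R B m"
        using l(2) less.IH[of m] Suc by (auto simp: subset_iff image_subset_iff)
      have "if m = 0 then augmentation R B (comb_val R ?l) = \<zero>\<^bsub>B\<^esub>
          else boundary R (comb_val R ?l) = (\<lambda>_. \<zero>\<^bsub>R\<^esub>)"
      proof (cases m)
        case 0
        then show ?thesis
          using l(3) augmentation_res_map(2)[OF assms] c linmap_zero[OF assms] rm by simp
      next
        case (Suc k)
        have g: "gen_map f ` res_basis R A k \<subseteq> res_basis R B k"
          "gen_map f ` res_basis R A (Suc k) \<subseteq> res_basis R B (Suc k)"
          by (rule less.IH; use Suc \<open>n = Suc m\<close> in simp)+
        have "boundary R (comb_val R ?l) = res_map R f (\<lambda>_. \<zero>\<^bsub>R\<^esub>)"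
          using boundary_res_map_on_basis[OF assms g] c Suc l(4) rm by simp
        also have "\<dots> = (\<lambda>_. \<zero>\<^bsub>R\<^esub>)"
          using linmap_zero[OF module_free_module[OF A.R.is_cring] module_free_module[OF A.R.is_cring]
              res_map_linmap[OF A.R.is_cring g(1)]] by simp
        finally show ?thesis using Suc by simp
      qed
      from res_basis_SucI[OF sub this] show "y \<in> res_basis R B n"
        using l(1) x(2) \<open>n = Suc m\<close> by simp
    qed
  qed
qed

lemma linmap_res_map:
  assumes "module R A" "module R B" "linmap R A B f"
  shows "linmap R (res_module R A n) (res_module R B n) (res_map R f)"
proof -
  interpret A: module R A by fact
  show ?thesis unfolding res_module_def
    by (rule res_map_linmap[OF A.R.is_cring gen_map_res_basis[OF assms]])
qed

lemma boundary_res_map: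
  assumes "module R A" "module R B" "linmap R A B f" "u \<in> carrier (res_module R A (Suc n))"
  shows "boundary R (res_map R f u) = res_map R f (boundary R u)"
  by (rule boundary_res_map_on_basis[OF assms(1-3) gen_map_res_basis[OF assms(1-3)]
        gen_map_res_basis[OF assms(1-3)] assms(4)])

subsection \<open>Submodules\<close>

text \<open>Not a matter of unfolding, since \<open>finsum\<close> depends on the carrier of the
  record; but the two linear maps agree on the basis.\<close>

lemma augmentation_submodule:
  fixes R :: "('r, 'x) ring_scheme" and A :: "('r, 'a, 'y) module_scheme"
  assumes "module R A" "submodule U R A" "u \<in> carrier (res_module R (A\<lparr>carrier := U\<rparr>) 0)"
  shows "augmentation R (A\<lparr>carrier := U\<rparr>) u = augmentation R A u"
proof -
  have U: "module R (A\<lparr>carrier := U\<rparr>)" by (rule module_submodule[OF assms(1,2)])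
  note U' = submodule_props[OF assms(1,2)]
  have 1: "linmap R (free_module R (Elt ` U :: ('r, 'a) gen set)) A (augmentation R (A\<lparr>carrier := U\<rparr>))"
    using linmap_out_of_sub[OF linmap_augmentation[OF U] U'(1)] by (simp add: res_module_def)
  have 2: "linmap R (free_module R (Elt ` U :: ('r, 'a) gen set)) A (augmentation R A)"
    unfolding augmentation_def by (rule linmap_lin_ext[OF assms(1)]) (use U'(1) in auto)
  show ?thesis
  proof (rule free_module_linmap_eq[OF assms(1) 1 2])
    show "u \<in> carrier (free_module R (Elt ` U :: ('r, 'a) gen set))" using assms(3) by (simp add: res_module_def)
    fix x assume "x \<in> (Elt ` U :: ('r, 'a) gen set)"
    then show "augmentation R (A\<lparr>carrier := U\<rparr>) (single R x) = augmentation R A (single R x)"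
      using U'(1) by (auto simp: augmentation_single[OF U] augmentation_single[OF assms(1)])
  qed
qed

text \<open>A submodule shares the element type of \<open>A\<close>, so its resolution is literally
  contained in that of \<open>A\<close> and the inclusion acts as the identity on chains.\<close>

lemma res_basis_submodule:
  assumes "module R A" "submodule U R A"
  shows "res_basis R (A\<lparr>carrier := U\<rparr>) n \<subseteq> res_basis R A n"
proof (induction n)
  case 0
  then show ?case using submodule_props(1)[OF assms] by auto
next
  case (Suc n)
  interpret A: module R A by fact
  show ?case
  proof
    fix x assume "x \<in> res_basis R (A\<lparr>carrier := U\<rparr>) (Suc n)"
    then obtain l where l: "x = Comb l" "set l \<subseteq> carrier R \<times> res_basis R (A\<lparr>carrier := U\<rparr>) n"
        "n = 0 \<Longrightarrow> augmentation R (A\<lparr>carrier := U\<rparr>) (comb_val R l) = \<zero>\<^bsub>A\<lparr>carrier := U\<rparr>\<^esub>"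
        "n \<noteq> 0 \<Longrightarrow> boundary R (comb_val R l) = (\<lambda>_. \<zero>\<^bsub>R\<^esub>)" by (rule res_basis_Suc) blast
    have "comb_val R l \<in> carrier (res_module R (A\<lparr>carrier := U\<rparr>) n)"
      unfolding res_module_def by (rule comb_val_closed[OF A.R.is_cring l(2)])
    then have "n = 0 \<Longrightarrow> augmentation R A (comb_val R l) = \<zero>\<^bsub>A\<^esub>"
      using l(3) augmentation_submodule[OF assms] by simp
    moreover have "set l \<subseteq> carrier R \<times> res_basis R A n" using l(2) Suc.IH by auto
    ultimately show "x \<in> res_basis R A (Suc n)" using l(1,4) by auto
  qed
qed

lemma res_module_submodule:
  assumes "module R A" "submodule U R A"
  shows "carrier (res_module R (A\<lparr>carrier := U\<rparr>) n) \<subseteq> carrier (res_module R A n)"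
  unfolding res_module_def by (rule free_module_mono[OF res_basis_submodule[OF assms]])

section \<open>Cocycles and the comparison theorem\<close>

text \<open>Unlike \<open>cocycles\<close>, this predicate imposes no extensionality on
  \<open>f\<close>, so composites with chain maps need no \<open>restrict\<close>;
  \<open>cocycles_iff\<close> and \<open>coboundaries_iff\<close> translate back.\<close>

definition cocyc ::
    "('r, 'x) ring_scheme \<Rightarrow> ('r, 'a, 'y) module_scheme \<Rightarrow> ('r, 'n, 'z) module_scheme \<Rightarrow> nat
      \<Rightarrow> ((('r, 'a) gen \<Rightarrow> 'r) \<Rightarrow> 'n) \<Rightarrow> bool" where
  "cocyc R A N i f \<longleftrightarrow> linmap R (res_module R A i) N f \<and>
     (\<forall>u\<in>carrier (res_module R A (Suc i)). f (boundary R u) = \<zero>\<^bsub>N\<^esub>)"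

text \<open>For \<open>i = 0\<close> the condition says \<open>f = 0\<close>, since \<^const>\<open>boundary\<close> vanishes on \<open>F\<^sub>0\<close>.\<close>

definition cobd ::
    "('r, 'x) ring_scheme \<Rightarrow> ('r, 'a, 'y) module_scheme \<Rightarrow> ('r, 'n, 'z) module_scheme \<Rightarrow> nat
      \<Rightarrow> ((('r, 'a) gen \<Rightarrow> 'r) \<Rightarrow> 'n) \<Rightarrow> bool" where
  "cobd R A N i f \<longleftrightarrow> (\<exists>h. linmap R (res_module R A (i - 1)) N h \<and>
     (\<forall>u\<in>carrier (res_module R A i). f u = h (boundary R u)))"

lemma cocyc_linmap: "cocyc R A N i f \<Longrightarrow> linmap R (res_module R A i) N f"
  by (simp add: cocyc_def)

lemma cocyc_boundary:
  "cocyc R A N i f \<Longrightarrow> u \<in> carrier (res_module R A (Suc i)) \<Longrightarrow> f (boundary R u) = \<zero>\<^bsub>N\<^esub>"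
  by (simp add: cocyc_def)

lemma cobd_cong:
  "(\<And>u. u \<in> carrier (res_module R A i) \<Longrightarrow> f u = g u) \<Longrightarrow> cobd R A N i f \<longleftrightarrow> cobd R A N i g"
  by (simp add: cobd_def)

lemma cobdI:
  assumes "linmap R (res_module R A (i - 1)) N h"
    and "\<And>u. u \<in> carrier (res_module R A i) \<Longrightarrow> f u = h (boundary R u)"
  shows "cobd R A N i f"
  using assms by (auto simp: cobd_def)

lemma cobdE:
  assumes "cobd R A N i f"
  obtains h where "linmap R (res_module R A (i - 1)) N h"
    "\<And>u. u \<in> carrier (res_module R A i) \<Longrightarrow> f u = h (boundary R u)"
  using assms by (auto simp: cobd_def)

lemma cobd_zero:
  assumes "module R N"
  shows "cobd R A N i (\<lambda>_. \<zero>\<^bsub>N\<^esub>)"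
  by (rule cobdI[OF linmap_const_zero[OF assms]]) simp

lemma cobd_add:
  assumes N: "module R N" and "cobd R A N i f" "cobd R A N i g"
  shows "cobd R A N i (\<lambda>u. f u \<oplus>\<^bsub>N\<^esub> g u)"
proof -
  obtain h where h: "linmap R (res_module R A (i - 1)) N h"
    "\<And>u. u \<in> carrier (res_module R A i) \<Longrightarrow> f u = h (boundary R u)" using assms(2) by (rule cobdE) blast
  obtain k where k: "linmap R (res_module R A (i - 1)) N k"
    "\<And>u. u \<in> carrier (res_module R A i) \<Longrightarrow> g u = k (boundary R u)" using assms(3) by (rule cobdE) blast
  show ?thesis by (rule cobdI[OF linmap_plus[OF N h(1) k(1)]]) (simp add: h(2) k(2))
qed

lemma cobd_diff:
  assumes N: "module R N" and "cobd R A N i f" "cobd R A N i g"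
  shows "cobd R A N i (\<lambda>u. f u \<ominus>\<^bsub>N\<^esub> g u)"
proof -
  interpret N: module R N by fact
  obtain h where h: "linmap R (res_module R A (i - 1)) N h"
    "\<And>u. u \<in> carrier (res_module R A i) \<Longrightarrow> f u = h (boundary R u)" using assms(2) by (rule cobdE) blast
  obtain k where k: "linmap R (res_module R A (i - 1)) N k"
    "\<And>u. u \<in> carrier (res_module R A i) \<Longrightarrow> g u = k (boundary R u)" using assms(3) by (rule cobdE) blast
  show ?thesis
    by (rule cobdI[OF linmap_subtract[OF module_res_module[OF N.R.is_cring] N h(1) k(1)]])
      (simp add: h(2) k(2))
qed

lemma cobd_smult:
  assumes N: "module R N" and "cobd R A N i f" and r: "r \<in> carrier R"
  shows "cobd R A N i (\<lambda>u. r \<odot>\<^bsub>N\<^esub> f u)"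
proof -
  obtain h where h: "linmap R (res_module R A (i - 1)) N h"
    "\<And>u. u \<in> carrier (res_module R A i) \<Longrightarrow> f u = h (boundary R u)" using assms(2) by (rule cobdE) blast
  show ?thesis by (rule cobdI[OF linmap_scale[OF N h(1) r]]) (simp add: h(2))
qed

lemma cobd_closed:
  assumes "module R A" "cobd R A N i f" "u \<in> carrier (res_module R A i)"
  shows "f u \<in> carrier N"
  using assms(2) linmap_closed[OF linmap_boundary[OF assms(1)] assms(3)]
  by (auto simp: cobd_def assms(3) dest: linmap_closed)

text \<open>Coboundaries are closed under sums and differences. This transfers the vanishing of a
  class between cohomologous representatives without passing to the quotient
  \<open>Ext\<close>.\<close>

lemma cobd_diff_cancel:
  assumes N: "module R N" and A: "module R A"
    and f: "\<And>u. u \<in> carrier (res_module R A i) \<Longrightarrow> f u \<in> carrier N"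
    and g: "\<And>u. u \<in> carrier (res_module R A i) \<Longrightarrow> g u \<in> carrier N"
    and fg: "cobd R A N i (\<lambda>u. f u \<ominus>\<^bsub>N\<^esub> g u)"
  shows "cobd R A N i f \<longleftrightarrow> cobd R A N i g"
proof -
  interpret N: module R N by fact
  have 1: "f u = (f u \<ominus>\<^bsub>N\<^esub> g u) \<oplus>\<^bsub>N\<^esub> g u" if "u \<in> carrier (res_module R A i)" for u
    using f[OF that] g[OF that] by (simp add: N.diff_add_cancel)
  have 2: "g u = f u \<ominus>\<^bsub>N\<^esub> (f u \<ominus>\<^bsub>N\<^esub> g u)" if "u \<in> carrier (res_module R A i)" for u
  proof -
    have "g u = ((f u \<ominus>\<^bsub>N\<^esub> g u) \<oplus>\<^bsub>N\<^esub> g u) \<ominus>\<^bsub>N\<^esub> (f u \<ominus>\<^bsub>N\<^esub> g u)"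
      using f[OF that] g[OF that] by (simp only: N.add_diff_cancel_left N.M.minus_closed)
    then show ?thesis using 1[OF that] by simp
  qed
  show ?thesis
  proof
    assume "cobd R A N i f"
    from cobd_diff[OF N this fg] show "cobd R A N i g"
      by (subst cobd_cong[OF 2])
  next
    assume "cobd R A N i g"
    from cobd_add[OF N fg this] show "cobd R A N i f"
      by (subst cobd_cong[OF 1])
  qed
qed

subsection \<open>Chain maps out of the standard resolution\<close>

text \<open>The target is any sequence \<open>Q\<close> with one function \<open>D\<close> as
  differential in all degrees, so that standard resolutions and mapping cones are both
  instances.\<close>

definition chain_lift ::
    "('r, 'x) ring_scheme \<Rightarrow> ('r, 'a, 'y) module_scheme \<Rightarrow> (nat \<Rightarrow> ('r, 'q, 'z) module_scheme)
      \<Rightarrow> ('q \<Rightarrow> 'q) \<Rightarrow> ('q \<Rightarrow> 'c) \<Rightarrow> ('a \<Rightarrow> 'c)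
      \<Rightarrow> (nat \<Rightarrow> (('r, 'a) gen \<Rightarrow> 'r) \<Rightarrow> 'q) \<Rightarrow> bool" where
  "chain_lift R A Q D e f \<phi> \<longleftrightarrow>
     (\<forall>n. linmap R (res_module R A n) (Q n) (\<phi> n)) \<and>
     (\<forall>u\<in>carrier (res_module R A 0). e (\<phi> 0 u) = f (augmentation R A u)) \<and>
     (\<forall>n. \<forall>u\<in>carrier (res_module R A (Suc n)). D (\<phi> (Suc n) u) = \<phi> n (boundary R u))"

lemma chain_liftI:
  assumes "\<And>n. linmap R (res_module R A n) (Q n) (\<phi> n)"
    and "\<And>u. u \<in> carrier (res_module R A 0) \<Longrightarrow> e (\<phi> 0 u) = f (augmentation R A u)"
    and "\<And>n u. u \<in> carrier (res_module R A (Suc n)) \<Longrightarrow> D (\<phi> (Suc n) u) = \<phi> n (boundary R u)"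
  shows "chain_lift R A Q D e f \<phi>"
  using assms by (auto simp: chain_lift_def)

lemma chain_liftD:
  assumes "chain_lift R A Q D e f \<phi>"
  shows "linmap R (res_module R A n) (Q n) (\<phi> n)"
    and "u \<in> carrier (res_module R A 0) \<Longrightarrow> e (\<phi> 0 u) = f (augmentation R A u)"
    and "u \<in> carrier (res_module R A (Suc n)) \<Longrightarrow> D (\<phi> (Suc n) u) = \<phi> n (boundary R u)"
  using assms by (auto simp: chain_lift_def)

abbreviation "res_lift R A B \<equiv> chain_lift R A (res_module R B) (boundary R) (augmentation R B)"

lemma chain_lift_res_map:
  assumes "module R A" "module R B" "linmap R A B f"
  shows "res_lift R A B f (\<lambda>_. res_map R f)"
  by (rule chain_liftI)
    (simp_all add: linmap_res_map[OF assms] augmentation_res_map(2)[OF assms] boundary_res_map[OF assms])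

lemma chain_lift_comp:
  assumes A: "module R A" and \<phi>: "res_lift R A B f \<phi>" and \<psi>: "chain_lift R B Q D e g \<psi>"
  shows "chain_lift R A Q D e (\<lambda>a. g (f a)) (\<lambda>n u. \<psi> n (\<phi> n u))"
  by (rule chain_liftI)
    (simp_all add: linmap_comp[OF chain_liftD(1)[OF \<phi>] chain_liftD(1)[OF \<psi>]]
      chain_liftD(2,3)[OF \<phi>] chain_liftD(2,3)[OF \<psi>] linmap_closed[OF chain_liftD(1)[OF \<phi>]])

lemma chain_lift_cong:
  assumes "chain_lift R A Q D e f \<phi>" "module R A" "\<And>a. a \<in> carrier A \<Longrightarrow> f a = g a"
  shows "chain_lift R A Q D e g \<phi>"
  using assms(1) assms(3)[OF linmap_closed[OF linmap_augmentation[OF assms(2)]]]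
  by (simp add: chain_lift_def)

lemma chain_lift_id: "res_lift R A A (\<lambda>a. a) (\<lambda>_ u. u)"
  by (rule chain_liftI) (simp_all add: linmap_id)

text \<open>Scalar multiplication on chains differs from \<open>res_map\<close> of scalar
  multiplication on \<open>A\<close>, as \<open>res_map\<close> is not linear in the map. Both lift
  the same map, so on Ext both act as multiplication by \<open>r\<close>.\<close>

lemma chain_lift_smult:
  assumes A: "module R A" and r: "r \<in> carrier R"
  shows "res_lift R A A (\<lambda>a. r \<odot>\<^bsub>A\<^esub> a) (\<lambda>n u. r \<odot>\<^bsub>res_module R A n\<^esub> u)"
proof -
  interpret A: module R A by fact
  have B: "boundary R (r \<odot>\<^bsub>res_module R A (Suc n)\<^esub> u) = r \<odot>\<^bsub>res_module R A n\<^esub> boundary R u"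
    if "u \<in> carrier (res_module R A (Suc n))" for n u
    by (rule linmap_smult[OF linmap_boundary_Suc[OF A] r that])
  show ?thesis
    by (rule chain_liftI)
      (simp_all only: linmap_smult_self[OF module_res_module[OF A.R.is_cring] r] B
        linmap_smult[OF linmap_augmentation[OF A] r])
qed

lemma chain_lift_inclusion:
  assumes "module R A" "submodule U R A" "chain_lift R A Q D e f \<phi>"
  shows "chain_lift R (A\<lparr>carrier := U\<rparr>) Q D e f \<phi>"
proof (rule chain_liftI)
  note sub = res_module_submodule[OF assms(1,2)]
  fix n
  show "linmap R (res_module R (A\<lparr>carrier := U\<rparr>) n) (Q n) (\<phi> n)"
    using chain_liftD(1)[OF assms(3), of n] sub[of n] by (auto simp: linmap_def Pi_def subset_iff)
  fix u
  show "e (\<phi> 0 u) = f (augmentation R (A\<lparr>carrier := U\<rparr>) u)"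
    if "u \<in> carrier (res_module R (A\<lparr>carrier := U\<rparr>) 0)"
    using that chain_liftD(2)[OF assms(3)] sub[of 0] augmentation_submodule[OF assms(1,2) that] by auto
  show "D (\<phi> (Suc n) u) = \<phi> n (boundary R u)"
    if "u \<in> carrier (res_module R (A\<lparr>carrier := U\<rparr>) (Suc n))"
    using that chain_liftD(3)[OF assms(3)] sub[of "Suc n"] by auto
qed

lemma cocyc_pullback:
  assumes \<phi>: "res_lift R A B f \<phi>" and g: "cocyc R B N i g"
  shows "cocyc R A N i (\<lambda>u. g (\<phi> i u))"
  unfolding cocyc_def
proof (intro conjI ballI)
  show "linmap R (res_module R A i) N (\<lambda>u. g (\<phi> i u))"
    using linmap_comp[OF chain_liftD(1)[OF \<phi>] cocyc_linmap[OF g]] .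
  fix u assume u: "u \<in> carrier (res_module R A (Suc i))"
  show "g (\<phi> i (boundary R u)) = \<zero>\<^bsub>N\<^esub>"
    using cocyc_boundary[OF g linmap_closed[OF chain_liftD(1)[OF \<phi>] u]] chain_liftD(3)[OF \<phi> u]
    by simp
qed

lemma cobd_pullback:
  assumes N: "module R N" and A: "module R A" and B: "module R B"
    and \<phi>: "res_lift R A B f \<phi>" and g: "cobd R B N i g"
  shows "cobd R A N i (\<lambda>u. g (\<phi> i u))"
proof -
  interpret N: module R N by fact
  obtain h where h: "linmap R (res_module R B (i - 1)) N h"
    "\<And>u. u \<in> carrier (res_module R B i) \<Longrightarrow> g u = h (boundary R u)" using g by (rule cobdE) blast
  show ?thesis
  proof (rule cobdI[OF linmap_comp[OF chain_liftD(1)[OF \<phi>] h(1)]])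
    fix u assume u: "u \<in> carrier (res_module R A i)"
    have \<phi>u: "\<phi> i u \<in> carrier (res_module R B i)" by (rule linmap_closed[OF chain_liftD(1)[OF \<phi>] u])
    have "boundary R (\<phi> i u) = \<phi> (i - 1) (boundary R u)"
    proof (cases i)
      case 0
      \<comment> \<open>Here i - 1 = 0 and both boundaries vanish, so commuting with
        \<open>boundary\<close> reduces to \<open>\<phi> 0\<close> preserving zero.\<close>
      have "boundary R (\<phi> i u) = (\<lambda>_. \<zero>\<^bsub>R\<^esub>)" "boundary R u = (\<lambda>_. \<zero>\<^bsub>R\<^esub>)"
        using boundary_eq_zero[OF N.R.is_cring] \<phi>u u 0 by auto
      moreover have "\<phi> 0 (\<lambda>_. \<zero>\<^bsub>R\<^esub>) = (\<lambda>_. \<zero>\<^bsub>R\<^esub>)"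
        using linmap_zero[OF module_res_module[OF N.R.is_cring] module_res_module[OF N.R.is_cring]
            chain_liftD(1)[OF \<phi>, of 0]] by simp
      ultimately show ?thesis using 0 by simp
    qed (use chain_liftD(3)[OF \<phi>] u in simp)
    then show "g (\<phi> i u) = h (\<phi> (i - 1) (boundary R u))" using h(2)[OF \<phi>u] by simp
  qed
qed

text \<open>The terms need not be free: in the comparison theorem freeness is required of the
  source, and the source is always a standard resolution.\<close>

locale exact_complex =
  fixes R :: "('r, 'x) ring_scheme" and Q :: "nat \<Rightarrow> ('r, 'q, 'y) module_scheme"
    and D :: "'q \<Rightarrow> 'q" and e :: "'q \<Rightarrow> 'c" and C :: "('r, 'c, 'z) module_scheme"
  assumes module_Q: "module R (Q n)" and module_C: "module R C"
    and linmap_D: "linmap R (Q (Suc n)) (Q n) D" and linmap_e: "linmap R (Q 0) C e"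
    and surj_e: "c \<in> carrier C \<Longrightarrow> c \<in> e ` carrier (Q 0)"
    and exact_0: "u \<in> carrier (Q 0) \<Longrightarrow> e u = \<zero>\<^bsub>C\<^esub> \<Longrightarrow> u \<in> D ` carrier (Q (Suc 0))"
    and exact_Suc: "u \<in> carrier (Q (Suc n)) \<Longrightarrow> D u = \<zero>\<^bsub>Q n\<^esub> \<Longrightarrow>
      u \<in> D ` carrier (Q (Suc (Suc n)))"
begin

lemma chain_lift_exists:
  assumes A: "module R A" and f: "linmap R A C f"
  shows "\<exists>\<phi>. chain_lift R A Q D e f \<phi>"
proof -
  interpret A: module R A by fact
  let ?F = "res_module R A"
  have F: "module R (?F n)" for n by (rule module_res_module[OF A.R.is_cring])
  \<comment> \<open>Besides linearity, the invariant records that composing with the next boundary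
    lands in the image of \<open>D\<close>; this is what allows the next component to be
    chosen.\<close>
  let ?P = "\<lambda>n \<phi>. linmap R (?F n) (Q n) \<phi> \<and>
    (n = 0 \<longrightarrow> (\<forall>u\<in>carrier (?F 0). e (\<phi> u) = f (augmentation R A u))) \<and>
    (\<forall>u\<in>carrier (?F (Suc n)). \<phi> (boundary R u) \<in> D ` carrier (Q (Suc n)))"
  let ?S = "\<lambda>n \<phi> \<phi>'. \<forall>u\<in>carrier (?F (Suc n)). D (\<phi>' u) = \<phi> (boundary R u)"
  have "\<exists>\<phi>. \<forall>n. ?P n (\<phi> n) \<and> ?S n (\<phi> n) (\<phi> (Suc n))"
  proof (rule dependent_nat_choice)
    have l: "linmap R (?F 0) C (\<lambda>u. f (augmentation R A u))"
      by (rule linmap_comp[OF linmap_augmentation[OF A] f])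
    have "f (augmentation R A u) \<in> e ` carrier (Q 0)" if "u \<in> carrier (?F 0)" for u
      by (rule surj_e[OF linmap_closed[OF l that]])
    from free_module_lift[OF module_C module_Q linmap_e l[unfolded res_module_def] this[unfolded res_module_def]]
    obtain \<phi> where \<phi>: "linmap R (?F 0) (Q 0) \<phi>"
      "\<And>u. u \<in> carrier (?F 0) \<Longrightarrow> e (\<phi> u) = f (augmentation R A u)"
      unfolding res_module_def by blast
    have "\<phi> (boundary R u) \<in> D ` carrier (Q (Suc 0))" if u: "u \<in> carrier (?F (Suc 0))" for u
    proof (rule exact_0)
      have b: "boundary R u \<in> carrier (?F 0)" by (rule linmap_closed[OF linmap_boundary_Suc[OF A] u])
      show "\<phi> (boundary R u) \<in> carrier (Q 0)" by (rule linmap_closed[OF \<phi>(1) b])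
      show "e (\<phi> (boundary R u)) = \<zero>\<^bsub>C\<^esub>"
        using \<phi>(2)[OF b] augmentation_boundary[OF A] u linmap_zero[OF A module_C f] by simp
    qed
    with \<phi> show "\<exists>\<phi>. ?P 0 \<phi>" by blast
  next
    fix \<phi> n assume P: "?P n \<phi>"
    have l: "linmap R (?F (Suc n)) (Q n) (\<lambda>u. \<phi> (boundary R u))"
      by (rule linmap_comp[OF linmap_boundary_Suc[OF A]]) (use P in blast)
    have "\<phi> (boundary R u) \<in> D ` carrier (Q (Suc n))" if "u \<in> carrier (?F (Suc n))" for u
      using P that by blast
    from free_module_lift[OF module_Q module_Q linmap_D l[unfolded res_module_def] this[unfolded res_module_def]]
    obtain \<phi>' where \<phi>': "linmap R (?F (Suc n)) (Q (Suc n)) \<phi>'"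
      "\<And>u. u \<in> carrier (?F (Suc n)) \<Longrightarrow> D (\<phi>' u) = \<phi> (boundary R u)"
      unfolding res_module_def by blast
    have "\<phi>' (boundary R u) \<in> D ` carrier (Q (Suc (Suc n)))" if u: "u \<in> carrier (?F (Suc (Suc n)))" for u
    proof (rule exact_Suc)
      have b: "boundary R u \<in> carrier (?F (Suc n))"
        by (rule linmap_closed[OF linmap_boundary_Suc[OF A] u])
      show "\<phi>' (boundary R u) \<in> carrier (Q (Suc n))" by (rule linmap_closed[OF \<phi>'(1) b])
      have "linmap R (?F n) (Q n) \<phi>" using P by blast
      from linmap_zero[OF F module_Q this]
      show "D (\<phi>' (boundary R u)) = \<zero>\<^bsub>Q n\<^esub>"
        using \<phi>'(2)[OF b] boundary_boundary[OF A u] by simp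
    qed
    with \<phi>' show "\<exists>\<phi>'. ?P (Suc n) \<phi>' \<and> ?S n \<phi> \<phi>'" by blast
  qed
  then obtain \<phi> where "\<forall>n. ?P n (\<phi> n) \<and> ?S n (\<phi> n) (\<phi> (Suc n))" by blast
  then have "chain_lift R A Q D e f \<phi>" unfolding chain_lift_def by blast
  then show ?thesis by blast
qed

text \<open>For a chain map over the zero map, \<open>\<chi>\<close> minus s after the boundary is a
  cycle at each stage, so exactness of \<open>Q\<close> and freeness of the source yield the next
  s.\<close>

lemma null_homotopy:
  assumes A: "module R A" and \<chi>: "chain_lift R A Q D e (\<lambda>_. \<zero>\<^bsub>C\<^esub>) \<chi>"
  obtains s where "\<And>n. linmap R (res_module R A n) (Q (Suc n)) (s n)"
    "\<And>u. u \<in> carrier (res_module R A 0) \<Longrightarrow> D (s 0 u) = \<chi> 0 u"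
    "\<And>n u. u \<in> carrier (res_module R A (Suc n)) \<Longrightarrow>
      D (s (Suc n) u) = \<chi> (Suc n) u \<ominus>\<^bsub>Q (Suc n)\<^esub> s n (boundary R u)"
proof -
  interpret A: module R A by fact
  let ?F = "res_module R A"
  have F: "module R (?F n)" for n by (rule module_res_module[OF A.R.is_cring])
  note \<chi>' = chain_liftD[OF \<chi>]
  let ?P = "\<lambda>n s. linmap R (?F n) (Q (Suc n)) s \<and>
    (n = 0 \<longrightarrow> (\<forall>u\<in>carrier (?F 0). D (s u) = \<chi> 0 u)) \<and>
    (\<forall>u\<in>carrier (?F (Suc n)). \<chi> (Suc n) u \<ominus>\<^bsub>Q (Suc n)\<^esub> s (boundary R u) \<in> D ` carrier (Q (Suc (Suc n))))"
  let ?S = "\<lambda>n s s'. \<forall>u\<in>carrier (?F (Suc n)). D (s' u) = \<chi> (Suc n) u \<ominus>\<^bsub>Q (Suc n)\<^esub> s (boundary R u)"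
  have l: "linmap R (?F (Suc n)) (Q (Suc n)) (\<lambda>u. \<chi> (Suc n) u \<ominus>\<^bsub>Q (Suc n)\<^esub> s (boundary R u))"
    if "linmap R (?F n) (Q (Suc n)) s" for n s
    by (rule linmap_subtract[OF F module_Q \<chi>'(1) linmap_comp[OF linmap_boundary_Suc[OF A] that]])
  have step: "\<chi> (Suc n) u \<ominus>\<^bsub>Q (Suc n)\<^esub> s (boundary R u) \<in> D ` carrier (Q (Suc (Suc n)))"
    if s: "linmap R (?F n) (Q (Suc n)) s" and u: "u \<in> carrier (?F (Suc n))"
      and eq: "D (s (boundary R u)) = \<chi> n (boundary R u)" for n s u
  proof (rule exact_Suc)
    interpret Qn: module R "Q n" by (rule module_Q)
    have b: "boundary R u \<in> carrier (?F n)" by (rule linmap_closed[OF linmap_boundary_Suc[OF A] u])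
    have c: "\<chi> (Suc n) u \<in> carrier (Q (Suc n))" by (rule linmap_closed[OF \<chi>'(1) u])
    show "\<chi> (Suc n) u \<ominus>\<^bsub>Q (Suc n)\<^esub> s (boundary R u) \<in> carrier (Q (Suc n))"
      by (rule linmap_closed[OF l[OF s] u])
    show "D (\<chi> (Suc n) u \<ominus>\<^bsub>Q (Suc n)\<^esub> s (boundary R u)) = \<zero>\<^bsub>Q n\<^esub>"
      using linmap_diff[OF module_Q module_Q linmap_D c linmap_closed[OF s b]] \<chi>'(3)[OF u] eq
        Qn.diff_self[OF linmap_closed[OF \<chi>'(1) b]] by simp
  qed
  have "\<exists>s. \<forall>n. ?P n (s n) \<and> ?S n (s n) (s (Suc n))"
  proof (rule dependent_nat_choice)
    have "\<chi> 0 u \<in> D ` carrier (Q (Suc 0))" if "u \<in> carrier (?F 0)" for u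
      by (rule exact_0[OF linmap_closed[OF \<chi>'(1) that] \<chi>'(2)[OF that]])
    from free_module_lift[OF module_Q module_Q linmap_D \<chi>'(1)[of 0, unfolded res_module_def]
        this[unfolded res_module_def]]
    obtain s where s: "linmap R (?F 0) (Q (Suc 0)) s" "\<And>u. u \<in> carrier (?F 0) \<Longrightarrow> D (s u) = \<chi> 0 u"
      unfolding res_module_def by blast
    have "\<chi> (Suc 0) u \<ominus>\<^bsub>Q (Suc 0)\<^esub> s (boundary R u) \<in> D ` carrier (Q (Suc (Suc 0)))"
      if u: "u \<in> carrier (?F (Suc 0))" for u
      by (rule step[OF s(1) u s(2)[OF linmap_closed[OF linmap_boundary_Suc[OF A] u]]])
    with s show "\<exists>s. ?P 0 s" by blast
  next
    fix s n assume P: "?P n s"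
    then have s: "linmap R (?F n) (Q (Suc n)) s" by blast
    have "\<chi> (Suc n) u \<ominus>\<^bsub>Q (Suc n)\<^esub> s (boundary R u) \<in> D ` carrier (Q (Suc (Suc n)))"
      if "u \<in> carrier (?F (Suc n))" for u using P that by blast
    from free_module_lift[OF module_Q module_Q linmap_D l[OF s, unfolded res_module_def]
        this[unfolded res_module_def]]
    obtain s' where s': "linmap R (?F (Suc n)) (Q (Suc (Suc n))) s'"
      "\<And>u. u \<in> carrier (?F (Suc n)) \<Longrightarrow> D (s' u) = \<chi> (Suc n) u \<ominus>\<^bsub>Q (Suc n)\<^esub> s (boundary R u)"
      unfolding res_module_def by blast
    have "\<chi> (Suc (Suc n)) u \<ominus>\<^bsub>Q (Suc (Suc n))\<^esub> s' (boundary R u) \<in> D ` carrier (Q (Suc (Suc (Suc n))))"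
      if u: "u \<in> carrier (?F (Suc (Suc n)))" for u
    proof (rule step[OF s'(1) u])
      interpret Qn: module R "Q (Suc n)" by (rule module_Q)
      have b: "boundary R u \<in> carrier (?F (Suc n))"
        by (rule linmap_closed[OF linmap_boundary_Suc[OF A] u])
      \<comment> \<open>The homotopy relation is evaluated on a boundary, where its s-term vanishes
        because \<open>boundary\<close> squares to zero.\<close>
      have "s (boundary R (boundary R u)) = \<zero>\<^bsub>Q (Suc n)\<^esub>"
        using linmap_zero[OF F module_Q s] boundary_boundary[OF A u] by simp
      then show "D (s' (boundary R u)) = \<chi> (Suc n) (boundary R u)"
        using s'(2)[OF b] Qn.diff_zero[OF linmap_closed[OF \<chi>'(1) b]] by simp
    qed
    with s' show "\<exists>s'. ?P (Suc n) s' \<and> ?S n s s'" by blast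
  qed
  then obtain s where "\<forall>n. ?P n (s n) \<and> ?S n (s n) (s (Suc n))" by blast
  then show thesis by (intro that[of s]) blast+
qed

text \<open>As \<open>\<theta>\<close> kills the image of \<open>D\<close>, applying it to the
  homotopy relation leaves \<open>\<theta>\<close> after \<open>\<chi>\<close> equal to
  \<open>\<theta>\<close> after s after the boundary, a coboundary; in degree 0 it leaves
  zero.\<close>

lemma cobd_null:
  assumes A: "module R A" and N: "module R N" and \<chi>: "chain_lift R A Q D e (\<lambda>_. \<zero>\<^bsub>C\<^esub>) \<chi>"
    and \<theta>: "linmap R (Q n) N \<theta>" "\<And>w. w \<in> carrier (Q (Suc n)) \<Longrightarrow> \<theta> (D w) = \<zero>\<^bsub>N\<^esub>"
  shows "cobd R A N n (\<lambda>u. \<theta> (\<chi> n u))"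
proof -
  interpret N: module R N by fact
  obtain s where s: "\<And>n. linmap R (res_module R A n) (Q (Suc n)) (s n)"
    "\<And>u. u \<in> carrier (res_module R A 0) \<Longrightarrow> D (s 0 u) = \<chi> 0 u"
    "\<And>n u. u \<in> carrier (res_module R A (Suc n)) \<Longrightarrow>
      D (s (Suc n) u) = \<chi> (Suc n) u \<ominus>\<^bsub>Q (Suc n)\<^esub> s n (boundary R u)"
    using null_homotopy[OF A \<chi>] by metis
  show ?thesis
  proof (cases n)
    case 0
    have "\<theta> (\<chi> n u) = \<zero>\<^bsub>N\<^esub>" if "u \<in> carrier (res_module R A n)" for u
      using \<theta>(2)[OF linmap_closed[OF s(1) that]] s(2)[of u] that 0 by simp
    then have "cobd R A N n (\<lambda>u. \<theta> (\<chi> n u)) = cobd R A N n (\<lambda>_. \<zero>\<^bsub>N\<^esub>)" by (rule cobd_cong)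
    then show ?thesis using cobd_zero[OF N] by blast
  next
    case (Suc m)
    have "linmap R (res_module R A m) N (\<lambda>u. \<theta> (s m u))"
      using linmap_comp[OF s(1)[of m]] \<theta>(1) Suc by simp
    moreover have "\<theta> (\<chi> n u) = \<theta> (s m (boundary R u))" if u: "u \<in> carrier (res_module R A n)" for u
    proof -
      have c: "\<chi> n u \<in> carrier (Q n)" by (rule linmap_closed[OF chain_liftD(1)[OF \<chi>] u])
      have "boundary R u \<in> carrier (res_module R A m)"
        using linmap_closed[OF linmap_boundary_Suc[OF A], of u m] u Suc by simp
      then have sc: "s m (boundary R u) \<in> carrier (Q n)" using linmap_closed[OF s(1)] Suc by blast
      have "\<theta> (\<chi> n u) \<ominus>\<^bsub>N\<^esub> \<theta> (s m (boundary R u)) = \<theta> (D (s n u))"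
        using linmap_diff[OF module_Q N \<theta>(1) c sc] s(3)[of u m] u Suc by simp
      also have "\<dots> = \<zero>\<^bsub>N\<^esub>" by (rule \<theta>(2)[OF linmap_closed[OF s(1) u]])
      finally show ?thesis
        using N.diff_eq_zero_iff linmap_closed[OF \<theta>(1)] c sc by blast
    qed
    ultimately show ?thesis using Suc by (intro cobdI[of _ _ _ _ "\<lambda>u. \<theta> (s m u)"]) simp_all
  qed
qed

lemma chain_lift_diff:
  assumes A: "module R A" and \<phi>: "chain_lift R A Q D e f \<phi>" and \<psi>: "chain_lift R A Q D e f \<psi>"
  shows "chain_lift R A Q D e (\<lambda>_. \<zero>\<^bsub>C\<^esub>) (\<lambda>n u. \<phi> n u \<ominus>\<^bsub>Q n\<^esub> \<psi> n u)"
proof (rule chain_liftI)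
  interpret A: module R A by fact
  interpret C: module R C by (rule module_C)
  note c = linmap_closed[OF chain_liftD(1)[OF \<phi>]] linmap_closed[OF chain_liftD(1)[OF \<psi>]]
  show "linmap R (res_module R A n) (Q n) (\<lambda>u. \<phi> n u \<ominus>\<^bsub>Q n\<^esub> \<psi> n u)" for n
    by (rule linmap_subtract[OF module_res_module[OF A.R.is_cring] module_Q
          chain_liftD(1)[OF \<phi>] chain_liftD(1)[OF \<psi>]])
  show "e (\<phi> 0 u \<ominus>\<^bsub>Q 0\<^esub> \<psi> 0 u) = \<zero>\<^bsub>C\<^esub>" if u: "u \<in> carrier (res_module R A 0)" for u
    using linmap_diff[OF module_Q module_C linmap_e c[OF u]] chain_liftD(2)[OF \<phi> u]
      chain_liftD(2)[OF \<psi> u] C.diff_self[OF linmap_closed[OF linmap_e c(1)[OF u]]] by simp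
  show "D (\<phi> (Suc n) u \<ominus>\<^bsub>Q (Suc n)\<^esub> \<psi> (Suc n) u) = \<phi> n (boundary R u) \<ominus>\<^bsub>Q n\<^esub> \<psi> n (boundary R u)"
    if u: "u \<in> carrier (res_module R A (Suc n))" for n u
    using linmap_diff[OF module_Q module_Q linmap_D c[OF u]] chain_liftD(3)[OF \<phi> u]
      chain_liftD(3)[OF \<psi> u] by simp
qed

text \<open>The difference of two lifts of \<open>f\<close> lifts the zero map and is
  null-homotopic; hence the map induced on cohomology is well defined.\<close>

lemma cobd_lift_unique:
  assumes A: "module R A" and N: "module R N"
    and \<phi>: "chain_lift R A Q D e f \<phi>" and \<psi>: "chain_lift R A Q D e f \<psi>"
    and \<theta>: "linmap R (Q n) N \<theta>" "\<And>w. w \<in> carrier (Q (Suc n)) \<Longrightarrow> \<theta> (D w) = \<zero>\<^bsub>N\<^esub>"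
  shows "cobd R A N n (\<lambda>u. \<theta> (\<phi> n u) \<ominus>\<^bsub>N\<^esub> \<theta> (\<psi> n u))"
proof -
  have "cobd R A N n (\<lambda>u. \<theta> (\<phi> n u \<ominus>\<^bsub>Q n\<^esub> \<psi> n u))"
    by (rule cobd_null[OF A N chain_lift_diff[OF A \<phi> \<psi>] \<theta>])
  then show ?thesis
    using linmap_diff[OF module_Q N \<theta>(1) linmap_closed[OF chain_liftD(1)[OF \<phi>]]
        linmap_closed[OF chain_liftD(1)[OF \<psi>]]]
    by (simp cong: cobd_cong)
qed

end

lemma exact_complex_res:
  assumes A: "module R A"
  shows "exact_complex R (res_module R A) (boundary R) (augmentation R A) A"
proof -
  interpret A: module R A by fact
  show ?thesis
  proof (rule exact_complex.intro)
    show "c \<in> augmentation R A ` carrier (res_module R A 0)" if "c \<in> carrier A" for c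
      using augmentation_surj[OF A] that by simp
    show "u \<in> boundary R ` carrier (res_module R A (Suc 0))"
      if "u \<in> carrier (res_module R A 0)" "augmentation R A u = \<zero>\<^bsub>A\<^esub>" for u
      using res_exact_0[OF A that] by auto
    show "u \<in> boundary R ` carrier (res_module R A (Suc (Suc n)))"
      if "u \<in> carrier (res_module R A (Suc n))" "boundary R u = \<zero>\<^bsub>res_module R A n\<^esub>" for u n
      using res_exact_Suc[OF A that(1)] that(2) by auto
  qed (rule A module_res_module[OF A.R.is_cring] linmap_boundary_Suc[OF A] linmap_augmentation[OF A])+
qed

lemma cocyc_lift_unique:
  assumes A: "module R A" and B: "module R B" and N: "module R N"
    and "res_lift R A B f \<phi>" "res_lift R A B f \<psi>" "cocyc R B N i g"
  shows "cobd R A N i (\<lambda>u. g (\<phi> i u) \<ominus>\<^bsub>N\<^esub> g (\<psi> i u))"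
proof -
  interpret B: exact_complex R "res_module R B" "boundary R" "augmentation R B" B
    by (rule exact_complex_res[OF B])
  show ?thesis
    by (rule B.cobd_lift_unique[OF A N assms(4,5) cocyc_linmap[OF assms(6)] cocyc_boundary[OF assms(6)]])
qed

section \<open>The mapping cone of an inclusion\<close>

definition prod_module ::
    "('r, 'a, 'y) module_scheme \<Rightarrow> ('r, 'b, 'z) module_scheme \<Rightarrow> ('r, 'a \<times> 'b) module" where
  "prod_module A B =
     \<lparr>carrier = carrier A \<times> carrier B, monoid.mult = undefined, one = undefined,
      ring.zero = (\<zero>\<^bsub>A\<^esub>, \<zero>\<^bsub>B\<^esub>),
      ring.add = (\<lambda>p q. (fst p \<oplus>\<^bsub>A\<^esub> fst q, snd p \<oplus>\<^bsub>B\<^esub> snd q)),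
      smult = (\<lambda>r p. (r \<odot>\<^bsub>A\<^esub> fst p, r \<odot>\<^bsub>B\<^esub> snd p))\<rparr>"

lemma module_prod_module:
  assumes "module R A" "module R B"
  shows "module R (prod_module A B)"
proof -
  interpret A: module R A by fact
  interpret B: module R B by fact
  show ?thesis
  proof (rule moduleI)
    show "abelian_group (prod_module A B)"
    proof (rule abelian_groupI)
      fix p assume "p \<in> carrier (prod_module A B)"
      then show "\<exists>q\<in>carrier (prod_module A B). q \<oplus>\<^bsub>prod_module A B\<^esub> p = \<zero>\<^bsub>prod_module A B\<^esub>"
        by (intro bexI[of _ "(\<ominus>\<^bsub>A\<^esub> fst p, \<ominus>\<^bsub>B\<^esub> snd p)"])
          (auto simp: prod_module_def A.M.l_neg B.M.l_neg)
    qed (auto simp: prod_module_def A.M.a_ac B.M.a_ac)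
  qed (auto simp: prod_module_def A.R.is_cring A.smult_l_distr B.smult_l_distr A.smult_r_distr
      B.smult_r_distr A.smult_assoc1 B.smult_assoc1)
qed

lemma linmap_fst: "linmap R (prod_module A B) A fst"
  and linmap_snd: "linmap R (prod_module A B) B snd"
  by (auto simp: linmap_def prod_module_def)

lemma linmap_Pair:
  "linmap R P A f \<Longrightarrow> linmap R P B g \<Longrightarrow> linmap R P (prod_module A B) (\<lambda>p. (f p, g p))"
  by (auto simp: linmap_def prod_module_def Pi_def)

text \<open>The resolution of \<open>K\<close> shifted up one degree. The free module on the empty
  set serves as zero module in degree 0, so the operations are the same functions in all
  degrees.\<close>

definition cone_fst ::
    "('r, 'x) ring_scheme \<Rightarrow> ('r, 'a, 'y) module_scheme \<Rightarrow> nat \<Rightarrow> ('r, ('r, 'a) gen \<Rightarrow> 'r) module" where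
  "cone_fst R K n = free_module R (case n of 0 \<Rightarrow> {} | Suc m \<Rightarrow> res_basis R K m)"

definition cone ::
    "('r, 'x) ring_scheme \<Rightarrow> ('r, 'a, 'y) module_scheme \<Rightarrow> ('r, 'b, 'z) module_scheme \<Rightarrow> nat
      \<Rightarrow> ('r, (('r, 'a) gen \<Rightarrow> 'r) \<times> (('r, 'b) gen \<Rightarrow> 'r)) module" where
  "cone R K B n = prod_module (cone_fst R K n) (res_module R B n)"

text \<open>
  The inclusion of \<open>K \<subseteq> B\<close> is the identity on chains, so the differential of its mapping cone
  is \<open>(a, b) \<mapsto> (-\<partial>a, a + \<partial>b)\<close>.
\<close>

definition cone_diff ::
    "('r, 'x) ring_scheme \<Rightarrow> (('r, 'a) gen \<Rightarrow> 'r) \<times> (('r, 'a) gen \<Rightarrow> 'r)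
      \<Rightarrow> (('r, 'a) gen \<Rightarrow> 'r) \<times> (('r, 'a) gen \<Rightarrow> 'r)" where
  "cone_diff R p =
     (\<lambda>x. (\<ominus>\<^bsub>R\<^esub> \<one>\<^bsub>R\<^esub>) \<otimes>\<^bsub>R\<^esub> boundary R (fst p) x, \<lambda>x. fst p x \<oplus>\<^bsub>R\<^esub> boundary R (snd p) x)"

lemma module_cone_fst: "cring R \<Longrightarrow> module R (cone_fst R K n)"
  unfolding cone_fst_def by (rule module_free_module)

lemma cone_fst_Suc: "cone_fst R K (Suc n) = res_module R K n"
  by (simp add: cone_fst_def res_module_def)

lemma cone_fst_0: "u \<in> carrier (cone_fst R K 0) \<longleftrightarrow> u = (\<lambda>_. \<zero>\<^bsub>R\<^esub>)" if "cring R"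
proof -
  interpret cring R by fact
  show ?thesis by (auto simp: cone_fst_def free_module_def supp_def fun_eq_iff)
qed

lemma cone_fst_simps:
  "\<zero>\<^bsub>cone_fst R K n\<^esub> = (\<lambda>_. \<zero>\<^bsub>R\<^esub>)"
  "add (cone_fst R K n) = (\<lambda>u v x. u x \<oplus>\<^bsub>R\<^esub> v x)"
  "smult (cone_fst R K n) = (\<lambda>r u x. r \<otimes>\<^bsub>R\<^esub> u x)"
  by (simp_all add: cone_fst_def)

text \<open>In degree 0 the zero module is mapped to F_0, matching the truncated i - 1 in
  \<open>cobd\<close>: a primitive of a coboundary applies to the first component of the cone in
  every degree.\<close>

lemma linmap_cone_fst: "linmap R (cone_fst R K n) (res_module R K (n - 1)) (\<lambda>u. u)"
  by (cases n) (auto simp: linmap_def cone_fst_def res_module_def free_module_def)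

lemma linmap_boundary_cone_fst:
  assumes "module R K"
  shows "linmap R (res_module R K n) (cone_fst R K n) (boundary R)"
proof (cases n)
  case 0
  interpret K: module R K by fact
  have l: "linmap R (res_module R K n) (cone_fst R K n) (\<lambda>_. \<zero>\<^bsub>cone_fst R K n\<^esub>)"
    by (rule linmap_const_zero[OF module_cone_fst[OF K.R.is_cring]])
  have "boundary R u = \<zero>\<^bsub>cone_fst R K n\<^esub>" if "u \<in> carrier (res_module R K n)" for u
    using boundary_eq_zero[OF K.R.is_cring] that 0 by (simp add: cone_fst_simps)
  from linmap_cong[THEN iffD2, OF this module_res_module[OF K.R.is_cring] l] show ?thesis .
qed (simp add: cone_fst_Suc linmap_boundary_Suc[OF assms])

text \<open>A short exact sequence is recorded by its surjection alone; the kernel is a submodule of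
  \<open>B\<close> with the same element type, as the cone requires.\<close>

locale short_exact =
  fixes R :: "('r, 'x) ring_scheme" and B :: "('r, 'b, 'y) module_scheme"
    and C :: "('r, 'c, 'z) module_scheme" and \<pi> :: "'b \<Rightarrow> 'c"
  assumes B: "module R B" and C: "module R C" and \<pi>: "linmap R B C \<pi>"
    and surj: "c \<in> carrier C \<Longrightarrow> c \<in> \<pi> ` carrier B"
begin

definition ker :: "'b set" where "ker = {b \<in> carrier B. \<pi> b = \<zero>\<^bsub>C\<^esub>}"

abbreviation "K \<equiv> B\<lparr>carrier := ker\<rparr>"

lemma R_cring: "cring R" using B by (rule module.axioms)

lemma ker_submodule: "submodule ker R B"
  unfolding ker_def by (rule submodule_kernel[OF B C \<pi>])

lemma module_K: "module R K" by (rule module_submodule[OF B ker_submodule])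

lemma module_cone: "module R (cone R K B n)"
  unfolding cone_def by (rule module_prod_module[OF module_cone_fst[OF R_cring] module_res_module[OF R_cring]])

lemma linmap_K_B: "linmap R (res_module R K n) (res_module R B n) (\<lambda>u. u)"
  using res_module_submodule[OF B ker_submodule] by (auto simp: linmap_def)

lemma linmap_cone_diff: "linmap R (cone R K B (Suc n)) (cone R K B n) (cone_diff R)"
proof -
  have f: "linmap R (cone R K B (Suc n)) (res_module R K n) fst"
    unfolding cone_def cone_fst_Suc by (rule linmap_fst)
  have s: "linmap R (cone R K B (Suc n)) (res_module R B (Suc n)) snd"
    unfolding cone_def by (rule linmap_snd)
  interpret cring R by (rule R_cring)
  have "linmap R (cone R K B (Suc n)) (cone R K B n)
      (\<lambda>p. ((\<ominus>\<^bsub>R\<^esub> \<one>\<^bsub>R\<^esub>) \<odot>\<^bsub>cone_fst R K n\<^esub> boundary R (fst p), fst p \<oplus>\<^bsub>res_module R B n\<^esub> boundary R (snd p)))"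
    unfolding cone_def[of R K B n]
    by (intro linmap_Pair linmap_scale linmap_plus module_cone_fst module_res_module R_cring
        linmap_comp[OF f linmap_boundary_cone_fst[OF module_K]] linmap_comp[OF f linmap_K_B]
        linmap_comp[OF s linmap_boundary_Suc[OF B]]) simp
  then show ?thesis by (simp add: cone_diff_def[abs_def] cone_fst_simps)
qed

lemma cone_SucE:
  assumes "w \<in> carrier (cone R K B (Suc n))"
  obtains a b where "w = (a, b)" "a \<in> carrier (res_module R K n)" "b \<in> carrier (res_module R B (Suc n))"
  using assms by (cases w) (simp add: cone_def cone_fst_Suc prod_module_def)

lemma cone_SucI:
  "a \<in> carrier (res_module R K n) \<Longrightarrow> b \<in> carrier (res_module R B (Suc n)) \<Longrightarrow>
    (a, b) \<in> carrier (cone R K B (Suc n))"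
  by (simp add: cone_def cone_fst_Suc prod_module_def)

lemma K_B: "a \<in> carrier (res_module R K n) \<Longrightarrow> a \<in> carrier (res_module R B n)"
  using res_module_submodule[OF B ker_submodule] by blast

lemma fst_cone_diff: "fst (cone_diff R p) = (\<ominus>\<^bsub>R\<^esub> \<one>\<^bsub>R\<^esub>) \<odot>\<^bsub>res_module R K n\<^esub> boundary R (fst p)"
  and snd_cone_diff: "snd (cone_diff R p) = fst p \<oplus>\<^bsub>res_module R B n\<^esub> boundary R (snd p)"
  by (simp_all add: cone_diff_def)

text \<open>If b' has boundary b - a, then (a, b') is a preimage.\<close>

lemma cone_diff_lift:
  assumes a: "a \<in> carrier (res_module R K (Suc n))" and b: "b \<in> carrier (res_module R B (Suc n))"
    and D: "b \<ominus>\<^bsub>res_module R B (Suc n)\<^esub> a \<in> boundary R ` carrier (res_module R B (Suc (Suc n)))"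
  shows "((\<ominus>\<^bsub>R\<^esub> \<one>\<^bsub>R\<^esub>) \<odot>\<^bsub>res_module R K n\<^esub> boundary R a, b) \<in> cone_diff R ` carrier (cone R K B (Suc (Suc n)))"
proof -
  interpret F: module R "res_module R B (Suc n)" by (rule module_res_module[OF R_cring])
  obtain b' where b': "b' \<in> carrier (res_module R B (Suc (Suc n)))"
    "b \<ominus>\<^bsub>res_module R B (Suc n)\<^esub> a = boundary R b'" using D by blast
  have "b = a \<oplus>\<^bsub>res_module R B (Suc n)\<^esub> boundary R b'"
    using F.diff_add_cancel[OF b K_B[OF a]] F.M.a_comm[OF K_B[OF a] F.M.minus_closed[OF b K_B[OF a]]] b'(2)
    by metis
  then have "cone_diff R (a, b') = ((\<ominus>\<^bsub>R\<^esub> \<one>\<^bsub>R\<^esub>) \<odot>\<^bsub>res_module R K n\<^esub> boundary R a, b)"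
    by (simp add: cone_diff_def)
  then show ?thesis using cone_SucI[OF a b'(1)] by (metis imageI)
qed

text \<open>Write d for the boundary. For a cycle (a, b), exactness over \<open>K\<close> gives a =
  -d a'; then b - a' is a cycle, exactness over \<open>B\<close> makes it d b', and (a', b') maps to
  (a, b).\<close>

lemma exact_complex_cone:
  "exact_complex R (cone R K B) (cone_diff R) (\<lambda>p. \<pi> (augmentation R B (snd p))) C"
proof (rule exact_complex.intro)
  interpret cring R by (rule R_cring)
  interpret B: module R B by (rule B)
  have m1: "\<ominus>\<^bsub>R\<^esub> \<one>\<^bsub>R\<^esub> \<in> carrier R" by simp
  have FK: "module R (res_module R K n)" and FB: "module R (res_module R B n)" for n
    by (rule module_res_module[OF R_cring])+
  have aug_K: "augmentation R K u = augmentation R B u" if "u \<in> carrier (res_module R K 0)" for u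
    by (rule augmentation_submodule[OF B ker_submodule that])
  have zero0: "(\<lambda>_. \<zero>\<^bsub>R\<^esub>) \<in> carrier (cone_fst R K 0)" by (simp add: cone_fst_0[OF R_cring])
  \<comment> \<open>Exactness of the resolution of \<open>K\<close>, with the sign of the cone
    differential absorbed by taking -v instead of v.\<close>
  have neg: "\<exists>a'\<in>carrier (res_module R K (Suc n)). (\<ominus>\<^bsub>R\<^esub> \<one>\<^bsub>R\<^esub>) \<odot>\<^bsub>res_module R K n\<^esub> boundary R a' = a"
    if a: "a \<in> carrier (res_module R K n)" and bd: "boundary R a = (\<lambda>_. \<zero>\<^bsub>R\<^esub>)"
      and aug: "n = 0 \<Longrightarrow> augmentation R K a = \<zero>\<^bsub>K\<^esub>" for a n
  proof -
    interpret F: module R "res_module R K n" by (rule FK)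
    interpret F': module R "res_module R K (Suc n)" by (rule FK)
    obtain v where v: "v \<in> carrier (res_module R K (Suc n))" "boundary R v = a"
    proof (cases n)
      case 0
      then show thesis using res_exact_0[OF module_K, of a] a aug that by auto
    next
      case (Suc m)
      then show thesis using res_exact_Suc[OF module_K, of a m] a bd that by auto
    qed
    have "(\<ominus>\<^bsub>R\<^esub> \<one>\<^bsub>R\<^esub>) \<odot>\<^bsub>res_module R K n\<^esub> boundary R ((\<ominus>\<^bsub>R\<^esub> \<one>\<^bsub>R\<^esub>) \<odot>\<^bsub>res_module R K (Suc n)\<^esub> v)
        = (\<ominus>\<^bsub>R\<^esub> \<one>\<^bsub>R\<^esub> \<otimes>\<^bsub>R\<^esub> \<ominus>\<^bsub>R\<^esub> \<one>\<^bsub>R\<^esub>) \<odot>\<^bsub>res_module R K n\<^esub> a"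
      unfolding linmap_smult[OF linmap_boundary_Suc[OF module_K] m1 v(1)] v(2)
      by (rule F.smult_assoc1[symmetric, OF m1 m1 a])
    also have "\<ominus>\<^bsub>R\<^esub> \<one>\<^bsub>R\<^esub> \<otimes>\<^bsub>R\<^esub> \<ominus>\<^bsub>R\<^esub> \<one>\<^bsub>R\<^esub> = \<one>\<^bsub>R\<^esub>" by (simp add: l_minus r_minus)
    also have "\<one>\<^bsub>R\<^esub> \<odot>\<^bsub>res_module R K n\<^esub> a = a" by (rule F.smult_one[OF a])
    finally show ?thesis using F'.smult_closed[OF m1 v(1)] by blast
  qed
  show "linmap R (cone R K B 0) C (\<lambda>p. \<pi> (augmentation R B (snd p)))"
    unfolding cone_def by (rule linmap_comp[OF linmap_comp[OF linmap_snd linmap_augmentation[OF B]] \<pi>])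
  show "c \<in> (\<lambda>p. \<pi> (augmentation R B (snd p))) ` carrier (cone R K B 0)" if "c \<in> carrier C" for c
  proof -
    obtain b where b: "b \<in> carrier B" "c = \<pi> b" using surj[OF \<open>c \<in> carrier C\<close>] by blast
    obtain u where u: "u \<in> carrier (res_module R B 0)" "augmentation R B u = b"
      by (rule augmentation_surjE[OF B b(1)])
    then show ?thesis using b(2) zero0
      by (intro image_eqI[of _ _ "(\<lambda>_. \<zero>\<^bsub>R\<^esub>, u)"]) (simp_all add: cone_def prod_module_def)
  qed
  show "u \<in> cone_diff R ` carrier (cone R K B (Suc 0))"
    if u: "u \<in> carrier (cone R K B 0)" and eq: "\<pi> (augmentation R B (snd u)) = \<zero>\<^bsub>C\<^esub>" for u
  proof -
    interpret F: module R "res_module R B 0" by (rule FB)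
    obtain b where b: "u = (\<lambda>_. \<zero>\<^bsub>R\<^esub>, b)" "b \<in> carrier (res_module R B 0)"
      using u by (cases u) (auto simp: cone_def prod_module_def cone_fst_0[OF R_cring])
    \<comment> \<open>The condition on b puts its augmentation in the kernel, so some chain a over
      \<open>K\<close> has the same augmentation, and b - a is a boundary.\<close>
    have "augmentation R B b \<in> carrier K"
      using linmap_closed[OF linmap_augmentation[OF B] b(2)] eq b(1) by (simp add: ker_def)
    then obtain a where a: "a \<in> carrier (res_module R K 0)" "augmentation R K a = augmentation R B b"
      by (rule augmentation_surjE[OF module_K])
    have c: "b \<ominus>\<^bsub>res_module R B 0\<^esub> a \<in> carrier (res_module R B 0)"
      by (rule F.M.minus_closed[OF b(2) K_B[OF a(1)]])
    have "augmentation R B (b \<ominus>\<^bsub>res_module R B 0\<^esub> a) = \<zero>\<^bsub>B\<^esub>"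
      using linmap_diff[OF FB B linmap_augmentation[OF B] b(2) K_B[OF a(1)]] a(2) aug_K[OF a(1)]
        B.diff_self linmap_closed[OF linmap_augmentation[OF B] b(2)] by simp
    then obtain b' where b': "b' \<in> carrier (res_module R B (Suc 0))"
      "b \<ominus>\<^bsub>res_module R B 0\<^esub> a = boundary R b'"
      using res_exact_0[OF B c] by auto
    have "b = a \<oplus>\<^bsub>res_module R B 0\<^esub> boundary R b'"
      using F.diff_add_cancel[OF b(2) K_B[OF a(1)]]
        F.M.a_comm[OF K_B[OF a(1)] c] b'(2) by metis
    then have "cone_diff R (a, b') = u"
      using b(1) boundary_eq_zero[OF R_cring a(1)] by (simp add: cone_diff_def)
    then show ?thesis using cone_SucI[OF a(1) b'(1)] by (metis imageI)
  qed
  show "u \<in> cone_diff R ` carrier (cone R K B (Suc (Suc n)))"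
    if u: "u \<in> carrier (cone R K B (Suc n))" and eq: "cone_diff R u = \<zero>\<^bsub>cone R K B n\<^esub>" for u n
  proof -
    interpret Fn: module R "res_module R B n" by (rule FB)
    interpret F: module R "res_module R B (Suc n)" by (rule FB)
    obtain a b where ab: "u = (a, b)" "a \<in> carrier (res_module R K n)" "b \<in> carrier (res_module R B (Suc n))"
      using u by (rule cone_SucE)
    have e1: "(\<lambda>x. (\<ominus>\<^bsub>R\<^esub> \<one>\<^bsub>R\<^esub>) \<otimes>\<^bsub>R\<^esub> boundary R a x) = (\<lambda>_. \<zero>\<^bsub>R\<^esub>)"
      and e2: "a \<oplus>\<^bsub>res_module R B n\<^esub> boundary R b = \<zero>\<^bsub>res_module R B n\<^esub>"
      using eq by (simp_all add: ab(1) cone_diff_def cone_def prod_module_def cone_fst_simps)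
    have bb: "boundary R b \<in> carrier (res_module R B n)" by (rule linmap_closed[OF linmap_boundary_Suc[OF B] ab(3)])
    have ba: "boundary R a = (\<lambda>_. \<zero>\<^bsub>R\<^esub>)"
    proof
      fix x
      have "boundary R a \<in> carrier (res_module R K (n - 1))"
        by (rule linmap_closed[OF linmap_boundary[OF module_K] ab(2)])
      then have c: "boundary R a x \<in> carrier R" unfolding res_module_def by (rule free_module_value)
      then have "\<ominus>\<^bsub>R\<^esub> (boundary R a x) = \<zero>\<^bsub>R\<^esub>" using fun_cong[OF e1, of x] by (simp add: l_minus)
      then show "boundary R a x = \<zero>\<^bsub>R\<^esub>" using c by (metis minus_minus minus_zero)
    qed
    \<comment> \<open>In degree 0 the vanishing of \<open>boundary R a\<close> carries no
      information; exactness over \<open>K\<close> needs the augmentation, which is read off from a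
      + d b = 0, with d the boundary.\<close>
    have "augmentation R K a = \<zero>\<^bsub>K\<^esub>" if "n = 0"
    proof -
      have a0: "a \<in> carrier (res_module R B 0)" using K_B[OF ab(2)] that by simp
      have "augmentation R B (a \<oplus>\<^bsub>res_module R B 0\<^esub> boundary R b) = \<zero>\<^bsub>B\<^esub>"
        using e2 that linmap_zero[OF FB B linmap_augmentation[OF B]] by simp
      moreover have "boundary R b \<in> carrier (res_module R B 0)" using bb that by simp
      note linmap_add[OF linmap_augmentation[OF B] a0 this]
      moreover have "augmentation R B (boundary R b) = \<zero>\<^bsub>B\<^esub>"
        using augmentation_boundary[OF B, of b] ab(3) that by simp
      ultimately have "augmentation R B a \<oplus>\<^bsub>B\<^esub> \<zero>\<^bsub>B\<^esub> = \<zero>\<^bsub>B\<^esub>" by metis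
      then have "augmentation R B a = \<zero>\<^bsub>B\<^esub>"
        using linmap_closed[OF linmap_augmentation[OF B] a0] by (simp only: B.M.r_zero)
      then show ?thesis using aug_K ab(2) that by simp
    qed
    from neg[OF ab(2) ba this] obtain a' where a': "a' \<in> carrier (res_module R K (Suc n))"
      "(\<ominus>\<^bsub>R\<^esub> \<one>\<^bsub>R\<^esub>) \<odot>\<^bsub>res_module R K n\<^esub> boundary R a' = a" by blast
    have a'c: "boundary R a' \<in> carrier (res_module R K n)"
      by (rule linmap_closed[OF linmap_boundary_Suc[OF module_K] a'(1)])
    have "a = \<ominus>\<^bsub>res_module R B n\<^esub> boundary R a'"
      using a'(2) Fn.minus_eq_smult[OF K_B[OF a'c]] by simp
    then have "boundary R b \<ominus>\<^bsub>res_module R B n\<^esub> boundary R a' = a \<oplus>\<^bsub>res_module R B n\<^esub> boundary R b"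
      using Fn.M.a_comm[OF K_B[OF ab(2)] bb] by (simp only: a_minus_def)
    then have "boundary R b = boundary R a'"
      using e2 Fn.diff_eq_zero_iff[OF bb K_B[OF a'c]] by (simp only:)
    then have "boundary R (b \<ominus>\<^bsub>res_module R B (Suc n)\<^esub> a') = (\<lambda>_. \<zero>\<^bsub>R\<^esub>)"
      using linmap_diff[OF FB FB linmap_boundary_Suc[OF B] ab(3) K_B[OF a'(1)]] Fn.diff_self[OF bb] by simp
    then have "b \<ominus>\<^bsub>res_module R B (Suc n)\<^esub> a' \<in> boundary R ` carrier (res_module R B (Suc (Suc n)))"
      using res_exact_Suc[OF B F.M.minus_closed[OF ab(3) K_B[OF a'(1)]]] by force
    from cone_diff_lift[OF a'(1) ab(3) this] show ?thesis using a'(2) ab(1) by simp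
  qed
qed (rule module_cone C linmap_cone_diff)+

sublocale cone: exact_complex R "cone R K B" "cone_diff R" "\<lambda>p. \<pi> (augmentation R B (snd p))" C
  by (rule exact_complex_cone)

end

section \<open>The long exact sequence\<close>

definition ext_zero ::
    "('r, 'x) ring_scheme \<Rightarrow> ('r, 'a, 'y) module_scheme \<Rightarrow> ('r, 'n, 'z) module_scheme \<Rightarrow> nat \<Rightarrow> bool" where
  "ext_zero R A N i \<longleftrightarrow> (\<forall>f. cocyc R A N i f \<longrightarrow> cobd R A N i f)"

lemma (in module) neg_smult_twice:
  "x \<in> carrier M \<Longrightarrow> (\<ominus>\<^bsub>R\<^esub> \<one>\<^bsub>R\<^esub>) \<odot>\<^bsub>M\<^esub> ((\<ominus>\<^bsub>R\<^esub> \<one>\<^bsub>R\<^esub>) \<odot>\<^bsub>M\<^esub> x) = x"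
  by (simp add: minus_eq_smult[symmetric])

lemma (in module) diff_split:
  assumes "x \<in> carrier M" "h \<in> carrier M" "k \<in> carrier M"
  shows "x \<ominus>\<^bsub>M\<^esub> k = (x \<ominus>\<^bsub>M\<^esub> (h \<oplus>\<^bsub>M\<^esub> k)) \<oplus>\<^bsub>M\<^esub> h"
proof -
  have "(x \<ominus>\<^bsub>M\<^esub> (h \<oplus>\<^bsub>M\<^esub> k)) \<oplus>\<^bsub>M\<^esub> h = x \<oplus>\<^bsub>M\<^esub> (\<ominus>\<^bsub>M\<^esub> k \<oplus>\<^bsub>M\<^esub> (\<ominus>\<^bsub>M\<^esub> h \<oplus>\<^bsub>M\<^esub> h))"
    using assms by (simp add: M.minus_eq M.minus_add M.a_ac)
  then show ?thesis using assms by (simp add: M.l_neg M.minus_eq)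
qed

context short_exact
begin

lemma FK: "module R (res_module R K n)" and FB: "module R (res_module R B n)"
  and FC: "module R (res_module R C n)"
  by (rule module_res_module[OF R_cring])+

lemma res_map_lift: "res_lift R B C \<pi> (\<lambda>_. res_map R \<pi>)"
  by (rule chain_lift_res_map[OF B C \<pi>])

text \<open>Another lift of \<open>\<pi>\<close> is \<open>res_map R \<pi>\<close> followed by a
  lift of the identity of \<open>C\<close>; comparing the two relates classes over \<open>B\<close>
  with classes over \<open>C\<close>.\<close>

lemma chain_lift_cone_snd:
  "chain_lift R B (cone R K B) (cone_diff R) (\<lambda>p. \<pi> (augmentation R B (snd p))) \<pi> (\<lambda>n v. (\<lambda>_. \<zero>\<^bsub>R\<^esub>, v))"
proof (rule chain_liftI)
  interpret cring R by (rule R_cring)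
  show "linmap R (res_module R B n) (cone R K B n) (\<lambda>v. (\<lambda>_. \<zero>\<^bsub>R\<^esub>, v))" for n
    using linmap_Pair[OF linmap_const_zero[OF module_cone_fst[OF R_cring]] linmap_id]
    by (simp add: cone_def cone_fst_simps)
  show "cone_diff R (\<lambda>_. \<zero>\<^bsub>R\<^esub>, u) = (\<lambda>_. \<zero>\<^bsub>R\<^esub>, boundary R u)"
    if u: "u \<in> carrier (res_module R B (Suc n))" for n u
  proof -
    have "boundary R (\<lambda>_. \<zero>\<^bsub>R\<^esub>) = (\<lambda>_ :: ('r, 'b) gen. \<zero>\<^bsub>R\<^esub>)"
      using linmap_zero[OF FB FB linmap_boundary_Suc[OF B]] by simp
    moreover have "boundary R u x \<in> carrier R" for x
      using linmap_closed[OF linmap_boundary_Suc[OF B] u]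
        free_module_value[of "boundary R u" R "res_basis R B n"] by (simp add: res_module_def)
    ultimately show ?thesis by (simp add: cone_diff_def)
  qed
qed simp

text \<open>A primitive h of f over \<open>K\<close> makes \<open>\<theta>\<close> (a, b) = h a + f
  b vanish on boundaries of the cone. Pulling \<open>\<theta>\<close> back along a lift of the
  identity of \<open>C\<close> gives g, and uniqueness of lifts compares it with f over
  \<open>B\<close>.\<close>

theorem ext_exact_middle:
  assumes N: "module R N" and f: "cocyc R B N i f" and fK: "cobd R K N i f"
  shows "\<exists>g. cocyc R C N i g \<and> cobd R B N i (\<lambda>v. f v \<ominus>\<^bsub>N\<^esub> g (res_map R \<pi> v))"
proof -
  interpret N: module R N by fact
  have m1: "\<ominus>\<^bsub>R\<^esub> \<one>\<^bsub>R\<^esub> \<in> carrier R" by simp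
  obtain h where h: "linmap R (res_module R K (i - 1)) N h"
    "\<And>u. u \<in> carrier (res_module R K i) \<Longrightarrow> f u = h (boundary R u)" using fK by (rule cobdE) blast
  define \<theta> where "\<theta> = (\<lambda>p. h (fst p) \<oplus>\<^bsub>N\<^esub> f (snd p))"
  have \<theta>: "linmap R (cone R K B i) N \<theta>"
    unfolding \<theta>_def cone_def
    by (intro linmap_plus[OF N] linmap_comp[OF linmap_comp[OF linmap_fst linmap_cone_fst] h(1)]
        linmap_comp[OF linmap_snd cocyc_linmap[OF f]])
  have \<theta>D: "\<theta> (cone_diff R w) = \<zero>\<^bsub>N\<^esub>" if w: "w \<in> carrier (cone R K B (Suc i))" for w
  proof -
    obtain a b where ab: "w = (a, b)" "a \<in> carrier (res_module R K i)"
      "b \<in> carrier (res_module R B (Suc i))" using w by (rule cone_SucE)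
    have ba: "boundary R a \<in> carrier (res_module R K (i - 1))"
      by (rule linmap_closed[OF linmap_boundary[OF module_K] ab(2)])
    have bb: "boundary R b \<in> carrier (res_module R B i)"
      by (rule linmap_closed[OF linmap_boundary_Suc[OF B] ab(3)])
    have hb: "h (boundary R a) \<in> carrier N" by (rule linmap_closed[OF h(1) ba])
    have "h (fst (cone_diff R w)) = \<ominus>\<^bsub>N\<^esub> h (boundary R a)"
      unfolding fst_cone_diff[of "(a, b)" "i - 1"] ab(1) fst_conv linmap_smult[OF h(1) m1 ba]
      using N.minus_eq_smult[OF hb] by simp
    moreover have "f (snd (cone_diff R w)) = h (boundary R a)"
      unfolding snd_cone_diff[of "(a, b)" i] ab(1) fst_conv snd_conv
        linmap_add[OF cocyc_linmap[OF f] K_B[OF ab(2)] bb] cocyc_boundary[OF f ab(3)] h(2)[OF ab(2)]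
      using hb by simp
    ultimately show ?thesis using hb by (simp add: \<theta>_def N.M.l_neg)
  qed
  obtain \<phi> where \<phi>: "chain_lift R C (cone R K B) (cone_diff R) (\<lambda>p. \<pi> (augmentation R B (snd p))) (\<lambda>c. c) \<phi>"
    using cone.chain_lift_exists[OF C linmap_id] by blast
  have "cocyc R C N i (\<lambda>w. \<theta> (\<phi> i w))"
    unfolding cocyc_def
    using linmap_comp[OF chain_liftD(1)[OF \<phi>] \<theta>] \<theta>D linmap_closed[OF chain_liftD(1)[OF \<phi>]]
      chain_liftD(3)[OF \<phi>, symmetric] by simp
  moreover have "cobd R B N i (\<lambda>v. f v \<ominus>\<^bsub>N\<^esub> \<theta> (\<phi> i (res_map R \<pi> v)))"
  proof -
    have "\<theta> (\<lambda>_. \<zero>\<^bsub>R\<^esub>, v) = f v" if "v \<in> carrier (res_module R B i)" for v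
      using linmap_zero[OF FK N h(1)] linmap_closed[OF cocyc_linmap[OF f] that] by (simp add: \<theta>_def)
    then show ?thesis
      using cone.cobd_lift_unique[OF B N chain_lift_cone_snd chain_lift_comp[OF B res_map_lift \<phi>] \<theta> \<theta>D]
      by (simp cong: cobd_cong)
  qed
  ultimately show ?thesis by blast
qed

text \<open>
  Precomposition with \<open>p\<close> is the connecting homomorphism; the first component of a chain map
  from the resolution of \<open>C\<close> to the cone provides \<open>p\<close>.
\<close>

theorem ext_connecting:
  assumes N: "module R N"
  shows "\<exists>p. (\<forall>i. linmap R (res_module R C (Suc i)) (res_module R K i) (p i)) \<and>
    (\<forall>i. \<forall>w\<in>carrier (res_module R C (Suc (Suc i))).
      p i (boundary R w) = (\<ominus>\<^bsub>R\<^esub> \<one>\<^bsub>R\<^esub>) \<odot>\<^bsub>res_module R K i\<^esub> boundary R (p (Suc i) w)) \<and>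
    (\<forall>i g. cocyc R C N (Suc i) g \<longrightarrow> cobd R B N (Suc i) (\<lambda>v. g (res_map R \<pi> v)) \<longrightarrow>
      (\<exists>k. cocyc R K N i k \<and> cobd R C N (Suc i) (\<lambda>w. g w \<ominus>\<^bsub>N\<^esub> k (p i w))))"
proof -
  interpret cring R by (rule R_cring)
  have m1: "\<ominus>\<^bsub>R\<^esub> \<one>\<^bsub>R\<^esub> \<in> carrier R" by simp
  obtain \<phi> where \<phi>: "chain_lift R C (cone R K B) (cone_diff R) (\<lambda>p. \<pi> (augmentation R B (snd p))) (\<lambda>c. c) \<phi>"
    using cone.chain_lift_exists[OF C linmap_id] by blast
  note \<phi>' = chain_liftD[OF \<phi>]
  \<comment> \<open>\<open>\<pi>\<close> is zero on \<open>K\<close>, but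
    \<open>res_map R \<pi>\<close> need not be: it sends the generator over any element of
    \<open>K\<close> to the generator over zero. It is only null-homotopic, by
    \<open>t\<close>.\<close>
  have "chain_lift R K (res_module R C) (boundary R) (augmentation R C) (\<lambda>_. \<zero>\<^bsub>C\<^esub>) (\<lambda>_. res_map R \<pi>)"
    by (rule chain_lift_cong[OF chain_lift_inclusion[OF B ker_submodule res_map_lift] module_K])
      (simp add: ker_def)
  from exact_complex.null_homotopy[OF exact_complex_res[OF C] module_K this]
  obtain t where t: "\<And>n. linmap R (res_module R K n) (res_module R C (Suc n)) (t n)"
    "\<And>u. u \<in> carrier (res_module R K 0) \<Longrightarrow> boundary R (t 0 u) = res_map R \<pi> u"
    "\<And>n u. u \<in> carrier (res_module R K (Suc n)) \<Longrightarrow>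
      boundary R (t (Suc n) u) = res_map R \<pi> u \<ominus>\<^bsub>res_module R C (Suc n)\<^esub> t n (boundary R u)"
    by metis
  \<comment> \<open>The homotopy \<open>t\<close> corrects \<open>res_map R \<pi>\<close> to a chain
    map from the cone to the resolution of \<open>C\<close>.\<close>
  define \<psi> where "\<psi> = (\<lambda>n w. case n of 0 \<Rightarrow> res_map R \<pi> (snd w)
    | Suc m \<Rightarrow> res_map R \<pi> (snd w) \<oplus>\<^bsub>res_module R C n\<^esub> t m (fst w))"
  have rm: "linmap R (res_module R B n) (res_module R C n) (res_map R \<pi>)" for n
    by (rule chain_liftD(1)[OF res_map_lift])
  have f: "linmap R (cone R K B (Suc n)) (res_module R K n) fst" for n
    unfolding cone_def cone_fst_Suc by (rule linmap_fst)
  have s: "linmap R (cone R K B n) (res_module R B n) snd" for n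
    unfolding cone_def by (rule linmap_snd)
  have \<psi>: "linmap R (cone R K B n) (res_module R C n) (\<psi> n)" for n
  proof (cases n)
    case 0
    then show ?thesis using linmap_comp[OF s rm, of 0] by (simp add: \<psi>_def)
  next
    case (Suc m)
    have "linmap R (cone R K B (Suc m)) (res_module R C (Suc m))
      (\<lambda>w. res_map R \<pi> (snd w) \<oplus>\<^bsub>res_module R C (Suc m)\<^esub> t m (fst w))"
      by (rule linmap_plus[OF FC linmap_comp[OF s rm] linmap_comp[OF f t(1)]])
    then show ?thesis unfolding \<psi>_def Suc nat.case .
  qed
  have \<psi>D: "boundary R (\<psi> (Suc n) w) = \<psi> n (cone_diff R w)" if w: "w \<in> carrier (cone R K B (Suc n))" for n w
  proof -
    interpret F: module R "res_module R C n" by (rule FC)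
    obtain a b where ab: "w = (a, b)" "a \<in> carrier (res_module R K n)"
      "b \<in> carrier (res_module R B (Suc n))" using w by (rule cone_SucE)
    have bb: "boundary R b \<in> carrier (res_module R B n)"
      by (rule linmap_closed[OF linmap_boundary_Suc[OF B] ab(3)])
    have ra: "res_map R \<pi> a \<in> carrier (res_module R C n)" by (rule linmap_closed[OF rm K_B[OF ab(2)]])
    have rb: "res_map R \<pi> (boundary R b) \<in> carrier (res_module R C n)" by (rule linmap_closed[OF rm bb])
    have "boundary R (\<psi> (Suc n) w) =
        boundary R (res_map R \<pi> b) \<oplus>\<^bsub>res_module R C n\<^esub> boundary R (t n a)"
      unfolding \<psi>_def nat.case ab(1) fst_conv snd_conv
      by (rule linmap_add[OF linmap_boundary_Suc[OF C] linmap_closed[OF rm ab(3)] linmap_closed[OF t(1) ab(2)]])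
    also have "boundary R (res_map R \<pi> b) = res_map R \<pi> (boundary R b)"
      by (rule boundary_res_map[OF B C \<pi> ab(3)])
    also have "res_map R \<pi> (boundary R b) \<oplus>\<^bsub>res_module R C n\<^esub> boundary R (t n a) = \<psi> n (cone_diff R w)"
    proof (cases n)
      case 0
      then show ?thesis
        unfolding \<psi>_def nat.case snd_cone_diff[of "(a, b)" n] ab(1) fst_conv snd_conv
          linmap_add[OF rm K_B[OF ab(2)] bb]
        using t(2)[of a] ab(2) F.M.a_comm[OF ra rb] by simp
    next
      case (Suc m)
      have ba: "boundary R a \<in> carrier (res_module R K m)"
        using linmap_closed[OF linmap_boundary_Suc[OF module_K]] ab(2) Suc by blast
      have ta: "t m (boundary R a) \<in> carrier (res_module R C n)"
        using linmap_closed[OF t(1) ba] Suc by simp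
      have "\<psi> n (cone_diff R w) = (res_map R \<pi> a \<oplus>\<^bsub>res_module R C n\<^esub> res_map R \<pi> (boundary R b))
          \<oplus>\<^bsub>res_module R C n\<^esub> (\<ominus>\<^bsub>R\<^esub> \<one>\<^bsub>R\<^esub>) \<odot>\<^bsub>res_module R C n\<^esub> t m (boundary R a)"
        using linmap_add[OF rm K_B[OF ab(2)] bb] linmap_smult[OF t(1) m1 ba]
        unfolding \<psi>_def snd_cone_diff[of "(a, b)" n] fst_cone_diff[of "(a, b)" m] ab(1) fst_conv snd_conv Suc nat.case
        by (simp only:)
      also have "\<dots> = res_map R \<pi> (boundary R b) \<oplus>\<^bsub>res_module R C n\<^esub> (res_map R \<pi> a \<ominus>\<^bsub>res_module R C n\<^esub> t m (boundary R a))"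
        unfolding F.minus_eq_smult[OF ta, symmetric] F.M.minus_eq
        using ra rb ta F.M.a_inv_closed[OF ta] by (simp only: F.M.a_ac F.M.a_closed)
      finally show ?thesis using t(3)[of a m] ab(2) Suc by (simp only:)
    qed
    finally show ?thesis .
  qed
  \<comment> \<open>The identity of the resolution is another lift, so g and its pullback along
    \<open>\<psi>\<close> after \<open>\<phi>\<close> differ by a coboundary.\<close>
  have id: "res_lift R C C (\<lambda>c. c) (\<lambda>n w. \<psi> n (\<phi> n w))"
  proof (rule chain_liftI)
    show "linmap R (res_module R C n) (res_module R C n) (\<lambda>w. \<psi> n (\<phi> n w))" for n
      by (rule linmap_comp[OF \<phi>'(1) \<psi>])
    show "augmentation R C (\<psi> 0 (\<phi> 0 u)) = augmentation R C u" if u: "u \<in> carrier (res_module R C 0)" for u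
      using \<phi>'(2)[OF u] augmentation_res_map(2)[OF B C \<pi> linmap_closed[OF s linmap_closed[OF \<phi>'(1) u]]]
      by (simp add: \<psi>_def)
    show "boundary R (\<psi> (Suc n) (\<phi> (Suc n) u)) = \<psi> n (\<phi> n (boundary R u))"
      if u: "u \<in> carrier (res_module R C (Suc n))" for n u
      using \<psi>D[OF linmap_closed[OF \<phi>'(1) u]] \<phi>'(3)[OF u] by simp
  qed
  show ?thesis
  proof (intro exI[of _ "\<lambda>i w. fst (\<phi> (Suc i) w)"] conjI allI ballI impI)
    show "linmap R (res_module R C (Suc i)) (res_module R K i) (\<lambda>w. fst (\<phi> (Suc i) w))" for i
      by (rule linmap_comp[OF \<phi>'(1) f])
    show "fst (\<phi> (Suc i) (boundary R w)) =
        (\<ominus>\<^bsub>R\<^esub> \<one>\<^bsub>R\<^esub>) \<odot>\<^bsub>res_module R K i\<^esub> boundary R (fst (\<phi> (Suc (Suc i)) w))"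
      if w: "w \<in> carrier (res_module R C (Suc (Suc i)))" for i w
      unfolding \<phi>'(3)[OF w, symmetric] by (rule fst_cone_diff)
    fix i g
    assume g: "cocyc R C N (Suc i) g"
      and gB: "cobd R B N (Suc i) (\<lambda>v. g (res_map R \<pi> v))"
    interpret N: module R N by fact
    have g': "linmap R (res_module R C (Suc i)) N g" by (rule cocyc_linmap[OF g])
    obtain h where h: "linmap R (res_module R B i) N h"
      "\<And>v. v \<in> carrier (res_module R B (Suc i)) \<Longrightarrow> g (res_map R \<pi> v) = h (boundary R v)"
      using gB by (rule cobdE) simp
    \<comment> \<open>Over \<open>K\<close> the pullback of g has two primitives: g after
      \<open>t\<close>, from the null-homotopy, and h. Their difference is the cocycle.\<close>
    define k where "k = (\<lambda>a. g (t i a) \<ominus>\<^bsub>N\<^esub> h a)"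
    have hK: "linmap R (res_module R K i) N h" by (rule linmap_comp[OF linmap_K_B h(1)])
    have k: "linmap R (res_module R K i) N k"
      unfolding k_def by (rule linmap_subtract[OF FK N linmap_comp[OF t(1) g'] hK])
    have "cocyc R K N i k"
      unfolding cocyc_def
    proof (intro conjI ballI k)
      fix c assume c: "c \<in> carrier (res_module R K (Suc i))"
      have bc: "boundary R c \<in> carrier (res_module R K i)"
        by (rule linmap_closed[OF linmap_boundary_Suc[OF module_K] c])
      have rc: "res_map R \<pi> c \<in> carrier (res_module R C (Suc i))" by (rule linmap_closed[OF rm K_B[OF c]])
      have tc: "t i (boundary R c) \<in> carrier (res_module R C (Suc i))" by (rule linmap_closed[OF t(1) bc])
      have "g (res_map R \<pi> c) \<ominus>\<^bsub>N\<^esub> g (t i (boundary R c)) = g (boundary R (t (Suc i) c))"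
        using linmap_diff[OF FC N g' rc tc] t(3)[OF c] by simp
      also have "\<dots> = \<zero>\<^bsub>N\<^esub>" by (rule cocyc_boundary[OF g linmap_closed[OF t(1) c]])
      finally have "g (res_map R \<pi> c) = g (t i (boundary R c))"
        using N.diff_eq_zero_iff[OF linmap_closed[OF g' rc] linmap_closed[OF g' tc]] by simp
      then show "k (boundary R c) = \<zero>\<^bsub>N\<^esub>"
        unfolding k_def using h(2)[OF K_B[OF c]] N.diff_self[OF linmap_closed[OF hK bc]] by simp
    qed
    moreover have "cobd R C N (Suc i) (\<lambda>w. g w \<ominus>\<^bsub>N\<^esub> k (fst (\<phi> (Suc i) w)))"
    proof -
      \<comment> \<open>Let d be the boundary and \<open>\<phi>\<close> w = (a, b). The pullback of
        g at w is g (t a) + h (d b) = k a + h (a + d b), and a + d b is the second component of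
        \<open>\<phi>\<close> (d w). The h-term is thus a coboundary.\<close>
      have eq: "g w \<ominus>\<^bsub>N\<^esub> k (fst (\<phi> (Suc i) w)) =
          (g w \<ominus>\<^bsub>N\<^esub> g (\<psi> (Suc i) (\<phi> (Suc i) w))) \<oplus>\<^bsub>N\<^esub> h (snd (\<phi> i (boundary R w)))"
        if w: "w \<in> carrier (res_module R C (Suc i))" for w
      proof -
        obtain a b where ab: "\<phi> (Suc i) w = (a, b)" "a \<in> carrier (res_module R K i)"
          "b \<in> carrier (res_module R B (Suc i))" using linmap_closed[OF \<phi>'(1) w] by (rule cone_SucE)
        have bb: "boundary R b \<in> carrier (res_module R B i)"
          by (rule linmap_closed[OF linmap_boundary_Suc[OF B] ab(3)])
        have c: "g w \<in> carrier N" "h a \<in> carrier N" "h (boundary R b) \<in> carrier N"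
            "k a \<in> carrier N" "g (t i a) \<in> carrier N"
          using linmap_closed[OF g' w] linmap_closed[OF hK ab(2)] linmap_closed[OF h(1) bb]
            linmap_closed[OF k ab(2)] linmap_closed[OF g' linmap_closed[OF t(1) ab(2)]] by auto
        have "g (\<psi> (Suc i) (\<phi> (Suc i) w)) = g (res_map R \<pi> b) \<oplus>\<^bsub>N\<^esub> g (t i a)"
          unfolding \<psi>_def nat.case ab(1) fst_conv snd_conv
          by (rule linmap_add[OF g' linmap_closed[OF rm ab(3)] linmap_closed[OF t(1) ab(2)]])
        also have "g (res_map R \<pi> b) = h (boundary R b)" by (rule h(2)[OF ab(3)])
        also have "g (t i a) = k a \<oplus>\<^bsub>N\<^esub> h a" unfolding k_def using c by (simp only: N.diff_add_cancel)
        also have "h (boundary R b) \<oplus>\<^bsub>N\<^esub> (k a \<oplus>\<^bsub>N\<^esub> h a) = (h a \<oplus>\<^bsub>N\<^esub> h (boundary R b)) \<oplus>\<^bsub>N\<^esub> k a"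
          using c by (simp only: N.M.a_ac N.M.a_closed)
        finally have 1: "g (\<psi> (Suc i) (\<phi> (Suc i) w)) = (h a \<oplus>\<^bsub>N\<^esub> h (boundary R b)) \<oplus>\<^bsub>N\<^esub> k a" .
        have "snd (\<phi> i (boundary R w)) = a \<oplus>\<^bsub>res_module R B i\<^esub> boundary R b"
          unfolding \<phi>'(3)[OF w, symmetric] snd_cone_diff[of _ i] ab(1) by simp
        then have 2: "h (snd (\<phi> i (boundary R w))) = h a \<oplus>\<^bsub>N\<^esub> h (boundary R b)"
          by (simp only: linmap_add[OF h(1) K_B[OF ab(2)] bb])
        show ?thesis unfolding 1 2 using N.diff_split[OF c(1) N.M.a_closed[OF c(2,3)] c(4)] by (simp add: ab(1))
      qed
      have "cobd R C N (Suc i) (\<lambda>w. g w \<ominus>\<^bsub>N\<^esub> g (\<psi> (Suc i) (\<phi> (Suc i) w)))"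
        by (rule cocyc_lift_unique[OF C C N chain_lift_id id g])
      moreover have "cobd R C N (Suc i) (\<lambda>w. h (snd (\<phi> i (boundary R w))))"
        by (rule cobdI[of _ _ _ _ "\<lambda>x. h (snd (\<phi> i x))"])
          (simp_all add: linmap_comp[OF linmap_comp[OF \<phi>'(1) s] h(1)])
      ultimately show ?thesis by (intro cobd_cong[OF eq, THEN iffD2] cobd_add[OF N])
    qed
    ultimately show "\<exists>k. cocyc R K N i k \<and> cobd R C N (Suc i) (\<lambda>w. g w \<ominus>\<^bsub>N\<^esub> k (fst (\<phi> (Suc i) w)))"
      by blast
  qed
qed

text \<open>If k is m after the boundary, then k after p is minus m after p after the boundary,
  because p commutes with the boundary up to sign. In degree 0 a coboundary is zero.\<close>

lemma connecting_cobd: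
  assumes N: "module R N"
    and p: "\<And>i. linmap R (res_module R C (Suc i)) (res_module R K i) (p i)"
    "\<And>i w. w \<in> carrier (res_module R C (Suc (Suc i))) \<Longrightarrow>
      p i (boundary R w) = (\<ominus>\<^bsub>R\<^esub> \<one>\<^bsub>R\<^esub>) \<odot>\<^bsub>res_module R K i\<^esub> boundary R (p (Suc i) w)"
    and k: "cobd R K N i k"
  shows "cobd R C N (Suc i) (\<lambda>w. k (p i w))"
proof -
  interpret N: module R N by fact
  have m1: "\<ominus>\<^bsub>R\<^esub> \<one>\<^bsub>R\<^esub> \<in> carrier R" by simp
  obtain m where m: "linmap R (res_module R K (i - 1)) N m"
    "\<And>u. u \<in> carrier (res_module R K i) \<Longrightarrow> k u = m (boundary R u)" using k by (rule cobdE) blast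
  show ?thesis
  proof (cases i)
    case 0
    have "k (p i w) = \<zero>\<^bsub>N\<^esub>" if "w \<in> carrier (res_module R C (Suc i))" for w
      using m(2)[OF linmap_closed[OF p(1) that]] linmap_closed[OF p(1)[of i] that]
        boundary_eq_zero[OF R_cring, of _ K] linmap_zero[OF FK N m(1)] 0 by simp
    then show ?thesis using cobd_zero[OF N] by (simp cong: cobd_cong)
  next
    case (Suc j)
    have m': "linmap R (res_module R K j) N m" using m(1) Suc by simp
    have "k (p i w) = (\<ominus>\<^bsub>R\<^esub> \<one>\<^bsub>R\<^esub>) \<odot>\<^bsub>N\<^esub> m (p j (boundary R w))" if w: "w \<in> carrier (res_module R C (Suc i))" for w
    proof -
      have pw: "p i w \<in> carrier (res_module R K (Suc j))" using linmap_closed[OF p(1) w] Suc by simp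
      have bp: "boundary R (p i w) \<in> carrier (res_module R K j)"
        by (rule linmap_closed[OF linmap_boundary_Suc[OF module_K] pw])
      have mb: "m (boundary R (p i w)) \<in> carrier N" by (rule linmap_closed[OF m' bp])
      have "m (p j (boundary R w)) = (\<ominus>\<^bsub>R\<^esub> \<one>\<^bsub>R\<^esub>) \<odot>\<^bsub>N\<^esub> m (boundary R (p i w))"
        using linmap_smult[OF m' m1 bp] p(2)[of w j] w Suc by simp
      then have "(\<ominus>\<^bsub>R\<^esub> \<one>\<^bsub>R\<^esub>) \<odot>\<^bsub>N\<^esub> m (p j (boundary R w)) = m (boundary R (p i w))"
        by (simp only: N.neg_smult_twice[OF mb])
      then show ?thesis using m(2)[of "p i w"] pw Suc by simp
    qed
    then show ?thesis
      by (rule cobdI[rotated]) (simp_all add: Suc linmap_scale[OF N linmap_comp[OF p(1) m'] m1])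
  qed
qed

lemma connecting_cocyc:
  assumes N: "module R N"
    and p: "\<And>i. linmap R (res_module R C (Suc i)) (res_module R K i) (p i)"
    "\<And>i w. w \<in> carrier (res_module R C (Suc (Suc i))) \<Longrightarrow>
      p i (boundary R w) = (\<ominus>\<^bsub>R\<^esub> \<one>\<^bsub>R\<^esub>) \<odot>\<^bsub>res_module R K i\<^esub> boundary R (p (Suc i) w)"
    and k: "cocyc R K N i k"
  shows "cocyc R C N (Suc i) (\<lambda>w. k (p i w))"
  unfolding cocyc_def
proof (intro conjI ballI)
  interpret N: module R N by fact
  show "linmap R (res_module R C (Suc i)) N (\<lambda>w. k (p i w))"
    by (rule linmap_comp[OF p(1) cocyc_linmap[OF k]])
  fix w assume w: "w \<in> carrier (res_module R C (Suc (Suc i)))"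
  have pw: "p (Suc i) w \<in> carrier (res_module R K (Suc i))" by (rule linmap_closed[OF p(1) w])
  have "k (p i (boundary R w)) = (\<ominus>\<^bsub>R\<^esub> \<one>\<^bsub>R\<^esub>) \<odot>\<^bsub>N\<^esub> k (boundary R (p (Suc i) w))"
    unfolding p(2)[OF w]
    by (rule linmap_smult[OF cocyc_linmap[OF k] _ linmap_closed[OF linmap_boundary_Suc[OF module_K] pw]]) simp
  then show "k (p i (boundary R w)) = \<zero>\<^bsub>N\<^esub>" using cocyc_boundary[OF k pw] by simp
qed

text \<open>The kernel of Ext^i(C, N) -> Ext^i(B, N) is hit by Ext^(i-1)(K, N). The case i = 0 is
  separate because i - 1 is truncated: there injectivity is direct, every generator over
  \<open>C\<close> being the image of one over \<open>B\<close>.\<close>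

theorem ext_injective:
  assumes N: "module R N" and K: "i = 0 \<or> ext_zero R K N (i - 1)"
    and g: "cocyc R C N i g" and gB: "cobd R B N i (\<lambda>v. g (res_map R \<pi> v))"
  shows "cobd R C N i g"
proof (cases i)
  case 0
  obtain h where h: "linmap R (res_module R B 0) N h"
    "\<And>v. v \<in> carrier (res_module R B 0) \<Longrightarrow> g (res_map R \<pi> v) = h (boundary R v)"
    using gB 0 by (auto elim!: cobdE)
  have gz: "g (res_map R \<pi> v) = \<zero>\<^bsub>N\<^esub>" if "v \<in> carrier (res_module R B 0)" for v
    using h(2)[OF that] boundary_eq_zero[OF R_cring that] linmap_zero[OF FB N h(1)] by simp
  have "g u = \<zero>\<^bsub>N\<^esub>" if u: "u \<in> carrier (res_module R C 0)" for u
  proof (rule free_module_linmap_eq[OF N _ linmap_const_zero[OF N] _ u[unfolded res_module_def]])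
    show "linmap R (free_module R (res_basis R C 0)) N g"
      using cocyc_linmap[OF g] 0 by (simp add: res_module_def)
    fix x assume "x \<in> res_basis R C 0"
    then obtain b where b: "x = Elt (\<pi> b)" "b \<in> carrier B" using surj by force
    have "single R (Elt b) \<in> carrier (res_module R B 0)"
      unfolding res_module_def using b(2) by (intro single_closed R_cring) simp
    from gz[OF this] show "g (single R x) = \<zero>\<^bsub>N\<^esub>" by (simp add: b(1) res_map_single[OF R_cring])
  qed
  then have "cobd R C N i g \<longleftrightarrow> cobd R C N i (\<lambda>_. \<zero>\<^bsub>N\<^esub>)" by (intro cobd_cong) (simp add: 0)
  then show ?thesis using cobd_zero[OF N] by blast
next
  case (Suc j)
  obtain p where p: "\<And>i. linmap R (res_module R C (Suc i)) (res_module R K i) (p i)"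
    "\<And>i w. w \<in> carrier (res_module R C (Suc (Suc i))) \<Longrightarrow>
      p i (boundary R w) = (\<ominus>\<^bsub>R\<^esub> \<one>\<^bsub>R\<^esub>) \<odot>\<^bsub>res_module R K i\<^esub> boundary R (p (Suc i) w)"
    and ex: "\<forall>i g. cocyc R C N (Suc i) g \<longrightarrow> cobd R B N (Suc i) (\<lambda>v. g (res_map R \<pi> v)) \<longrightarrow>
      (\<exists>k. cocyc R K N i k \<and> cobd R C N (Suc i) (\<lambda>w. g w \<ominus>\<^bsub>N\<^esub> k (p i w)))"
    using ext_connecting[OF N] by (elim exE conjE) (rule that, simp_all only: bex_simps ball_simps)
  from ex obtain k where k: "cocyc R K N j k" "cobd R C N (Suc j) (\<lambda>w. g w \<ominus>\<^bsub>N\<^esub> k (p j w))"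
    using g gB Suc by blast
  have kK: "cobd R K N j k" using K Suc k(1) by (simp add: ext_zero_def)
  have kp: "cobd R C N (Suc j) (\<lambda>w. k (p j w))"
    by (rule connecting_cobd[where p = p, OF N p(1) p(2) kK])
  have "cobd R C N (Suc j) g \<longleftrightarrow> cobd R C N (Suc j) (\<lambda>w. k (p j w))"
    by (rule cobd_diff_cancel[OF N C _ cobd_closed[OF C kp] k(2)])
      (use linmap_closed[OF cocyc_linmap[OF g]] Suc in simp)
  then show ?thesis using kp Suc by simp
qed

end

section \<open>Finitely generated submodules\<close>

lemma linmap_restrict:
  assumes "module R A" "linmap R A B f"
  shows "linmap R A B (restrict f (carrier A))"
proof -
  interpret A: module R A by fact
  show ?thesis using assms(2) by (auto simp: linmap_def)
qed

lemma Hom_module_carrier: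
  "f \<in> carrier (Hom_module R A B) \<longleftrightarrow> linmap R A B f \<and> f \<in> extensional (carrier A)"
  by (auto simp: Hom_module_def linmap_def PiE_def)

lemma Hom_module_simps:
  "\<zero>\<^bsub>Hom_module R A B\<^esub> = (\<lambda>x\<in>carrier A. \<zero>\<^bsub>B\<^esub>)"
  "f \<oplus>\<^bsub>Hom_module R A B\<^esub> g = (\<lambda>x\<in>carrier A. f x \<oplus>\<^bsub>B\<^esub> g x)"
  "r \<odot>\<^bsub>Hom_module R A B\<^esub> f = (\<lambda>x\<in>carrier A. r \<odot>\<^bsub>B\<^esub> f x)"
  by (simp_all add: Hom_module_def)

lemma module_Hom_module:
  assumes A: "module R A" and B: "module R B"
  shows "module R (Hom_module R A B)"
proof -
  interpret B: module R B by fact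
  have cl: "f x \<in> carrier B" if "f \<in> carrier (Hom_module R A B)" "x \<in> carrier A" for f x
    using that by (auto simp: Hom_module_carrier dest: linmap_closed)
  have ext: "f = g" if "f \<in> carrier (Hom_module R A B)" "g \<in> extensional (carrier A)"
    "\<And>x. x \<in> carrier A \<Longrightarrow> f x = g x" for f g
    using that by (intro extensionalityI[of _ "carrier A"]) (auto simp: Hom_module_carrier)
  have zero: "\<zero>\<^bsub>Hom_module R A B\<^esub> \<in> carrier (Hom_module R A B)"
    and add: "\<And>f g. f \<in> carrier (Hom_module R A B) \<Longrightarrow> g \<in> carrier (Hom_module R A B) \<Longrightarrow>
      f \<oplus>\<^bsub>Hom_module R A B\<^esub> g \<in> carrier (Hom_module R A B)"
    and smult: "\<And>r f. r \<in> carrier R \<Longrightarrow> f \<in> carrier (Hom_module R A B) \<Longrightarrow>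
      r \<odot>\<^bsub>Hom_module R A B\<^esub> f \<in> carrier (Hom_module R A B)"
    unfolding Hom_module_simps
    by (auto simp: Hom_module_carrier intro!: linmap_restrict[OF A] linmap_const_zero[OF B]
        linmap_plus[OF B] linmap_scale[OF B])
  show ?thesis
  proof (rule moduleI)
    show "abelian_group (Hom_module R A B)"
    proof (rule abelian_groupI)
      fix f assume f: "f \<in> carrier (Hom_module R A B)"
      then show "\<exists>g\<in>carrier (Hom_module R A B). g \<oplus>\<^bsub>Hom_module R A B\<^esub> f = \<zero>\<^bsub>Hom_module R A B\<^esub>"
        using smult[of "\<ominus>\<^bsub>R\<^esub> \<one>\<^bsub>R\<^esub>" f]
        by (intro bexI[of _ "(\<ominus>\<^bsub>R\<^esub> \<one>\<^bsub>R\<^esub>) \<odot>\<^bsub>Hom_module R A B\<^esub> f"])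
          (auto simp: Hom_module_simps cl B.minus_eq_smult[symmetric] B.M.l_neg)
    next
      fix f assume f: "f \<in> carrier (Hom_module R A B)"
      show "\<zero>\<^bsub>Hom_module R A B\<^esub> \<oplus>\<^bsub>Hom_module R A B\<^esub> f = f"
        by (rule ext[symmetric, OF f]) (simp_all add: Hom_module_simps cl[OF f])
    qed (use add zero in \<open>auto simp: Hom_module_simps cl B.M.a_ac\<close>)
  next
    fix f assume f: "f \<in> carrier (Hom_module R A B)"
    show "\<one>\<^bsub>R\<^esub> \<odot>\<^bsub>Hom_module R A B\<^esub> f = f"
      by (rule ext[symmetric, OF f]) (simp_all add: Hom_module_simps cl[OF f])
  qed (use smult in \<open>auto simp: Hom_module_simps cl B.R.is_cring B.smult_l_distr B.smult_r_distr B.smult_assoc1\<close>)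
qed

text \<open>Adjoining generators one by one turns finite generation into an induction whose
  successive quotients are cyclic modules R/J.\<close>

inductive fg_sub :: "('r, 'x) ring_scheme \<Rightarrow> ('r, 'm, 'y) module_scheme \<Rightarrow> 'm set \<Rightarrow> bool"
  for R M where
  zero: "fg_sub R M {\<zero>\<^bsub>M\<^esub>}"
| adjoin: "fg_sub R M U \<Longrightarrow> x \<in> carrier M \<Longrightarrow> fg_sub R M {u \<oplus>\<^bsub>M\<^esub> r \<odot>\<^bsub>M\<^esub> x | u r. u \<in> U \<and> r \<in> carrier R}"

section \<open>The ring as a module over itself\<close>

lemma ring_module_simps [simp]:
  "carrier (ring_module R) = carrier R" "\<zero>\<^bsub>ring_module R\<^esub> = \<zero>\<^bsub>R\<^esub>"
  "add (ring_module R) = add R" "smult (ring_module R) = monoid.mult R"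
  by (simp_all add: ring_module_def)

lemma module_ring_module:
  assumes "cring R"
  shows "module R (ring_module R)"
proof -
  interpret cring R by fact
  have "abelian_group (ring_module R)"
    by (rule abelian_groupI) (auto simp: a_ac intro: bexI[of _ "\<ominus>\<^bsub>R\<^esub> _"] l_neg)
  then show ?thesis
    by (intro moduleI) (auto simp: assms l_distr r_distr m_assoc)
qed

lemma linmap_ring_module:
  assumes "module R M" "x \<in> carrier M"
  shows "linmap R (ring_module R) M (\<lambda>r. r \<odot>\<^bsub>M\<^esub> x)"
proof -
  interpret M: module R M by fact
  show ?thesis using assms(2) by (auto simp: linmap_def M.smult_l_distr M.smult_assoc1)
qed

lemma fg_sub_submodule:
  assumes "module R M" "fg_sub R M U"
  shows "submodule U R M"
  using assms(2)
proof induction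
  case zero
  show ?case by (rule submodule_zero[OF assms(1)])
next
  case (adjoin U x)
  interpret M: module R M by fact
  from submodule_image_plus[OF module_ring_module[OF M.R.is_cring] assms(1)
      linmap_ring_module[OF assms(1) adjoin(2)] adjoin.IH]
  show ?case by simp
qed

lemma fg_sub_span:
  assumes M: "module R M" and S: "finite S" "S \<subseteq> carrier M"
  shows "\<exists>U. fg_sub R M U \<and> S \<subseteq> U \<and> (\<forall>V. submodule V R M \<longrightarrow> S \<subseteq> V \<longrightarrow> U \<subseteq> V)"
  using S
proof (induction S)
  case empty
  then show ?case using fg_sub.zero[of R M] submodule_props(2)[OF M] by (auto intro!: exI[of _ "{\<zero>\<^bsub>M\<^esub>}"])
next
  case (insert x S)
  interpret M: module R M by fact
  obtain U where U: "fg_sub R M U" "S \<subseteq> U" "\<And>V. submodule V R M \<Longrightarrow> S \<subseteq> V \<Longrightarrow> U \<subseteq> V"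
    using insert by auto
  note U' = submodule_props[OF M fg_sub_submodule[OF M U(1)]]
  have x: "x \<in> carrier M" using insert by simp
  let ?U = "{u \<oplus>\<^bsub>M\<^esub> r \<odot>\<^bsub>M\<^esub> x | u r. u \<in> U \<and> r \<in> carrier R}"
  have "x \<in> ?U" using x U'(2) by (force intro!: exI[of _ "\<zero>\<^bsub>M\<^esub>"] exI[of _ "\<one>\<^bsub>R\<^esub>"])
  moreover have "U \<subseteq> ?U"
  proof
    fix u assume "u \<in> U"
    then show "u \<in> ?U" using x U'(1) by (force intro!: exI[of _ u] exI[of _ "\<zero>\<^bsub>R\<^esub>"])
  qed
  moreover have "?U \<subseteq> V" if V: "submodule V R M" "insert x S \<subseteq> V" for V
    using U(3)[OF V(1)] V(2) submodule_props(3,4)[OF M V(1)] by auto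
  ultimately show ?case using U(2) fg_sub.adjoin[OF U(1) x] by (intro exI[of _ ?U]) auto
qed

lemma fg_sub_carrier:
  assumes "fin_gen_module R M"
  shows "fg_sub R M (carrier M)"
proof -
  have M: "module R M" using assms by (simp add: fin_gen_module_def)
  obtain S where S: "finite S" "S \<subseteq> carrier M" "mod_span R M S = carrier M"
    using assms by (auto simp: fin_gen_module_def)
  obtain U where U: "fg_sub R M U" "S \<subseteq> U" using fg_sub_span[OF M S(1,2)] by blast
  note U' = fg_sub_submodule[OF M U(1)]
  have "carrier M \<subseteq> U" unfolding S(3)[symmetric] mod_span_def using U(2) U' by blast
  then show ?thesis using U(1) submodule_props(1)[OF M U'] by (metis subset_antisym)
qed

lemma submodule_ring_module_iff:
  assumes "cring R"
  shows "submodule J R (ring_module R) \<longleftrightarrow> ideal J R"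
proof -
  interpret cring R by fact
  interpret M: module R "ring_module R" by (rule module_ring_module) fact
  show ?thesis
  proof
    assume J: "submodule J R (ring_module R)"
    note J' = submodule_props[OF M.module_axioms J]
    have "\<ominus>\<^bsub>R\<^esub> a \<in> J" if "a \<in> J" for a
      using J'(4)[of "\<ominus>\<^bsub>R\<^esub> \<one>\<^bsub>R\<^esub>" a] that J'(1) by (auto simp: l_minus subset_iff)
    then have "subgroup J (add_monoid R)"
      using J' by (intro add.subgroupI) (auto simp: subset_iff)
    moreover have "x \<otimes>\<^bsub>R\<^esub> a \<in> J" "a \<otimes>\<^bsub>R\<^esub> x \<in> J" if "a \<in> J" "x \<in> carrier R" for a x
      using J'(4)[OF that(2,1)] m_comm[of a x] that J'(1) by auto
    ultimately show "ideal J R" by (intro idealI ring_axioms)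
  next
    assume "ideal J R"
    then interpret ideal J R .
    show "submodule J R (ring_module R)"
      unfolding submodule_iff[OF M.module_axioms] using I_l_closed a_subset by auto
  qed
qed

lemma noetherian_fg_sub:
  assumes "cring R" "noetherian_ring R" "ideal J R"
  shows "fg_sub R (ring_module R) J"
proof -
  interpret cring R by fact
  have M: "module R (ring_module R)" by (rule module_ring_module) fact
  obtain S where S: "S \<subseteq> carrier R" "finite S" "J = genideal R S"
    using noetherian_ring.finetely_gen[OF assms(2,3)] by blast
  obtain U where U: "fg_sub R (ring_module R) U" "S \<subseteq> U"
    "\<And>V. submodule V R (ring_module R) \<Longrightarrow> S \<subseteq> V \<Longrightarrow> U \<subseteq> V"
    using fg_sub_span[OF M S(2)] S(1) by auto
  have "ideal U R" using fg_sub_submodule[OF M U(1)] submodule_ring_module_iff[OF assms(1)] by blast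
  then have "J \<subseteq> U" unfolding S(3) by (rule genideal_minimal) (rule U(2))
  moreover have "U \<subseteq> J"
    using U(3)[of J] submodule_ring_module_iff[OF assms(1)] assms(3) genideal_self[OF S(1)] S(3) by blast
  ultimately show ?thesis using U(1) by (metis subset_antisym)
qed

lemma fg_sub_image:
  assumes A: "module R A" and B: "module R B" and f: "linmap R A B f" and U: "fg_sub R A U"
  shows "fg_sub R B (f ` U)"
  using U
proof induction
  case zero
  then show ?case using fg_sub.zero[of R B] linmap_zero[OF A B f] by simp
next
  case (adjoin U x)
  interpret A: module R A by fact
  have U: "U \<subseteq> carrier A" by (rule submodule_props(1)[OF A fg_sub_submodule[OF A adjoin(1)]])
  have "f (u \<oplus>\<^bsub>A\<^esub> r \<odot>\<^bsub>A\<^esub> x) = f u \<oplus>\<^bsub>B\<^esub> r \<odot>\<^bsub>B\<^esub> f x" if "u \<in> U" "r \<in> carrier R" for u r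
    using that U adjoin(2) linmap_add[OF f] linmap_smult[OF f] by auto
  then have "f ` {u \<oplus>\<^bsub>A\<^esub> r \<odot>\<^bsub>A\<^esub> x | u r. u \<in> U \<and> r \<in> carrier R} =
      {u \<oplus>\<^bsub>B\<^esub> r \<odot>\<^bsub>B\<^esub> f x | u r. u \<in> f ` U \<and> r \<in> carrier R}"
    by (force simp: image_iff)
  then show ?case using fg_sub.adjoin[OF adjoin.IH linmap_closed[OF f adjoin(2)]] by simp
qed

text \<open>
  In the induction step, the submodule \<open>W \<subseteq> U + Rx\<close> is built up from \<open>W \<inter> U\<close> by following
  generators of the ideal of all \<open>r\<close> with \<open>u + rx \<in> W\<close> for some \<open>u \<in> U\<close>.
\<close>

lemma fg_sub_noetherian:
  assumes R: "noetherian_ring R" and M: "module R M" and "fg_sub R M U"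
    and "submodule W R M" "W \<subseteq> U"
  shows "fg_sub R M W"
  using assms(3-)
proof (induction arbitrary: W)
  case zero
  then have "W = {\<zero>\<^bsub>M\<^esub>}" using submodule_props(2)[OF M zero(1)] by auto
  then show ?case using fg_sub.zero[of R M] by simp
next
  case (adjoin U x W)
  interpret M: module R M by fact
  note U = submodule_props[OF M fg_sub_submodule[OF M adjoin(1)]]
  note W = submodule_props[OF M adjoin(4)]
  note x = adjoin(2)
  have WU: "submodule (W \<inter> U) R M" unfolding submodule_iff[OF M] using U W by auto
  have fg: "fg_sub R M (W \<inter> U)" by (rule adjoin.IH[OF WU]) simp
  define L where "L = {r \<in> carrier R. \<exists>u\<in>U. u \<oplus>\<^bsub>M\<^esub> r \<odot>\<^bsub>M\<^esub> x \<in> W}"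
  have RM: "module R (ring_module R)" by (rule module_ring_module[OF M.R.is_cring])
  have "submodule L R (ring_module R)"
    unfolding submodule_iff[OF RM]
  proof (intro conjI ballI)
    show "L \<subseteq> carrier (ring_module R)" by (auto simp: L_def)
    show "\<zero>\<^bsub>ring_module R\<^esub> \<in> L" using x U(2) W(2) by (auto simp: L_def intro!: bexI[of _ "\<zero>\<^bsub>M\<^esub>"])
  next
    fix r s assume "r \<in> L" "s \<in> L"
    then obtain u v where uv: "r \<in> carrier R" "s \<in> carrier R" "u \<in> U" "v \<in> U"
      "u \<oplus>\<^bsub>M\<^esub> r \<odot>\<^bsub>M\<^esub> x \<in> W" "v \<oplus>\<^bsub>M\<^esub> s \<odot>\<^bsub>M\<^esub> x \<in> W" by (auto simp: L_def)
    have "(u \<oplus>\<^bsub>M\<^esub> r \<odot>\<^bsub>M\<^esub> x) \<oplus>\<^bsub>M\<^esub> (v \<oplus>\<^bsub>M\<^esub> s \<odot>\<^bsub>M\<^esub> x) = (u \<oplus>\<^bsub>M\<^esub> v) \<oplus>\<^bsub>M\<^esub> (r \<oplus>\<^bsub>R\<^esub> s) \<odot>\<^bsub>M\<^esub> x"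
      using uv U(1) x by (simp add: M.smult_l_distr M.M.a_ac subset_iff)
    then have "(u \<oplus>\<^bsub>M\<^esub> v) \<oplus>\<^bsub>M\<^esub> (r \<oplus>\<^bsub>R\<^esub> s) \<odot>\<^bsub>M\<^esub> x \<in> W" using W(3)[OF uv(5,6)] by simp
    then show "r \<oplus>\<^bsub>ring_module R\<^esub> s \<in> L" using uv(1,2) U(3)[OF uv(3,4)] by (auto simp: L_def)
  next
    fix r s assume r: "r \<in> carrier R" "s \<in> L"
    then obtain v where v: "s \<in> carrier R" "v \<in> U" "v \<oplus>\<^bsub>M\<^esub> s \<odot>\<^bsub>M\<^esub> x \<in> W" by (auto simp: L_def)
    have "r \<odot>\<^bsub>M\<^esub> (v \<oplus>\<^bsub>M\<^esub> s \<odot>\<^bsub>M\<^esub> x) = r \<odot>\<^bsub>M\<^esub> v \<oplus>\<^bsub>M\<^esub> (r \<otimes>\<^bsub>R\<^esub> s) \<odot>\<^bsub>M\<^esub> x"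
      using v(1,2) r(1) U(1) x by (simp add: M.smult_r_distr M.smult_assoc1 subset_iff)
    then have "r \<odot>\<^bsub>M\<^esub> v \<oplus>\<^bsub>M\<^esub> (r \<otimes>\<^bsub>R\<^esub> s) \<odot>\<^bsub>M\<^esub> x \<in> W" using W(4)[OF r(1) v(3)] by simp
    then show "r \<odot>\<^bsub>ring_module R\<^esub> s \<in> L" using r(1) v(1) U(4)[OF r(1) v(2)] by (auto simp: L_def)
  qed
  then have fgL: "fg_sub R (ring_module R) L"
    using noetherian_fg_sub[OF M.R.is_cring R] submodule_ring_module_iff[OF M.R.is_cring] by blast
  \<comment> \<open>Induction over generators of \<open>L\<close>: \<open>W'\<close> must contain
    the elements u + r x of \<open>W\<close> whose coefficient r lies in \<open>L'\<close>. For
    \<open>L'\<close> = \<open>L\<close> these are all elements of \<open>W\<close>.\<close>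
  have "\<exists>W'. fg_sub R M W' \<and> W \<inter> U \<subseteq> W' \<and> W' \<subseteq> W \<and>
      (\<forall>r\<in>L'. \<forall>u\<in>U. u \<oplus>\<^bsub>M\<^esub> r \<odot>\<^bsub>M\<^esub> x \<in> W \<longrightarrow> u \<oplus>\<^bsub>M\<^esub> r \<odot>\<^bsub>M\<^esub> x \<in> W')"
    if "fg_sub R (ring_module R) L'" "L' \<subseteq> L" for L'
    using that
  proof induction
    case zero
    show ?case using fg U(1) x by (intro exI[of _ "W \<inter> U"]) (auto simp: subset_iff)
  next
    case (adjoin L' a)
    have a: "a \<in> carrier R" using adjoin(2) by simp
    note L' = submodule_props[OF RM fg_sub_submodule[OF RM adjoin(1)], simplified]
    have "l \<in> L" if "l \<in> L'" for l
    proof -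
      have "l = l \<oplus>\<^bsub>R\<^esub> \<zero>\<^bsub>R\<^esub> \<otimes>\<^bsub>R\<^esub> a" using that L'(1) a by auto
      then show ?thesis using adjoin(4) that by (auto simp: subset_iff)
    qed
    then obtain W' where W': "fg_sub R M W'" "W \<inter> U \<subseteq> W'" "W' \<subseteq> W"
      "\<And>r u. r \<in> L' \<Longrightarrow> u \<in> U \<Longrightarrow> u \<oplus>\<^bsub>M\<^esub> r \<odot>\<^bsub>M\<^esub> x \<in> W \<Longrightarrow> u \<oplus>\<^bsub>M\<^esub> r \<odot>\<^bsub>M\<^esub> x \<in> W'"
      using adjoin.IH by blast
    have "a = \<zero>\<^bsub>R\<^esub> \<oplus>\<^bsub>R\<^esub> \<one>\<^bsub>R\<^esub> \<otimes>\<^bsub>R\<^esub> a" using a by simp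
    then have "a \<in> L" using adjoin(4) L'(2) M.R.one_closed by (auto simp: subset_iff)
    then obtain v where v: "v \<in> U" "v \<oplus>\<^bsub>M\<^esub> a \<odot>\<^bsub>M\<^esub> x \<in> W" by (auto simp: L_def)
    \<comment> \<open>This element witnesses that a lies in \<open>L\<close>; adjoining it to
      \<open>W'\<close> accounts for the new coefficient a.\<close>
    let ?w = "v \<oplus>\<^bsub>M\<^esub> a \<odot>\<^bsub>M\<^esub> x"
    let ?W = "{w \<oplus>\<^bsub>M\<^esub> r \<odot>\<^bsub>M\<^esub> ?w | w r. w \<in> W' \<and> r \<in> carrier R}"
    have w: "?w \<in> carrier M" using v(2) W(1) by blast
    show ?case
    proof (intro exI[of _ ?W] conjI ballI impI)
      show "fg_sub R M ?W" by (rule fg_sub.adjoin[OF W'(1) w])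
      show "W \<inter> U \<subseteq> ?W"
      proof
        fix y assume "y \<in> W \<inter> U"
        then have "y \<in> W'" "y \<in> carrier M" using W'(2) W(1) by auto
        then show "y \<in> ?W" using w by (auto intro!: exI[of _ y] exI[of _ "\<zero>\<^bsub>R\<^esub>"])
      qed
      show "?W \<subseteq> W" using W'(3) W(3) W(4)[OF _ v(2)] by auto
    next
      fix t u
      assume "t \<in> {l \<oplus>\<^bsub>ring_module R\<^esub> r \<odot>\<^bsub>ring_module R\<^esub> a | l r. l \<in> L' \<and> r \<in> carrier R}"
        and u: "u \<in> U" "u \<oplus>\<^bsub>M\<^esub> t \<odot>\<^bsub>M\<^esub> x \<in> W"
      then obtain l s where ls: "t = l \<oplus>\<^bsub>R\<^esub> s \<otimes>\<^bsub>R\<^esub> a" "l \<in> L'" "s \<in> carrier R" by auto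
      have c: "l \<in> carrier R" "u \<in> carrier M" "v \<in> carrier M" using ls(2) L'(1) u(1) v(1) U(1) by auto
      have sv: "s \<odot>\<^bsub>M\<^esub> v \<in> carrier M" using c(3) ls(3) by simp
      \<comment> \<open>Subtracting s times \<open>?w\<close> from u + t x changes the coefficient
        from t = l + s a to l, which lies in \<open>L'\<close>; the remainder y is in
        \<open>W\<close>, hence in \<open>W'\<close>.\<close>
      define y where "y = (u \<ominus>\<^bsub>M\<^esub> s \<odot>\<^bsub>M\<^esub> v) \<oplus>\<^bsub>M\<^esub> l \<odot>\<^bsub>M\<^esub> x"
      have yc: "y \<in> carrier M" unfolding y_def using c sv x by simp
      have "y \<oplus>\<^bsub>M\<^esub> s \<odot>\<^bsub>M\<^esub> ?w = ((u \<ominus>\<^bsub>M\<^esub> s \<odot>\<^bsub>M\<^esub> v) \<oplus>\<^bsub>M\<^esub> s \<odot>\<^bsub>M\<^esub> v) \<oplus>\<^bsub>M\<^esub> t \<odot>\<^bsub>M\<^esub> x"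
        unfolding y_def ls(1) using c sv x a ls(3) M.M.minus_closed[OF c(2) sv]
        by (simp add: M.smult_l_distr M.smult_r_distr M.smult_assoc1 M.M.a_ac)
      then have eq: "y \<oplus>\<^bsub>M\<^esub> s \<odot>\<^bsub>M\<^esub> ?w = u \<oplus>\<^bsub>M\<^esub> t \<odot>\<^bsub>M\<^esub> x"
        by (simp only: M.diff_add_cancel[OF c(2) sv])
      have "y = (u \<oplus>\<^bsub>M\<^esub> t \<odot>\<^bsub>M\<^esub> x) \<ominus>\<^bsub>M\<^esub> s \<odot>\<^bsub>M\<^esub> ?w"
        unfolding eq[symmetric] using yc w ls(3) by (simp only: M.add_diff_cancel M.smult_closed)
      then have "y \<in> W" using W(5)[OF u(2) W(4)[OF ls(3) v(2)]] by simp
      then have "y \<in> W'" unfolding y_def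
        by (rule W'(4)[OF ls(2) U(5)[OF u(1) U(4)[OF ls(3) v(1)]]])
      then show "u \<oplus>\<^bsub>M\<^esub> t \<odot>\<^bsub>M\<^esub> x \<in> ?W" using eq[symmetric] ls(3) by blast
    qed
  qed
  from this[OF fgL subset_refl] obtain W' where W': "fg_sub R M W'" "W' \<subseteq> W"
    "\<And>r u. r \<in> L \<Longrightarrow> u \<in> U \<Longrightarrow> u \<oplus>\<^bsub>M\<^esub> r \<odot>\<^bsub>M\<^esub> x \<in> W \<Longrightarrow> u \<oplus>\<^bsub>M\<^esub> r \<odot>\<^bsub>M\<^esub> x \<in> W'" by blast
  have "w \<in> W'" if w: "w \<in> W" for w
  proof -
    obtain u r where "w = u \<oplus>\<^bsub>M\<^esub> r \<odot>\<^bsub>M\<^esub> x" "u \<in> U" "r \<in> carrier R" using adjoin(5) w by blast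
    then show ?thesis using W'(3)[of r u] w by (auto simp: L_def)
  qed
  then have "W = W'" using W'(2) by blast
  then show ?case using W'(1) by simp
qed

section \<open>Short exact sequences\<close>

lemma short_exact_quot:
  assumes "module R M" "submodule U R M"
  shows "short_exact R M (quot_module M U) (\<lambda>x. U +>\<^bsub>M\<^esub> x)"
    and "short_exact.ker M (quot_module M U) (\<lambda>x. U +>\<^bsub>M\<^esub> x) = U"
proof -
  show s: "short_exact R M (quot_module M U) (\<lambda>x. U +>\<^bsub>M\<^esub> x)"
    by (rule short_exact.intro[OF assms(1) module_quot_module[OF assms] linmap_quot[OF assms]])
      (auto elim: quot_moduleE)
  show "short_exact.ker M (quot_module M U) (\<lambda>x. U +>\<^bsub>M\<^esub> x) = U"
    unfolding short_exact.ker_def[OF s]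
    using submodule_props(1)[OF assms] quot_map_eq_zero_iff[OF assms] by blast
qed

lemma short_exact_quot_quot:
  assumes "module R M" "submodule U R M" "submodule V R M" "U \<subseteq> V"
  shows "short_exact R (quot_module M U) (quot_module M V) (\<lambda>C. V <+>\<^bsub>M\<^esub> C)"
    and "short_exact.ker (quot_module M U) (quot_module M V) (\<lambda>C. V <+>\<^bsub>M\<^esub> C) = (\<lambda>x. U +>\<^bsub>M\<^esub> x) ` V"
proof -
  note V = submodule_props[OF assms(1,3)]
  show s: "short_exact R (quot_module M U) (quot_module M V) (\<lambda>C. V <+>\<^bsub>M\<^esub> C)"
  proof (rule short_exact.intro[OF module_quot_module[OF assms(1,2)] module_quot_module[OF assms(1,3)]
        linmap_quot_quot[OF assms]])
    fix C assume "C \<in> carrier (quot_module M V)"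
    then obtain x where x: "x \<in> carrier M" "C = V +>\<^bsub>M\<^esub> x" by (rule quot_moduleE)
    then show "C \<in> (\<lambda>C. V <+>\<^bsub>M\<^esub> C) ` carrier (quot_module M U)"
      using set_add_rcos[OF assms x(1)] quot_module_closed[OF x(1), of U] by (metis imageI)
  qed
  have "V <+>\<^bsub>M\<^esub> (U +>\<^bsub>M\<^esub> x) = \<zero>\<^bsub>quot_module M V\<^esub> \<longleftrightarrow> x \<in> V" if "x \<in> carrier M" for x
    unfolding set_add_rcos[OF assms that] by (rule quot_map_eq_zero_iff[OF assms(1,3) that])
  note eq = this
  show "short_exact.ker (quot_module M U) (quot_module M V) (\<lambda>C. V <+>\<^bsub>M\<^esub> C) = (\<lambda>x. U +>\<^bsub>M\<^esub> x) ` V"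
    unfolding short_exact.ker_def[OF s]
  proof (intro equalityI subsetI)
    fix C assume "C \<in> {C \<in> carrier (quot_module M U). V <+>\<^bsub>M\<^esub> C = \<zero>\<^bsub>quot_module M V\<^esub>}"
    then have C: "C \<in> carrier (quot_module M U)" "V <+>\<^bsub>M\<^esub> C = \<zero>\<^bsub>quot_module M V\<^esub>" by auto
    from C(1) obtain x where "x \<in> carrier M" "C = U +>\<^bsub>M\<^esub> x" by (rule quot_moduleE)
    then show "C \<in> (\<lambda>x. U +>\<^bsub>M\<^esub> x) ` V" using C(2) eq by blast
  next
    fix C assume "C \<in> (\<lambda>x. U +>\<^bsub>M\<^esub> x) ` V"
    then obtain x where "x \<in> V" "C = U +>\<^bsub>M\<^esub> x" by blast
    then show "C \<in> {C \<in> carrier (quot_module M U). V <+>\<^bsub>M\<^esub> C = \<zero>\<^bsub>quot_module M V\<^esub>}"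
      using eq V(1) quot_module_closed[of x M U] by blast
  qed
qed

text \<open>The isomorphism \<open>(U + \<alpha>(A)) / U \<cong> A / \<alpha>\<^sup>-\<^sup>1(U)\<close>, composed with the projection.\<close>

definition coset_preimage ::
    "('r, 'a, 'y) module_scheme \<Rightarrow> ('r, 'b, 'z) module_scheme \<Rightarrow> ('a \<Rightarrow> 'b) \<Rightarrow> 'b set \<Rightarrow> 'b \<Rightarrow> 'a set" where
  "coset_preimage A B \<alpha> U y = {z \<in> carrier A. \<alpha> z \<ominus>\<^bsub>B\<^esub> y \<in> U}"

text \<open>Applied with A = R and \<open>\<alpha>\<close> r = r x to adjoin a generator, and with A
  = B and multiplication by a ring element to adjoin aA. By the last part, the map composed with
  \<open>\<alpha>\<close> is the projection to A/V.\<close>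

lemma short_exact_adjoin:
  fixes \<alpha> :: "'a \<Rightarrow> 'b" and A :: "('r, 'a, 'y) module_scheme" and B :: "('r, 'b, 'z) module_scheme"
  defines "W U \<equiv> {u \<oplus>\<^bsub>B\<^esub> \<alpha> z | u z. u \<in> U \<and> z \<in> carrier A}"
    and "V U \<equiv> {z \<in> carrier A. \<alpha> z \<in> U}"
  assumes A: "module R A" and B: "module R B" and \<alpha>: "linmap R A B \<alpha>" and U: "submodule U R B"
  shows "short_exact R (B\<lparr>carrier := W U\<rparr>) (quot_module A (V U)) (coset_preimage A B \<alpha> U)"
    and "short_exact.ker (B\<lparr>carrier := W U\<rparr>) (quot_module A (V U)) (coset_preimage A B \<alpha> U) = U"
    and "z \<in> carrier A \<Longrightarrow> coset_preimage A B \<alpha> U (\<alpha> z) = V U +>\<^bsub>A\<^esub> z"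
proof -
  interpret A: module R A by fact
  interpret B: module R B by fact
  note U' = submodule_props[OF B U]
  have V: "submodule (V U) R A" unfolding V_def by (rule submodule_vimage[OF A B \<alpha> U])
  have W: "submodule (W U) R B" unfolding W_def by (rule submodule_image_plus[OF A B \<alpha> U])
  have mW: "module R (B\<lparr>carrier := W U\<rparr>)" by (rule module_submodule[OF B W])
  have mV: "module R (quot_module A (V U))" by (rule module_quot_module[OF A V])
  have eq: "coset_preimage A B \<alpha> U (u \<oplus>\<^bsub>B\<^esub> \<alpha> z) = V U +>\<^bsub>A\<^esub> z" if u: "u \<in> U" and z: "z \<in> carrier A" for u z
  proof -
    have Vz: "V U +>\<^bsub>A\<^esub> z \<subseteq> carrier A"
      using A.M.a_r_coset_subset_G[of "V U" z] submodule_props(1)[OF A V] z by simp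
    have "\<alpha> z' \<ominus>\<^bsub>B\<^esub> (u \<oplus>\<^bsub>B\<^esub> \<alpha> z) \<in> U \<longleftrightarrow> z' \<in> V U +>\<^bsub>A\<^esub> z" if z': "z' \<in> carrier A" for z'
    proof -
      have c: "\<alpha> z' \<in> carrier B" "\<alpha> z \<in> carrier B" "u \<in> carrier B"
        using linmap_closed[OF \<alpha>] z z' u U'(1) by auto
      have e: "\<alpha> z' \<ominus>\<^bsub>B\<^esub> \<alpha> z = (\<alpha> z' \<ominus>\<^bsub>B\<^esub> (u \<oplus>\<^bsub>B\<^esub> \<alpha> z)) \<oplus>\<^bsub>B\<^esub> u" by (rule B.diff_split[OF c(1,3,2)])
      have "\<alpha> z' \<ominus>\<^bsub>B\<^esub> (u \<oplus>\<^bsub>B\<^esub> \<alpha> z) = (\<alpha> z' \<ominus>\<^bsub>B\<^esub> \<alpha> z) \<ominus>\<^bsub>B\<^esub> u"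
        unfolding e using c by (simp only: B.add_diff_cancel B.M.minus_closed B.M.a_closed)
      then have "\<alpha> z' \<ominus>\<^bsub>B\<^esub> (u \<oplus>\<^bsub>B\<^esub> \<alpha> z) \<in> U \<longleftrightarrow> \<alpha> z' \<ominus>\<^bsub>B\<^esub> \<alpha> z \<in> U"
        using e u U'(3,5) by metis
      also have "\<dots> \<longleftrightarrow> z' \<ominus>\<^bsub>A\<^esub> z \<in> V U"
        using z z' by (simp add: V_def linmap_diff[OF A B \<alpha>])
      also have "\<dots> \<longleftrightarrow> z' \<in> V U +>\<^bsub>A\<^esub> z" using mem_rcos_iff[OF A V z z'] by simp
      finally show ?thesis .
    qed
    then show ?thesis using Vz unfolding coset_preimage_def by blast
  qed
  have WE: thesis if "y \<in> W U" "\<And>u z. y = u \<oplus>\<^bsub>B\<^esub> \<alpha> z \<Longrightarrow> u \<in> U \<Longrightarrow> z \<in> carrier A \<Longrightarrow> thesis" for y thesis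
    using that unfolding W_def by blast
  have lin: "linmap R (B\<lparr>carrier := W U\<rparr>) (quot_module A (V U)) (coset_preimage A B \<alpha> U)"
  proof (rule linmapI)
    fix y assume "y \<in> carrier (B\<lparr>carrier := W U\<rparr>)"
    then have "y \<in> W U" by simp
    then obtain u z where uz: "y = u \<oplus>\<^bsub>B\<^esub> \<alpha> z" "u \<in> U" "z \<in> carrier A" by (rule WE)
    show "coset_preimage A B \<alpha> U y \<in> carrier (quot_module A (V U))"
      unfolding uz(1) eq[OF uz(2,3)] by (rule quot_module_closed[OF uz(3)])
    {
      fix r assume r: "r \<in> carrier R"
      have "r \<odot>\<^bsub>B\<^esub> y = r \<odot>\<^bsub>B\<^esub> u \<oplus>\<^bsub>B\<^esub> \<alpha> (r \<odot>\<^bsub>A\<^esub> z)"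
        using uz r U'(1) linmap_closed[OF \<alpha>] by (auto simp: linmap_smult[OF \<alpha>] B.smult_r_distr)
      then show "coset_preimage A B \<alpha> U (r \<odot>\<^bsub>B\<lparr>carrier := W U\<rparr>\<^esub> y) =
          r \<odot>\<^bsub>quot_module A (V U)\<^esub> coset_preimage A B \<alpha> U y"
        using eq[OF U'(4)[OF r uz(2)] A.smult_closed[OF r uz(3)]] eq[OF uz(2,3)]
          quot_module_simps(3)[OF A V r uz(3)] uz(1) by simp
    }
    fix y' assume "y' \<in> carrier (B\<lparr>carrier := W U\<rparr>)"
    then have "y' \<in> W U" by simp
    then obtain u' z' where uz': "y' = u' \<oplus>\<^bsub>B\<^esub> \<alpha> z'" "u' \<in> U" "z' \<in> carrier A" by (rule WE)
    have "y \<oplus>\<^bsub>B\<^esub> y' = (u \<oplus>\<^bsub>B\<^esub> u') \<oplus>\<^bsub>B\<^esub> \<alpha> (z \<oplus>\<^bsub>A\<^esub> z')"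
      using uz uz' U'(1) linmap_closed[OF \<alpha>] by (auto simp: linmap_add[OF \<alpha>] B.M.a_ac subset_iff)
    then show "coset_preimage A B \<alpha> U (y \<oplus>\<^bsub>B\<lparr>carrier := W U\<rparr>\<^esub> y') =
        coset_preimage A B \<alpha> U y \<oplus>\<^bsub>quot_module A (V U)\<^esub> coset_preimage A B \<alpha> U y'"
      using eq[OF U'(3)[OF uz(2) uz'(2)] A.M.a_closed[OF uz(3) uz'(3)]] eq[OF uz(2,3)] eq[OF uz'(2,3)]
        quot_module_simps(2)[OF A V uz(3) uz'(3)] uz(1) uz'(1) by simp
  qed
  show s: "short_exact R (B\<lparr>carrier := W U\<rparr>) (quot_module A (V U)) (coset_preimage A B \<alpha> U)"
  proof (rule short_exact.intro[OF mW mV lin])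
    fix C assume "C \<in> carrier (quot_module A (V U))"
    then obtain z where z: "z \<in> carrier A" "C = V U +>\<^bsub>A\<^esub> z" by (rule quot_moduleE)
    then have "C = coset_preimage A B \<alpha> U (\<zero>\<^bsub>B\<^esub> \<oplus>\<^bsub>B\<^esub> \<alpha> z)" using eq[OF U'(2) z(1)] by simp
    moreover have "\<zero>\<^bsub>B\<^esub> \<oplus>\<^bsub>B\<^esub> \<alpha> z \<in> W U" unfolding W_def using U'(2) z(1) by blast
    ultimately show "C \<in> coset_preimage A B \<alpha> U ` carrier (B\<lparr>carrier := W U\<rparr>)" by auto
  qed
  have "coset_preimage A B \<alpha> U y = \<zero>\<^bsub>quot_module A (V U)\<^esub> \<longleftrightarrow> y \<in> U" if y: "y \<in> W U" for y
  proof -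
    obtain u z where uz: "y = u \<oplus>\<^bsub>B\<^esub> \<alpha> z" "u \<in> U" "z \<in> carrier A" using y by (rule WE)
    have c: "u \<in> carrier B" "\<alpha> z \<in> carrier B" using uz U'(1) linmap_closed[OF \<alpha>] by auto
    have "coset_preimage A B \<alpha> U y = \<zero>\<^bsub>quot_module A (V U)\<^esub> \<longleftrightarrow> z \<in> V U"
      unfolding uz(1) eq[OF uz(2,3)] by (rule quot_map_eq_zero_iff[OF A V uz(3)])
    also have "\<dots> \<longleftrightarrow> \<alpha> z \<in> U" using uz(3) by (simp add: V_def)
    also have "\<dots> \<longleftrightarrow> y \<in> U"
      using U'(3)[OF uz(2)] U'(5)[of y u] B.add_diff_cancel_left[OF c(2,1)] uz(1,2) by auto
    finally show ?thesis .
  qed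
  moreover have "U \<subseteq> W U"
  proof
    fix u assume u: "u \<in> U"
    then have "u = u \<oplus>\<^bsub>B\<^esub> \<alpha> \<zero>\<^bsub>A\<^esub>" using U'(1) linmap_zero[OF A B \<alpha>] by auto
    then show "u \<in> W U" unfolding W_def using u by blast
  qed
  ultimately show "short_exact.ker (B\<lparr>carrier := W U\<rparr>) (quot_module A (V U)) (coset_preimage A B \<alpha> U) = U"
    unfolding short_exact.ker_def[OF s] by auto
  show "coset_preimage A B \<alpha> U (\<alpha> z) = V U +>\<^bsub>A\<^esub> z" if "z \<in> carrier A"
    using eq[OF U'(2) that] linmap_closed[OF \<alpha> that] by simp
qed

section \<open>Vanishing of Ext\<close>

lemma cocyc_submodule:
  assumes "module R B" "submodule U R B" "cocyc R B N i f"
  shows "cocyc R (B\<lparr>carrier := U\<rparr>) N i f"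
  using cocyc_pullback[OF chain_lift_inclusion[OF assms(1,2) chain_lift_id] assms(3)] .

lemma cobd_submodule:
  assumes "module R N" "module R B" "submodule U R B" "cobd R B N i f"
  shows "cobd R (B\<lparr>carrier := U\<rparr>) N i f"
  using cobd_pullback[OF assms(1) module_submodule[OF assms(2,3)] assms(2)
      chain_lift_inclusion[OF assms(2,3) chain_lift_id] assms(4)] .

lemma (in short_exact) ext_zero_middle:
  assumes N: "module R N" and "ext_zero R K N i" "ext_zero R C N i"
  shows "ext_zero R B N i"
  unfolding ext_zero_def
proof (intro allI impI)
  fix f assume f: "cocyc R B N i f"
  have "cobd R K N i f" using assms(2) cocyc_submodule[OF B ker_submodule f] by (simp add: ext_zero_def)
  then obtain g where g: "cocyc R C N i g" "cobd R B N i (\<lambda>v. f v \<ominus>\<^bsub>N\<^esub> g (res_map R \<pi> v))"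
    using ext_exact_middle[OF N f] by blast
  have "cobd R C N i g" using assms(3) g(1) by (simp add: ext_zero_def)
  from cobd_pullback[OF N B C res_map_lift this]
  have *: "cobd R B N i (\<lambda>v. g (res_map R \<pi> v))" .
  show "cobd R B N i f"
    using cobd_diff_cancel[OF N B linmap_closed[OF cocyc_linmap[OF f]] cobd_closed[OF B *] g(2)] * by simp
qed

text \<open>The standard resolution of the zero module need not be zero, as its basis contains
  \<open>Elt\<close> of zero. But its identity also lifts the zero map and is therefore
  null-homotopic.\<close>

lemma ext_zero_trivial:
  assumes A: "module R A" and N: "module R N" and "carrier A = {\<zero>\<^bsub>A\<^esub>}"
  shows "ext_zero R A N i"
  unfolding ext_zero_def
proof (intro allI impI)
  interpret A: exact_complex R "res_module R A" "boundary R" "augmentation R A" A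
    by (rule exact_complex_res[OF A])
  fix f assume f: "cocyc R A N i f"
  have "res_lift R A A (\<lambda>_. \<zero>\<^bsub>A\<^esub>) (\<lambda>_ u. u)"
    by (rule chain_lift_cong[OF chain_lift_id A]) (use assms(3) in auto)
  from A.cobd_null[OF A N this cocyc_linmap[OF f] cocyc_boundary[OF f]] show "cobd R A N i f" .
qed

text \<open>Each adjoined generator contributes a factor R/J, and J contains \<open>\<aa>\<close>
  because \<open>\<aa>\<close> annihilates the generator. Vanishing at both ends of a short exact
  sequence passes to the middle.\<close>

lemma ext_zero_fg:
  assumes N: "module R N" and B: "module R B"
    and T: "\<And>J. submodule J R (ring_module R) \<Longrightarrow> \<aa> \<subseteq> J \<Longrightarrow> ext_zero R (quot_module (ring_module R) J) N i"
    and \<aa>: "\<aa> \<subseteq> carrier R"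
    and U: "fg_sub R B U" and ann: "\<And>a x. a \<in> \<aa> \<Longrightarrow> x \<in> U \<Longrightarrow> a \<odot>\<^bsub>B\<^esub> x = \<zero>\<^bsub>B\<^esub>"
  shows "ext_zero R (B\<lparr>carrier := U\<rparr>) N i"
  using U ann
proof induction
  case zero
  show ?case
    by (rule ext_zero_trivial[OF module_submodule[OF B submodule_zero[OF B]] N]) simp
next
  case (adjoin U x)
  interpret B: module R B by fact
  have RM: "module R (ring_module R)" by (rule module_ring_module[OF B.R.is_cring])
  have U: "submodule U R B" by (rule fg_sub_submodule[OF B adjoin(1)])
  note U' = submodule_props[OF B U]
  have x: "linmap R (ring_module R) B (\<lambda>r. r \<odot>\<^bsub>B\<^esub> x)" by (rule linmap_ring_module[OF B adjoin(2)])
  let ?W = "{u \<oplus>\<^bsub>B\<^esub> r \<odot>\<^bsub>B\<^esub> x | u r. u \<in> U \<and> r \<in> carrier R}"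
  let ?J = "{r \<in> carrier (ring_module R). r \<odot>\<^bsub>B\<^esub> x \<in> U}"
  have 1: "u \<oplus>\<^bsub>B\<^esub> r \<odot>\<^bsub>B\<^esub> x \<in> ?W" if "u \<in> U" "r \<in> carrier R" for u r using that by blast
  have UW: "u \<in> ?W" if "u \<in> U" for u
    using 1[OF that B.R.zero_closed] that U'(1) adjoin(2) by (auto simp: subset_iff)
  have xW: "x \<in> ?W" using 1[OF U'(2) B.R.one_closed] adjoin(2) by simp
  note se = short_exact_adjoin[OF RM B x U, unfolded ring_module_simps]
  interpret S: short_exact R "B\<lparr>carrier := ?W\<rparr>" "quot_module (ring_module R) ?J"
      "coset_preimage (ring_module R) B (\<lambda>r. r \<odot>\<^bsub>B\<^esub> x) U"
    using se(1) by simp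
  have "\<aa> \<subseteq> ?J" using adjoin.prems[OF _ xW] \<aa> U'(2) by auto
  moreover have "submodule ?J R (ring_module R)" by (rule submodule_vimage[OF RM B x U])
  ultimately have "ext_zero R (quot_module (ring_module R) ?J) N i" by (intro T)
  moreover have "ext_zero R (B\<lparr>carrier := U\<rparr>) N i"
    using adjoin.IH adjoin.prems UW by blast
  moreover have "S.ker = U" using se(2) by simp
  ultimately show ?case using S.ext_zero_middle[OF N] by simp
qed

text \<open>The standard resolution of R is not the trivial one, so its identity is compared with
  the lift \<open>\<rho>\<close>, which in degree 0 projects onto the span of the generator over 1
  and is zero above. A cocycle of positive degree is thus cohomologous to zero.\<close>

lemma ext_zero_ring_module:
  assumes R: "cring R" and N: "module R N"
  shows "ext_zero R (ring_module R) N (Suc i)"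
  unfolding ext_zero_def
proof (intro allI impI)
  interpret cring R by fact
  interpret N: module R N by fact
  let ?A = "ring_module R"
  let ?F = "res_module R ?A"
  have A: "module R ?A" by (rule module_ring_module[OF R])
  have F: "module R (?F n)" for n by (rule module_res_module[OF R])
  interpret F0: module R "?F 0" by (rule F)
  fix g assume g: "cocyc R ?A N (Suc i) g"
  let ?s = "single R (Elt \<one>\<^bsub>R\<^esub>)"
  have s: "?s \<in> carrier (?F 0)" unfolding res_module_def by (intro single_closed R) simp
  have aug_s: "augmentation R ?A ?s = \<one>\<^bsub>R\<^esub>" by (rule augmentation_single[OF A]) simp
  define \<rho> where "\<rho> = (\<lambda>n u. case n of 0 \<Rightarrow> augmentation R ?A u \<odot>\<^bsub>?F 0\<^esub> ?s | Suc _ \<Rightarrow> \<zero>\<^bsub>?F n\<^esub>)"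
  have "res_lift R ?A ?A (\<lambda>a. a) \<rho>"
  proof (rule chain_liftI)
    show "linmap R (?F n) (?F n) (\<rho> n)" for n
    proof (cases n)
      case 0
      then show ?thesis unfolding \<rho>_def 0 nat.case
        by (intro linmap_comp[OF linmap_augmentation[OF A] linmap_ring_module[OF F s]])
    next
      case (Suc m)
      show ?thesis unfolding \<rho>_def Suc nat.case by (rule linmap_const_zero[OF F])
    qed
    fix u
    show "augmentation R ?A (\<rho> 0 u) = augmentation R ?A u" if u: "u \<in> carrier (?F 0)"
    proof -
      have c: "augmentation R ?A u \<in> carrier R" using linmap_closed[OF linmap_augmentation[OF A] u] by simp
      show ?thesis unfolding \<rho>_def nat.case linmap_smult[OF linmap_augmentation[OF A] c s] aug_s
        using c by simp
    qed
    show "boundary R (\<rho> (Suc n) u) = \<rho> n (boundary R u)" if u: "u \<in> carrier (?F (Suc n))" for n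
    proof -
      have "boundary R (\<rho> (Suc n) u) = \<zero>\<^bsub>?F n\<^esub>"
        unfolding \<rho>_def nat.case by (rule linmap_zero[OF F F linmap_boundary_Suc[OF A]])
      also have "\<zero>\<^bsub>?F n\<^esub> = \<rho> n (boundary R u)"
      proof (cases n)
        case 0
        have "augmentation R ?A (boundary R u) = \<zero>\<^bsub>R\<^esub>" using augmentation_boundary[OF A] u 0 by simp
        then show ?thesis unfolding \<rho>_def 0 nat.case using F0.smult_l_null[OF s] by simp
      qed (simp add: \<rho>_def)
      finally show ?thesis .
    qed
  qed
  from cocyc_lift_unique[OF A A N chain_lift_id this g]
  have *: "cobd R ?A N (Suc i) (\<lambda>u. g u \<ominus>\<^bsub>N\<^esub> g (\<rho> (Suc i) u))" .
  have "g (\<rho> (Suc i) u) = \<zero>\<^bsub>N\<^esub>" for u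
    unfolding \<rho>_def nat.case by (rule linmap_zero[OF F N cocyc_linmap[OF g]])
  then have "g u \<ominus>\<^bsub>N\<^esub> g (\<rho> (Suc i) u) = g u" if "u \<in> carrier (?F (Suc i))" for u
    using linmap_closed[OF cocyc_linmap[OF g] that] N.diff_zero by simp
  then have "cobd R ?A N (Suc i) (\<lambda>u. g u \<ominus>\<^bsub>N\<^esub> g (\<rho> (Suc i) u)) \<longleftrightarrow> cobd R ?A N (Suc i) g"
    by (rule cobd_cong)
  with * show "cobd R ?A N (Suc i) g" by simp
qed

section \<open>Ext is weakly Laskerian\<close>

definition cocycle_module ::
    "('r, 'x) ring_scheme \<Rightarrow> ('r, 'a, 'y) module_scheme \<Rightarrow> ('r, 'b, 'z) module_scheme \<Rightarrow> nat
      \<Rightarrow> ('r, (('r, 'a) gen \<Rightarrow> 'r) \<Rightarrow> 'b) module" where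
  "cocycle_module R A N i = (cochains R A N i)\<lparr>carrier := cocycles R A N i\<rparr>"

lemma cocycles_iff:
  "f \<in> cocycles R A N i \<longleftrightarrow> cocyc R A N i f \<and> f \<in> extensional (carrier (res_module R A i))"
  by (auto simp: cocycles_def cochains_def Hom_module_carrier cocyc_def)

lemma cocycle_module_simps:
  "carrier (cocycle_module R A N i) = cocycles R A N i"
  "\<zero>\<^bsub>cocycle_module R A N i\<^esub> = (\<lambda>u\<in>carrier (res_module R A i). \<zero>\<^bsub>N\<^esub>)"
  "f \<oplus>\<^bsub>cocycle_module R A N i\<^esub> g = (\<lambda>u\<in>carrier (res_module R A i). f u \<oplus>\<^bsub>N\<^esub> g u)"
  "r \<odot>\<^bsub>cocycle_module R A N i\<^esub> f = (\<lambda>u\<in>carrier (res_module R A i). r \<odot>\<^bsub>N\<^esub> f u)"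
  by (simp_all add: cocycle_module_def cochains_def Hom_module_simps)

lemma cocyc_cong:
  assumes A: "module R A" and eq: "\<And>u. u \<in> carrier (res_module R A i) \<Longrightarrow> f u = g u"
  shows "cocyc R A N i f \<longleftrightarrow> cocyc R A N i g"
proof -
  interpret A: module R A by fact
  have "linmap R (res_module R A i) N f \<longleftrightarrow> linmap R (res_module R A i) N g"
    by (rule linmap_cong[OF eq module_res_module[OF A.R.is_cring]])
  then show ?thesis
    unfolding cocyc_def using eq linmap_closed[OF linmap_boundary_Suc[OF A]] by simp
qed

lemma restrict_cocycles:
  assumes "module R A" "cocyc R A N i f"
  shows "restrict f (carrier (res_module R A i)) \<in> cocycles R A N i"
proof -
  have "cocyc R A N i (restrict f (carrier (res_module R A i))) \<longleftrightarrow> cocyc R A N i f"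
    by (rule cocyc_cong[OF assms(1)]) simp
  then show ?thesis using assms(2) by (simp add: cocycles_iff)
qed

text \<open>In degree 0 the set contains only the zero cochain, and \<open>cobd\<close> says the
  same since \<open>boundary\<close> vanishes on F_0. In positive degrees the two notions differ
  only by extensionality.\<close>

lemma coboundaries_iff:
  assumes A: "module R A" and N: "module R N"
  shows "f \<in> coboundaries R A N i \<longleftrightarrow> cobd R A N i f \<and> f \<in> extensional (carrier (res_module R A i))"
proof (cases i)
  case 0
  interpret N: module R N by fact
  have F: "module R (res_module R A 0)" by (rule module_res_module[OF N.R.is_cring])
  show ?thesis
  proof
    assume "f \<in> coboundaries R A N i"
    then have f: "f = (\<lambda>u\<in>carrier (res_module R A 0). \<zero>\<^bsub>N\<^esub>)" using 0 by (simp add: cochains_def Hom_module_simps)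
    have "cobd R A N 0 f \<longleftrightarrow> cobd R A N 0 (\<lambda>_. \<zero>\<^bsub>N\<^esub>)" by (rule cobd_cong) (simp add: f)
    then show "cobd R A N i f \<and> f \<in> extensional (carrier (res_module R A i))"
      using cobd_zero[OF N] f 0 by simp
  next
    assume f: "cobd R A N i f \<and> f \<in> extensional (carrier (res_module R A i))"
    then obtain h where h: "linmap R (res_module R A 0) N h"
      "\<And>u. u \<in> carrier (res_module R A 0) \<Longrightarrow> f u = h (boundary R u)" using 0 by (auto elim!: cobdE)
    have "f u = \<zero>\<^bsub>N\<^esub>" if "u \<in> carrier (res_module R A 0)" for u
      using h(2)[OF that] boundary_eq_zero[OF N.R.is_cring that] linmap_zero[OF F N h(1)] by simp
    then have "f = (\<lambda>u\<in>carrier (res_module R A 0). \<zero>\<^bsub>N\<^esub>)"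
      using f 0 by (intro extensionalityI[of _ "carrier (res_module R A 0)"]) auto
    then show "f \<in> coboundaries R A N i" using 0 by (simp add: cochains_def Hom_module_simps)
  qed
next
  case (Suc j)
  interpret N: module R N by fact
  have F: "module R (res_module R A n)" for n by (rule module_res_module[OF N.R.is_cring])
  show ?thesis
  proof
    assume "f \<in> coboundaries R A N i"
    then obtain h where h: "h \<in> carrier (cochains R A N j)"
      "f = (\<lambda>u\<in>carrier (res_module R A i). h (boundary R u))" using Suc by auto
    then show "cobd R A N i f \<and> f \<in> extensional (carrier (res_module R A i))"
      using Suc by (auto simp: cochains_def Hom_module_carrier intro!: cobdI[of _ _ _ _ h])
  next
    assume f: "cobd R A N i f \<and> f \<in> extensional (carrier (res_module R A i))"
    then obtain h where h: "linmap R (res_module R A j) N h"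
      "\<And>u. u \<in> carrier (res_module R A i) \<Longrightarrow> f u = h (boundary R u)" using Suc by (auto elim!: cobdE)
    define k where "k = restrict h (carrier (res_module R A j))"
    have "k \<in> carrier (cochains R A N j)"
      by (simp add: k_def cochains_def Hom_module_carrier linmap_restrict[OF F h(1)])
    moreover have "k (boundary R u) = h (boundary R u)" if "u \<in> carrier (res_module R A i)" for u
      using linmap_closed[OF linmap_boundary_Suc[OF A, of j], of u] that Suc by (simp add: k_def)
    then have "f = (\<lambda>u\<in>carrier (res_module R A i). k (boundary R u))"
      using f h(2) by (intro extensionalityI[of _ "carrier (res_module R A i)"]) auto
    ultimately show "f \<in> coboundaries R A N i" using Suc by auto
  qed
qed

lemma cobd_cocyc:
  assumes A: "module R A" and N: "module R N" and f: "cobd R A N i f"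
  shows "cocyc R A N i f"
proof -
  interpret N: module R N by fact
  have F: "module R (res_module R A n)" for n by (rule module_res_module[OF N.R.is_cring])
  obtain h where h: "linmap R (res_module R A (i - 1)) N h"
    "\<And>u. u \<in> carrier (res_module R A i) \<Longrightarrow> f u = h (boundary R u)" using f by (rule cobdE) blast
  have "cocyc R A N i (\<lambda>u. h (boundary R u))"
    unfolding cocyc_def
    using linmap_comp[OF linmap_boundary[OF A] h(1)] boundary_boundary[OF A]
      linmap_zero[OF F N h(1)] by simp
  moreover have "cocyc R A N i f \<longleftrightarrow> cocyc R A N i (\<lambda>u. h (boundary R u))"
    by (rule cocyc_cong[OF A h(2)])
  ultimately show ?thesis by simp
qed

lemma submodule_cocycles:
  assumes A: "module R A" and N: "module R N"
  shows "submodule (cocycles R A N i) R (cochains R A N i)"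
proof -
  interpret N: module R N by fact
  have F: "module R (res_module R A n)" for n by (rule module_res_module[OF N.R.is_cring])
  have M: "module R (cochains R A N i)" unfolding cochains_def by (rule module_Hom_module[OF F N])
  show ?thesis
    unfolding submodule_iff[OF M]
  proof (intro conjI ballI)
    show "cocycles R A N i \<subseteq> carrier (cochains R A N i)" by (auto simp: cocycles_def)
    have "cocyc R A N i (\<lambda>_. \<zero>\<^bsub>N\<^esub>)" by (simp add: cocyc_def linmap_const_zero[OF N])
    from restrict_cocycles[OF A this] show "\<zero>\<^bsub>cochains R A N i\<^esub> \<in> cocycles R A N i"
      by (simp add: cochains_def Hom_module_simps)
  next
    fix f g assume "f \<in> cocycles R A N i" "g \<in> cocycles R A N i"
    then have "cocyc R A N i (\<lambda>u. f u \<oplus>\<^bsub>N\<^esub> g u)"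
      by (auto simp: cocycles_iff cocyc_def intro!: linmap_plus[OF N])
    from restrict_cocycles[OF A this] show "f \<oplus>\<^bsub>cochains R A N i\<^esub> g \<in> cocycles R A N i"
      by (simp add: cochains_def Hom_module_simps)
  next
    fix r f assume "r \<in> carrier R" "f \<in> cocycles R A N i"
    then have "cocyc R A N i (\<lambda>u. r \<odot>\<^bsub>N\<^esub> f u)"
      by (auto simp: cocycles_iff cocyc_def intro!: linmap_scale[OF N])
    from restrict_cocycles[OF A this] show "r \<odot>\<^bsub>cochains R A N i\<^esub> f \<in> cocycles R A N i"
      by (simp add: cochains_def Hom_module_simps)
  qed
qed

lemma module_cocycle_module:
  assumes A: "module R A" and N: "module R N"
  shows "module R (cocycle_module R A N i)"
proof -
  interpret N: module R N by fact
  have "module R (cochains R A N i)"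
    unfolding cochains_def by (rule module_Hom_module[OF module_res_module[OF N.R.is_cring] N])
  then show ?thesis unfolding cocycle_module_def by (rule module_submodule[OF _ submodule_cocycles[OF A N]])
qed

lemma submodule_coboundaries:
  assumes A: "module R A" and N: "module R N"
  shows "submodule (coboundaries R A N i) R (cocycle_module R A N i)"
  unfolding submodule_iff[OF module_cocycle_module[OF A N]] cocycle_module_simps
    coboundaries_iff[OF A N] cocycles_iff
proof (intro conjI ballI)
  show "coboundaries R A N i \<subseteq> cocycles R A N i"
    by (auto simp: coboundaries_iff[OF A N] cocycles_iff cobd_cocyc[OF A N])
  show "cobd R A N i (\<lambda>u\<in>carrier (res_module R A i). \<zero>\<^bsub>N\<^esub>)"
    using cobd_zero[OF N] by (simp cong: cobd_cong)
  show "cobd R A N i (\<lambda>u\<in>carrier (res_module R A i). f u \<oplus>\<^bsub>N\<^esub> g u)"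
    if "f \<in> coboundaries R A N i" "g \<in> coboundaries R A N i" for f g
  proof -
    have "cobd R A N i f" "cobd R A N i g" using that by (simp_all add: coboundaries_iff[OF A N])
    from cobd_add[OF N this] show ?thesis by (simp cong: cobd_cong)
  qed
  show "cobd R A N i (\<lambda>u\<in>carrier (res_module R A i). r \<odot>\<^bsub>N\<^esub> f u)"
    if "r \<in> carrier R" "f \<in> coboundaries R A N i" for r f
  proof -
    have "cobd R A N i f" using that(2) by (simp add: coboundaries_iff[OF A N])
    from cobd_smult[OF N this that(1)] show ?thesis by (simp cong: cobd_cong)
  qed
qed auto

lemma cocycle_module_minus:
  assumes A: "module R A" and N: "module R N"
    and f: "f \<in> cocycles R A N i" and g: "g \<in> cocycles R A N i"
  shows "f \<ominus>\<^bsub>cocycle_module R A N i\<^esub> g = (\<lambda>u\<in>carrier (res_module R A i). f u \<ominus>\<^bsub>N\<^esub> g u)"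
proof -
  interpret N: module R N by fact
  interpret Z: module R "cocycle_module R A N i" by (rule module_cocycle_module[OF A N])
  have g': "g u \<in> carrier N" if "u \<in> carrier (res_module R A i)" for u
    using g that by (auto simp: cocycles_iff intro: linmap_closed[OF cocyc_linmap])
  have "g \<in> carrier (cocycle_module R A N i)" using g by (simp add: cocycle_module_simps)
  from Z.minus_eq_smult[OF this] show ?thesis
    unfolding Z.M.minus_eq cocycle_module_simps
    by (auto simp: fun_eq_iff cocycle_module_simps N.M.minus_eq N.minus_eq_smult[OF g'])
qed

lemma cocycle_module_linmapI:
  assumes A: "module R A" and N: "module R N" and M: "module R M"
    and cl: "\<And>f. f \<in> cocycles R A N i \<Longrightarrow> T f \<in> carrier M"
    and add: "\<And>f g. f \<in> cocycles R A N i \<Longrightarrow> g \<in> cocycles R A N i \<Longrightarrow>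
      T (\<lambda>u\<in>carrier (res_module R A i). f u \<oplus>\<^bsub>N\<^esub> g u) = T f \<oplus>\<^bsub>M\<^esub> T g"
    and smult: "\<And>r f. r \<in> carrier R \<Longrightarrow> f \<in> cocycles R A N i \<Longrightarrow>
      T (\<lambda>u\<in>carrier (res_module R A i). r \<odot>\<^bsub>N\<^esub> f u) = r \<odot>\<^bsub>M\<^esub> T f"
  shows "linmap R (cocycle_module R A N i) M T"
  by (rule linmapI) (simp_all add: cocycle_module_simps cl add smult)

text \<open>The two degrees are independent so that p may be a chain map in one degree or the
  connecting map, which lowers the degree by one.\<close>

lemma linmap_cocycle_pullback:
  assumes A: "module R A" and B: "module R B" and N: "module R N"
    and p: "\<And>u. u \<in> carrier (res_module R A j) \<Longrightarrow> p u \<in> carrier (res_module R B i)"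
    and c: "\<And>f. cocyc R B N i f \<Longrightarrow> cocyc R A N j (\<lambda>u. f (p u))"
  shows "linmap R (cocycle_module R B N i) (cocycle_module R A N j)
    (\<lambda>f. \<lambda>u\<in>carrier (res_module R A j). f (p u))"
  by (rule cocycle_module_linmapI[OF B N module_cocycle_module[OF A N]])
    (auto simp: cocycle_module_simps cocycles_iff p restrict_def fun_eq_iff
      intro!: restrict_cocycles[OF A c, unfolded cocycles_iff restrict_def])

abbreviation "wl_ext R A N i \<equiv> wl R (cocycle_module R A N i) (coboundaries R A N i)"

context short_exact
begin

text \<open>\<open>wl_exact\<close> applies to Ext^i(C, N) -> Ext^i(B, N) -> Ext^i(K, N), with
  \<open>ext_exact_middle\<close> providing exactness.\<close>

lemma wl_ext_middle:
  assumes N: "module R N" and wl: "wl_ext R C N i" "wl_ext R K N i"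
  shows "wl_ext R B N i"
proof (rule wl_exact[OF module_cocycle_module[OF C N] module_cocycle_module[OF B N]
      module_cocycle_module[OF module_K N] submodule_coboundaries[OF module_K N] _ _ _ _ _ wl])
  let ?\<alpha> = "\<lambda>g. \<lambda>v\<in>carrier (res_module R B i). g (res_map R \<pi> v)"
  let ?\<beta> = "\<lambda>f. \<lambda>v\<in>carrier (res_module R K i). f v"
  have r: "res_map R \<pi> v \<in> carrier (res_module R C i)" if "v \<in> carrier (res_module R B i)" for v
    by (rule linmap_closed[OF chain_liftD(1)[OF res_map_lift] that])
  show "linmap R (cocycle_module R C N i) (cocycle_module R B N i) ?\<alpha>"
    by (rule linmap_cocycle_pullback[where p = "res_map R \<pi>", OF B C N r cocyc_pullback[OF res_map_lift]])
  show "linmap R (cocycle_module R B N i) (cocycle_module R K N i) ?\<beta>"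
    by (rule linmap_cocycle_pullback[where p = "\<lambda>v. v", OF module_K B N K_B cocyc_submodule[OF B ker_submodule]])
  show "coboundaries R C N i \<subseteq> carrier (cocycle_module R C N i)"
    using submodule_props(1)[OF module_cocycle_module[OF C N] submodule_coboundaries[OF C N]] .
  show "?\<alpha> g \<in> coboundaries R B N i" if "g \<in> coboundaries R C N i" for g
    using that cobd_pullback[OF N B C res_map_lift]
    by (simp add: coboundaries_iff[OF C N] coboundaries_iff[OF B N] cong: cobd_cong)
  fix f assume "f \<in> carrier (cocycle_module R B N i)" and fK: "?\<beta> f \<in> coboundaries R K N i"
  then have f: "f \<in> cocycles R B N i" by (simp add: cocycle_module_simps)
  then have f': "cocyc R B N i f" by (simp add: cocycles_iff)
  have "cobd R K N i f" using fK by (simp add: coboundaries_iff[OF module_K N] cong: cobd_cong)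
  from ext_exact_middle[OF N f' this] obtain g where
    g: "cocyc R C N i g" "cobd R B N i (\<lambda>v. f v \<ominus>\<^bsub>N\<^esub> g (res_map R \<pi> v))" by blast
  let ?g = "restrict g (carrier (res_module R C i))"
  have gC: "?g \<in> cocycles R C N i" by (rule restrict_cocycles[OF C g(1)])
  have eq: "?\<alpha> ?g = (\<lambda>v\<in>carrier (res_module R B i). g (res_map R \<pi> v))" using r by (auto simp: fun_eq_iff)
  have \<alpha>g: "?\<alpha> ?g \<in> cocycles R B N i"
    unfolding eq by (rule restrict_cocycles[OF B cocyc_pullback[OF res_map_lift g(1)]])
  have "f \<ominus>\<^bsub>cocycle_module R B N i\<^esub> ?\<alpha> ?g \<in> coboundaries R B N i"
    unfolding cocycle_module_minus[OF B N f \<alpha>g] coboundaries_iff[OF B N]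
    using g(2) r by (simp cong: cobd_cong)
  with gC show "\<exists>g\<in>carrier (cocycle_module R C N i). f \<ominus>\<^bsub>cocycle_module R B N i\<^esub> ?\<alpha> g \<in> coboundaries R B N i"
    by (intro bexI[of _ ?g]) (simp_all add: cocycle_module_simps)
qed

text \<open>Dimension shifting: since Ext^(i+1)(B, N) = 0, the connecting map from Ext^i(K, N) is
  onto Ext^(i+1)(C, N), and quotients of weakly Laskerian modules are weakly Laskerian.\<close>

lemma wl_ext_shift:
  assumes N: "weakly_Laskerian R N" and ez: "ext_zero R B N (Suc i)" and wl: "wl_ext R K N i"
  shows "wl_ext R C N (Suc i)"
proof -
  have N': "module R N" using N by (simp add: weakly_Laskerian_def)
  obtain p where p: "\<And>i. linmap R (res_module R C (Suc i)) (res_module R K i) (p i)"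
    "\<And>i w. w \<in> carrier (res_module R C (Suc (Suc i))) \<Longrightarrow>
      p i (boundary R w) = (\<ominus>\<^bsub>R\<^esub> \<one>\<^bsub>R\<^esub>) \<odot>\<^bsub>res_module R K i\<^esub> boundary R (p (Suc i) w)"
    and ex: "\<forall>i g. cocyc R C N (Suc i) g \<longrightarrow> cobd R B N (Suc i) (\<lambda>v. g (res_map R \<pi> v)) \<longrightarrow>
      (\<exists>k. cocyc R K N i k \<and> cobd R C N (Suc i) (\<lambda>w. g w \<ominus>\<^bsub>N\<^esub> k (p i w)))"
    using ext_connecting[OF N'] by (elim exE conjE) (rule that, simp_all only: bex_simps ball_simps)
  let ?\<alpha> = "\<lambda>k. \<lambda>w\<in>carrier (res_module R C (Suc i)). k (p i w)"
  have pc: "p i w \<in> carrier (res_module R K i)" if "w \<in> carrier (res_module R C (Suc i))" for w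
    by (rule linmap_closed[OF p(1) that])
  have cc: "cocyc R C N (Suc i) (\<lambda>w. k (p i w))" if "cocyc R K N i k" for k
    by (rule connecting_cocyc[where p = p, OF N' p(1) p(2) that])
  have cb: "cobd R C N (Suc i) (\<lambda>w. k (p i w))" if "cobd R K N i k" for k
    by (rule connecting_cobd[where p = p, OF N' p(1) p(2) that])
  show ?thesis
  \<comment> \<open>The third term is reached by the zero map, so exactness becomes surjectivity of
    the connecting map; \<open>N\<close> merely serves as a weakly Laskerian target.\<close>
  proof (rule wl_exact[OF module_cocycle_module[OF module_K N'] module_cocycle_module[OF C N'] N'
        submodule_zero[OF N'] _ _ _ linmap_const_zero[OF N'] _ wl weakly_Laskerian_wl[OF N]])
    show "linmap R (cocycle_module R K N i) (cocycle_module R C N (Suc i)) ?\<alpha>"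
      by (rule linmap_cocycle_pullback[where p = "p i", OF C module_K N' pc cc])
    show "coboundaries R K N i \<subseteq> carrier (cocycle_module R K N i)"
      using submodule_props(1)[OF module_cocycle_module[OF module_K N'] submodule_coboundaries[OF module_K N']] .
    show "?\<alpha> k \<in> coboundaries R C N (Suc i)" if "k \<in> coboundaries R K N i" for k
      using that cb by (simp add: coboundaries_iff[OF C N'] coboundaries_iff[OF module_K N'] del: coboundaries.simps cong: cobd_cong)
    fix g assume "g \<in> carrier (cocycle_module R C N (Suc i))"
    then have g: "g \<in> cocycles R C N (Suc i)" by (simp add: cocycle_module_simps)
    then have g': "cocyc R C N (Suc i) g" by (simp add: cocycles_iff)
    have "cobd R B N (Suc i) (\<lambda>v. g (res_map R \<pi> v))"
      using ez cocyc_pullback[OF res_map_lift g'] by (simp add: ext_zero_def)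
    then obtain k where k: "cocyc R K N i k" "cobd R C N (Suc i) (\<lambda>w. g w \<ominus>\<^bsub>N\<^esub> k (p i w))"
      using ex g' by blast
    let ?k = "restrict k (carrier (res_module R K i))"
    have kK: "?k \<in> cocycles R K N i" by (rule restrict_cocycles[OF module_K k(1)])
    have eq: "?\<alpha> ?k = (\<lambda>w\<in>carrier (res_module R C (Suc i)). k (p i w))" using pc by (auto simp: fun_eq_iff)
    have \<alpha>k: "?\<alpha> ?k \<in> cocycles R C N (Suc i)" unfolding eq by (rule restrict_cocycles[OF C cc[OF k(1)]])
    have "g \<ominus>\<^bsub>cocycle_module R C N (Suc i)\<^esub> ?\<alpha> ?k \<in> coboundaries R C N (Suc i)"
      unfolding cocycle_module_minus[OF C N' g \<alpha>k] coboundaries_iff[OF C N']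
      using k(2) pc by (simp cong: cobd_cong)
    with kK show "\<exists>k\<in>carrier (cocycle_module R K N i).
        g \<ominus>\<^bsub>cocycle_module R C N (Suc i)\<^esub> ?\<alpha> k \<in> coboundaries R C N (Suc i)"
      by (intro bexI[of _ ?k]) (simp_all add: cocycle_module_simps)
  qed
qed

end

text \<open>The filtration of \<open>ext_zero_fg\<close> again, with \<open>wl_ext_middle\<close> at
  each step. No annihilator is prescribed, so any ideal J may occur in a factor R/J.\<close>

lemma wl_ext_fg:
  assumes N: "module R N" and B: "module R B"
    and W: "\<And>J. submodule J R (ring_module R) \<Longrightarrow> wl_ext R (quot_module (ring_module R) J) N i"
    and U: "fg_sub R B U"
  shows "wl_ext R (B\<lparr>carrier := U\<rparr>) N i"
  using U
proof induction
  case zero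
  let ?Z = "B\<lparr>carrier := {\<zero>\<^bsub>B\<^esub>}\<rparr>"
  have Z: "module R ?Z" by (rule module_submodule[OF B submodule_zero[OF B]])
  have "ext_zero R ?Z N i" by (rule ext_zero_trivial[OF Z N]) simp
  then have "carrier (cocycle_module R ?Z N i) \<subseteq> coboundaries R ?Z N i"
    unfolding cocycle_module_simps by (auto simp: coboundaries_iff[OF Z N] cocycles_iff ext_zero_def)
  then show ?case by (rule wl_carrier[OF module_cocycle_module[OF Z N]])
next
  case (adjoin U x)
  interpret B: module R B by fact
  have RM: "module R (ring_module R)" by (rule module_ring_module[OF B.R.is_cring])
  have U: "submodule U R B" by (rule fg_sub_submodule[OF B adjoin(1)])
  have x: "linmap R (ring_module R) B (\<lambda>r. r \<odot>\<^bsub>B\<^esub> x)" by (rule linmap_ring_module[OF B adjoin(2)])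
  let ?W = "{u \<oplus>\<^bsub>B\<^esub> r \<odot>\<^bsub>B\<^esub> x | u r. u \<in> U \<and> r \<in> carrier R}"
  let ?J = "{r \<in> carrier (ring_module R). r \<odot>\<^bsub>B\<^esub> x \<in> U}"
  note se = short_exact_adjoin[OF RM B x U, unfolded ring_module_simps]
  interpret S: short_exact R "B\<lparr>carrier := ?W\<rparr>" "quot_module (ring_module R) ?J"
      "coset_preimage (ring_module R) B (\<lambda>r. r \<odot>\<^bsub>B\<^esub> x) U"
    using se(1) by simp
  have "wl_ext R (quot_module (ring_module R) ?J) N i"
    by (rule W[OF submodule_vimage[OF RM B x U]])
  moreover have "S.ker = U" using se(2) by simp
  ultimately show ?case using S.wl_ext_middle[OF N] adjoin.IH by simp
qed

text \<open>Evaluation at the coset of 1 embeds Hom(R/J, N) into N; this is \<open>wl_exact\<close>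
  with the zero map on the left.\<close>

lemma wl_ext_cyclic_0:
  assumes R: "cring R" and N: "weakly_Laskerian R N" and J: "submodule J R (ring_module R)"
  shows "wl_ext R (quot_module (ring_module R) J) N 0"
proof -
  have N': "module R N" using N by (simp add: weakly_Laskerian_def)
  interpret N: module R N by (rule N')
  have RM: "module R (ring_module R)" by (rule module_ring_module[OF R])
  let ?A = "quot_module (ring_module R) J"
  let ?F = "res_module R ?A"
  have A: "module R ?A" by (rule module_quot_module[OF RM J])
  interpret A: module R ?A by (rule A)
  interpret Z: module R "cocycle_module R ?A N 0" by (rule module_cocycle_module[OF A N'])
  interpret F: module R "?F 0" by (rule module_res_module[OF R])
  define e where "e = J +>\<^bsub>ring_module R\<^esub> \<one>\<^bsub>R\<^esub>"
  have e: "e \<in> carrier ?A" unfolding e_def by (rule quot_module_closed) simp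
  have se: "single R (Elt a) \<in> carrier (?F 0)" if "a \<in> carrier ?A" for a
    unfolding res_module_def using that by (intro single_closed R) simp
  show ?thesis
  proof (rule wl_exact[OF N' module_cocycle_module[OF A N'] N' submodule_zero[OF N']
        linmap_const_zero[OF module_cocycle_module[OF A N']] _ _ _ _
        weakly_Laskerian_wl[OF N, of "{}"] weakly_Laskerian_wl[OF N]])
    show "linmap R (cocycle_module R ?A N 0) N (\<lambda>f. f (single R (Elt e)))"
      by (rule cocycle_module_linmapI[OF A N' N'])
        (use se[OF e] in \<open>auto simp: cocycles_iff intro: linmap_closed[OF cocyc_linmap]\<close>)
    fix f assume "f \<in> carrier (cocycle_module R ?A N 0)" and fe: "f (single R (Elt e)) \<in> {\<zero>\<^bsub>N\<^esub>}"
    then have f: "f \<in> carrier (cocycle_module R ?A N 0)" "cocyc R ?A N 0 f"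
      "f \<in> extensional (carrier (?F 0))" by (auto simp: cocycle_module_simps cocycles_iff)
    note fl = cocyc_linmap[OF f(2)]
    have "f u = \<zero>\<^bsub>N\<^esub>" if u: "u \<in> carrier (?F 0)" for u
    proof (rule free_module_linmap_eq[OF N' fl[unfolded res_module_def] linmap_const_zero[OF N'] _
          u[unfolded res_module_def]])
      fix x assume "x \<in> res_basis R ?A 0"
      then obtain a where a: "x = Elt a" "a \<in> carrier ?A" by auto
      from a(2) obtain r where r: "r \<in> carrier R" "a = J +>\<^bsub>ring_module R\<^esub> r"
        by (auto elim: quot_moduleE)
      \<comment> \<open>Every element of R/J is r e, so the generator over a and r times the
        generator over e have the same augmentation. Their difference is a boundary, which the
        cocycle kills.\<close>
      have ae: "a = r \<odot>\<^bsub>?A\<^esub> e"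
        using quot_module_simps(3)[OF RM J r(1), of "\<one>\<^bsub>R\<^esub>"] r by (simp add: e_def)
      let ?v = "single R (Elt a)" and ?w = "r \<odot>\<^bsub>?F 0\<^esub> single R (Elt e)"
      have v: "?v \<in> carrier (?F 0)" by (rule se[OF a(2)])
      have w: "?w \<in> carrier (?F 0)" by (rule F.smult_closed[OF r(1) se[OF e]])
      have "augmentation R ?A (?v \<ominus>\<^bsub>?F 0\<^esub> ?w) = a \<ominus>\<^bsub>?A\<^esub> a"
        using linmap_diff[OF F.module_axioms A linmap_augmentation[OF A] v w]
          linmap_smult[OF linmap_augmentation[OF A] r(1) se[OF e]] augmentation_single[OF A a(2)]
          augmentation_single[OF A e] ae by simp
      then have "augmentation R ?A (?v \<ominus>\<^bsub>?F 0\<^esub> ?w) = \<zero>\<^bsub>?A\<^esub>" using A.diff_self[OF a(2)] by simp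
      from res_exact_0[OF A F.M.minus_closed[OF v w] this]
      obtain z where z: "z \<in> carrier (?F (Suc 0))" "boundary R z = ?v \<ominus>\<^bsub>?F 0\<^esub> ?w" by auto
      have "f ?v \<ominus>\<^bsub>N\<^esub> f ?w = \<zero>\<^bsub>N\<^esub>"
        using cocyc_boundary[OF f(2) z(1)] linmap_diff[OF F.module_axioms N' fl v w] z(2) by simp
      then have "f ?v = f ?w" using N.diff_eq_zero_iff linmap_closed[OF fl] v w by blast
      also have "\<dots> = \<zero>\<^bsub>N\<^esub>" using linmap_smult[OF fl r(1) se[OF e]] fe r(1) by simp
      finally show "f (single R x) = \<zero>\<^bsub>N\<^esub>" by (simp add: a(1))
    qed
    then have "cobd R ?A N 0 f" using cobd_zero[OF N'] by (simp cong: cobd_cong)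
    then have "f \<in> coboundaries R ?A N 0" using f(3) coboundaries_iff[OF A N'] by blast
    then have "f \<ominus>\<^bsub>cocycle_module R ?A N 0\<^esub> \<zero>\<^bsub>cocycle_module R ?A N 0\<^esub> \<in> coboundaries R ?A N 0"
      using Z.diff_zero[OF f(1)] by metis
    then show "\<exists>x\<in>carrier N. f \<ominus>\<^bsub>cocycle_module R ?A N 0\<^esub> \<zero>\<^bsub>cocycle_module R ?A N 0\<^esub> \<in> coboundaries R ?A N 0"
      using N.M.zero_closed by blast
  qed auto
qed

text \<open>The sequence 0 -> J -> R -> R/J -> 0 shifts Ext^(i+1)(R/J, N) to Ext^i(J, N). As J is
  finitely generated, it is filtered by cyclic modules R/J' for other ideals J', so the induction on
  i runs over all ideals at once.\<close>

theorem wl_ext_cyclic: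
  assumes R: "cring R" "noetherian_ring R" and N: "weakly_Laskerian R N"
    and "submodule J R (ring_module R)"
  shows "wl_ext R (quot_module (ring_module R) J) N i"
  using assms(4)
proof (induction i arbitrary: J)
  case 0
  then show ?case by (rule wl_ext_cyclic_0[OF R(1) N])
next
  case (Suc i)
  have N': "module R N" using N by (simp add: weakly_Laskerian_def)
  have RM: "module R (ring_module R)" by (rule module_ring_module[OF R(1)])
  note se = short_exact_quot[OF RM Suc.prems]
  interpret short_exact R "ring_module R" "quot_module (ring_module R) J" "\<lambda>x. J +>\<^bsub>ring_module R\<^esub> x"
    by (rule se(1))
  have "fg_sub R (ring_module R) J"
    using noetherian_fg_sub[OF R] submodule_ring_module_iff[OF R(1)] Suc.prems by blast
  from wl_ext_fg[OF N' RM Suc.IH this] have "wl_ext R K N i" using se(2) by simp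
  then show ?case by (rule wl_ext_shift[OF N ext_zero_ring_module[OF R(1) N']])
qed

section \<open>Direct limits of injective systems\<close>

locale injective_system =
  fixes R :: "('r, 'x) ring_scheme" and E :: "nat \<Rightarrow> ('r, 'e, 'y) module_scheme" and t :: "nat \<Rightarrow> 'e \<Rightarrow> 'e"
  assumes module_E: "module R (E q)" and linmap_t: "linmap R (E q) (E (Suc q)) (t q)"
    and inj_t: "x \<in> carrier (E q) \<Longrightarrow> t q x = \<zero>\<^bsub>E (Suc q)\<^esub> \<Longrightarrow> x = \<zero>\<^bsub>E q\<^esub>"
begin

lemma fold_trans: "p \<le> n \<Longrightarrow> n \<le> m \<Longrightarrow> fold t [p..<m] x = fold t [n..<m] (fold t [p..<n] x)"
  using upt_add_eq_append[of p n "m - n"] by simp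

lemma linmap_fold: "p \<le> n \<Longrightarrow> linmap R (E p) (E n) (\<lambda>x. fold t [p..<n] x)"
proof (induction n rule: dec_induct)
  case base
  then show ?case by (simp add: linmap_id)
next
  case (step n)
  from linmap_comp[OF step.IH linmap_t] show ?case using step(1) by simp
qed

lemma fold_inj: "p \<le> n \<Longrightarrow> x \<in> carrier (E p) \<Longrightarrow> fold t [p..<n] x = \<zero>\<^bsub>E n\<^esub> \<Longrightarrow> x = \<zero>\<^bsub>E p\<^esub>"
proof (induction n rule: dec_induct)
  case (step n)
  then have "t n (fold t [p..<n] x) = \<zero>\<^bsub>E (Suc n)\<^esub>" by simp
  from inj_t[OF linmap_closed[OF linmap_fold[OF step(1)] step(4)] this] step show ?case by blast
qed simp

abbreviation "pts \<equiv> SIGMA q:UNIV. carrier (E q)"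

lemma equiv_dlim_rel: "equiv pts (dlim_rel E t)"
proof (rule equivI)
  show "dlim_rel E t \<subseteq> pts \<times> pts" by (auto simp: dlim_rel_def)
  show "refl_on pts (dlim_rel E t)" by (auto simp: refl_on_def dlim_rel_def)
  show "sym (dlim_rel E t)" unfolding sym_def dlim_rel_def by (auto intro: sym)
  show "trans (dlim_rel E t)"
  proof (rule transI)
    fix a b c assume "(a, b) \<in> dlim_rel E t" "(b, c) \<in> dlim_rel E t"
    then obtain p x q y s z n m where *: "a = (p, x)" "b = (q, y)" "c = (s, z)" "x \<in> carrier (E p)"
      "z \<in> carrier (E s)" "p \<le> n" "q \<le> n" "fold t [p..<n] x = fold t [q..<n] y"
      "q \<le> m" "s \<le> m" "fold t [q..<m] y = fold t [s..<m] z" by (auto simp: dlim_rel_def)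
    \<comment> \<open>Both given equalities are pushed forward to the common stage max n m.\<close>
    have "fold t [p..<max n m] x = fold t [q..<max n m] y"
      using fold_trans[OF *(6), of "max n m"] fold_trans[OF *(7), of "max n m"] *(8) by simp
    also have "\<dots> = fold t [s..<max n m] z"
      using fold_trans[OF *(9), of "max n m"] fold_trans[OF *(10), of "max n m"] *(11) by simp
    finally have "fold t [p..<max n m] x = fold t [s..<max n m] z" .
    moreover have "p \<le> max n m" "s \<le> max n m" using *(6,10) by auto
    ultimately show "(a, c) \<in> dlim_rel E t" using *(1,3,4,5) unfolding dlim_rel_def by blast
  qed
qed

abbreviation "cls q x \<equiv> dlim_rel E t `` {(q, x)}"

lemma direct_limit_zero: "\<zero>\<^bsub>direct_limit E t\<^esub> = cls 0 \<zero>\<^bsub>E 0\<^esub>"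
  by (simp add: direct_limit_def)

lemma cls_eq_zero_iff:
  assumes x: "x \<in> carrier (E q)"
  shows "cls q x = \<zero>\<^bsub>direct_limit E t\<^esub> \<longleftrightarrow> x = \<zero>\<^bsub>E q\<^esub>"
proof -
  interpret E0: module R "E 0" by (rule module_E)
  have fz: "fold t [p..<n] \<zero>\<^bsub>E p\<^esub> = \<zero>\<^bsub>E n\<^esub>" if "p \<le> n" for p n
    by (rule linmap_zero[OF module_E module_E linmap_fold[OF that]])
  have "cls q x = \<zero>\<^bsub>direct_limit E t\<^esub> \<longleftrightarrow> ((q, x), (0, \<zero>\<^bsub>E 0\<^esub>)) \<in> dlim_rel E t"
    unfolding direct_limit_zero by (rule eq_equiv_class_iff[OF equiv_dlim_rel]) (use x in auto)
  also have "\<dots> \<longleftrightarrow> x = \<zero>\<^bsub>E q\<^esub>"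
  proof
    assume "((q, x), (0, \<zero>\<^bsub>E 0\<^esub>)) \<in> dlim_rel E t"
    then obtain n where "q \<le> n" "fold t [q..<n] x = fold t [0..<n] \<zero>\<^bsub>E 0\<^esub>" by (auto simp: dlim_rel_def)
    then show "x = \<zero>\<^bsub>E q\<^esub>" using fold_inj[OF _ x] fz[of 0 n] by simp
  next
    assume "x = \<zero>\<^bsub>E q\<^esub>"
    then have "fold t [q..<q] x = fold t [0..<q] \<zero>\<^bsub>E 0\<^esub>" using fz[of 0 q] by simp
    then show "((q, x), (0, \<zero>\<^bsub>E 0\<^esub>)) \<in> dlim_rel E t"
      using x E0.M.zero_closed unfolding dlim_rel_def by blast
  qed
  finally show ?thesis .
qed

lemma cls_closed: "x \<in> carrier (E q) \<Longrightarrow> cls q x \<in> carrier (direct_limit E t)"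
  by (auto simp: direct_limit_def intro: quotientI)

lemma direct_limitE:
  assumes "C \<in> carrier (direct_limit E t)"
  obtains q x where "x \<in> carrier (E q)" "C = cls q x"
  using assms by (auto simp: direct_limit_def elim!: quotientE)

lemma direct_limit_smult:
  assumes x: "x \<in> carrier (E q)" and r: "r \<in> carrier R"
  shows "r \<odot>\<^bsub>direct_limit E t\<^esub> cls q x = cls q (r \<odot>\<^bsub>E q\<^esub> x)"
proof -
  have cl: "r \<odot>\<^bsub>E p\<^esub> y \<in> carrier (E p)" if "y \<in> carrier (E p)" for p y
  proof -
    interpret Ep: module R "E p" by (rule module_E)
    show ?thesis using that r by simp
  qed
  have "(case a of (p, y) \<Rightarrow> cls p (r \<odot>\<^bsub>E p\<^esub> y)) = cls q (r \<odot>\<^bsub>E q\<^esub> x)" if "a \<in> cls q x" for a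
  proof -
    from that obtain p y n where a: "a = (p, y)" "y \<in> carrier (E p)" "q \<le> n" "p \<le> n"
      "fold t [q..<n] x = fold t [p..<n] y" by (auto simp: dlim_rel_def)
    have "fold t [q..<n] (r \<odot>\<^bsub>E q\<^esub> x) = fold t [p..<n] (r \<odot>\<^bsub>E p\<^esub> y)"
      using linmap_smult[OF linmap_fold[OF a(3)] r x] linmap_smult[OF linmap_fold[OF a(4)] r a(2)] a(5) by simp
    then have "((q, r \<odot>\<^bsub>E q\<^esub> x), (p, r \<odot>\<^bsub>E p\<^esub> y)) \<in> dlim_rel E t"
      using a(3,4) cl[OF x] cl[OF a(2)] unfolding dlim_rel_def by blast
    from equiv_class_eq[OF equiv_dlim_rel this] show ?thesis by (simp add: a(1))
  qed
  moreover have "cls q x \<noteq> {}" using equiv_class_self[OF equiv_dlim_rel, of "(q, x)"] x by auto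
  ultimately have "(\<Union>a\<in>cls q x. case a of (p, y) \<Rightarrow> cls p (r \<odot>\<^bsub>E p\<^esub> y)) = cls q (r \<odot>\<^bsub>E q\<^esub> x)"
    by (intro SUP_eq_const)
  then show ?thesis by (simp only: direct_limit_def module.select_convs)
qed

lemma direct_limit_trivial:
  assumes "\<not> nonzero_module (direct_limit E t)"
  shows "carrier (E q) = {\<zero>\<^bsub>E q\<^esub>}"
proof -
  interpret Eq: module R "E q" by (rule module_E)
  have *: "carrier (direct_limit E t) = {\<zero>\<^bsub>direct_limit E t\<^esub>}"
    using assms by (simp add: nonzero_module_def)
  have "x = \<zero>\<^bsub>E q\<^esub>" if x: "x \<in> carrier (E q)" for x
  proof -
    have "cls q x = \<zero>\<^bsub>direct_limit E t\<^esub>"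
      using cls_closed[OF x] unfolding * by (rule singletonD)
    then show ?thesis using cls_eq_zero_iff[OF x] by (rule iffD1[rotated])
  qed
  then show ?thesis using Eq.M.zero_closed by blast
qed

text \<open>With injective transition maps a class is zero in the limit only if its representative
  is zero, so both have the same annihilator.\<close>

lemma Ass_direct_limit: "Ass R (direct_limit E t) \<subseteq> (\<Union>q. Ass R (E q))"
proof
  fix P assume "P \<in> Ass R (direct_limit E t)"
  then obtain C where P: "primeideal P R" "C \<in> carrier (direct_limit E t)"
    "P = annihilator R (direct_limit E t) C" by (auto simp only: Ass_def)
  from P(2) obtain q x where x: "x \<in> carrier (E q)" "C = cls q x" by (rule direct_limitE)
  interpret Eq: module R "E q" by (rule module_E)
  have "r \<odot>\<^bsub>direct_limit E t\<^esub> C = \<zero>\<^bsub>direct_limit E t\<^esub> \<longleftrightarrow> r \<odot>\<^bsub>E q\<^esub> x = \<zero>\<^bsub>E q\<^esub>" if "r \<in> carrier R" for r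
    unfolding x(2) direct_limit_smult[OF x(1) that]
    by (rule cls_eq_zero_iff[OF Eq.smult_closed[OF that x(1)]])
  then have "P = annihilator R (E q) x" unfolding P(3) annihilator_def by blast
  then show "P \<in> (\<Union>q. Ass R (E q))" using P(1) x(1) unfolding Ass_def by blast
qed

end

section \<open>The maps between Ext modules\<close>

lemma Ext_eq_quot: "Ext R i A N = quot_module (cocycle_module R A N i) (coboundaries R A N i)"
  by (simp add: Ext_def cocycle_module_def)

lemma module_Ext: "module R A \<Longrightarrow> module R N \<Longrightarrow> module R (Ext R i A N)"
  unfolding Ext_eq_quot by (intro module_quot_module module_cocycle_module submodule_coboundaries)

lemma Ass_Ext:
  "module R A \<Longrightarrow> module R N \<Longrightarrow> Ass R (Ext R i A N) = Ass_rel R (cocycle_module R A N i) (coboundaries R A N i)"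
  unfolding Ext_eq_quot by (intro Ass_quot_module module_cocycle_module submodule_coboundaries)

lemma ext_zero_trivial_Ext:
  assumes A: "module R A" and N: "module R N" and "carrier (Ext R i A N) = {\<zero>\<^bsub>Ext R i A N\<^esub>}"
  shows "ext_zero R A N i"
  unfolding ext_zero_def
proof (intro allI impI)
  note M = module_cocycle_module[OF A N] and U = submodule_coboundaries[OF A N]
  fix f assume f: "cocyc R A N i f"
  let ?f = "restrict f (carrier (res_module R A i))"
  have f': "?f \<in> carrier (cocycle_module R A N i)"
    unfolding cocycle_module_simps by (rule restrict_cocycles[OF A f])
  have "coboundaries R A N i +>\<^bsub>cocycle_module R A N i\<^esub> ?f = \<zero>\<^bsub>Ext R i A N\<^esub>"
    using quot_module_closed[OF f', of "coboundaries R A N i"] assms(3) unfolding Ext_eq_quot by blast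
  then have "?f \<in> coboundaries R A N i"
    unfolding Ext_eq_quot using quot_map_eq_zero_iff[OF M U f'] by blast
  then show "cobd R A N i f" by (simp add: coboundaries_iff[OF A N] cong: cobd_cong)
qed

text \<open>\<open>Ext_map\<close> forms a union over all representatives of a class; these differ
  by coboundaries, whose pullbacks are coboundaries, so the union is a single coset.\<close>

lemma Ext_map_rcos:
  assumes A: "module R A" and C: "module R C" and N: "module R N" and f: "linmap R A C f"
    and \<psi>: "\<psi> \<in> cocycles R C N i"
  shows "Ext_map R i A N f (coboundaries R C N i +>\<^bsub>cocycle_module R C N i\<^esub> \<psi>) =
    coboundaries R A N i +>\<^bsub>cocycle_module R A N i\<^esub> (\<lambda>u\<in>carrier (res_module R A i). \<psi> (res_map R f u))"
proof -
  note MA = module_cocycle_module[OF A N, of i] and UA = submodule_coboundaries[OF A N, of i]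
  note MC = module_cocycle_module[OF C N, of i] and UC = submodule_coboundaries[OF C N, of i]
  interpret U: abelian_subgroup "coboundaries R C N i" "cocycle_module R C N i"
    by (rule abelian_subgroup_submodule[OF MC UC])
  let ?T = "\<lambda>\<psi>. \<lambda>u\<in>carrier (res_module R A i). \<psi> (res_map R f u)"
  note lift = chain_lift_res_map[OF A C f]
  have r: "res_map R f u \<in> carrier (res_module R C i)" if "u \<in> carrier (res_module R A i)" for u
    by (rule linmap_closed[OF linmap_res_map[OF A C f] that])
  have T: "linmap R (cocycle_module R C N i) (cocycle_module R A N i) ?T"
    by (rule linmap_cocycle_pullback[where p = "res_map R f", OF A C N r cocyc_pullback[OF lift]])
  have \<psi>c: "\<psi> \<in> carrier (cocycle_module R C N i)" using \<psi> by (simp add: cocycle_module_simps)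
  have cb: "?T \<phi> \<in> coboundaries R A N i" if "\<phi> \<in> coboundaries R C N i" for \<phi>
    using that cobd_pullback[OF N A C lift]
    by (simp add: coboundaries_iff[OF C N] coboundaries_iff[OF A N] cong: cobd_cong)
  have eq: "coboundaries R A N i +>\<^bsub>cocycle_module R A N i\<^esub> ?T \<phi> =
      coboundaries R A N i +>\<^bsub>cocycle_module R A N i\<^esub> ?T \<psi>"
    if "\<phi> \<in> coboundaries R C N i +>\<^bsub>cocycle_module R C N i\<^esub> \<psi>" for \<phi>
  proof -
    have \<phi>: "\<phi> \<in> carrier (cocycle_module R C N i)"
      by (rule U.a_elemrcos_carrier[OF \<psi>c that])
    have "\<phi> \<ominus>\<^bsub>cocycle_module R C N i\<^esub> \<psi> \<in> coboundaries R C N i"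
      using mem_rcos_iff[OF MC UC \<psi>c \<phi>] that by blast
    from cb[OF this] show ?thesis
      unfolding linmap_diff[OF MC MA T \<phi> \<psi>c]
        rcos_eq_iff[OF MA UA linmap_closed[OF T \<phi>] linmap_closed[OF T \<psi>c]] .
  qed
  have "coboundaries R C N i +>\<^bsub>cocycle_module R C N i\<^esub> \<psi> \<noteq> {}" using U.a_rcos_self[OF \<psi>c] by blast
  then have "(\<Union>\<phi>\<in>coboundaries R C N i +>\<^bsub>cocycle_module R C N i\<^esub> \<psi>.
      coboundaries R A N i +>\<^bsub>cocycle_module R A N i\<^esub> ?T \<phi>) =
      coboundaries R A N i +>\<^bsub>cocycle_module R A N i\<^esub> ?T \<psi>" by (rule SUP_eq_const[OF _ eq])
  \<comment> \<open>\<open>Ext_map\<close> forms cosets in the module of all cochains, whereas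
    \<open>Ext\<close> is a quotient of the cocycles; a coset depends only on the addition, which
    the two share.\<close>
  moreover have "coboundaries R A N i +>\<^bsub>cochains R A N i\<^esub> x = coboundaries R A N i +>\<^bsub>cocycle_module R A N i\<^esub> x" for x
    by (simp add: a_r_coset_def' cocycle_module_def)
  ultimately show ?thesis unfolding Ext_map_def by simp
qed

lemma linmap_Ext_map:
  assumes A: "module R A" and C: "module R C" and N: "module R N" and f: "linmap R A C f"
  shows "linmap R (Ext R i C N) (Ext R i A N) (Ext_map R i A N f)"
proof -
  note MA = module_cocycle_module[OF A N, of i] and UA = submodule_coboundaries[OF A N, of i]
  note MC = module_cocycle_module[OF C N, of i] and UC = submodule_coboundaries[OF C N, of i]
  interpret Z: module R "cocycle_module R C N i" by (rule MC)
  let ?T = "\<lambda>\<psi>. \<lambda>u\<in>carrier (res_module R A i). \<psi> (res_map R f u)"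
  have r: "res_map R f u \<in> carrier (res_module R C i)" if "u \<in> carrier (res_module R A i)" for u
    by (rule linmap_closed[OF linmap_res_map[OF A C f] that])
  have T: "linmap R (cocycle_module R C N i) (cocycle_module R A N i) ?T"
    by (rule linmap_cocycle_pullback[where p = "res_map R f",
          OF A C N r cocyc_pullback[OF chain_lift_res_map[OF A C f]]])
  have E: "Ext_map R i A N f (coboundaries R C N i +>\<^bsub>cocycle_module R C N i\<^esub> \<psi>) =
      coboundaries R A N i +>\<^bsub>cocycle_module R A N i\<^esub> ?T \<psi>" if "\<psi> \<in> carrier (cocycle_module R C N i)" for \<psi>
    using Ext_map_rcos[OF A C N f, of \<psi> i] that by (simp add: cocycle_module_simps)
  show ?thesis
    unfolding Ext_eq_quot
  proof (rule linmapI)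
    fix X assume "X \<in> carrier (quot_module (cocycle_module R C N i) (coboundaries R C N i))"
    then obtain \<psi> where \<psi>: "\<psi> \<in> carrier (cocycle_module R C N i)"
      "X = coboundaries R C N i +>\<^bsub>cocycle_module R C N i\<^esub> \<psi>" by (rule quot_moduleE)
    note T\<psi> = linmap_closed[OF T \<psi>(1)]
    show "Ext_map R i A N f X \<in> carrier (quot_module (cocycle_module R A N i) (coboundaries R A N i))"
      unfolding \<psi>(2) E[OF \<psi>(1)] by (rule quot_module_closed[OF T\<psi>])
    show "Ext_map R i A N f (r \<odot>\<^bsub>quot_module (cocycle_module R C N i) (coboundaries R C N i)\<^esub> X) =
        r \<odot>\<^bsub>quot_module (cocycle_module R A N i) (coboundaries R A N i)\<^esub> Ext_map R i A N f X"
      if r: "r \<in> carrier R" for r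
      unfolding \<psi>(2) quot_module_simps(3)[OF MC UC r \<psi>(1)] E[OF \<psi>(1)] E[OF Z.smult_closed[OF r \<psi>(1)]]
        quot_module_simps(3)[OF MA UA r T\<psi>] linmap_smult[OF T r \<psi>(1)] ..
    fix Y assume "Y \<in> carrier (quot_module (cocycle_module R C N i) (coboundaries R C N i))"
    then obtain \<phi> where \<phi>: "\<phi> \<in> carrier (cocycle_module R C N i)"
      "Y = coboundaries R C N i +>\<^bsub>cocycle_module R C N i\<^esub> \<phi>" by (rule quot_moduleE)
    show "Ext_map R i A N f (X \<oplus>\<^bsub>quot_module (cocycle_module R C N i) (coboundaries R C N i)\<^esub> Y) =
        Ext_map R i A N f X \<oplus>\<^bsub>quot_module (cocycle_module R A N i) (coboundaries R A N i)\<^esub> Ext_map R i A N f Y"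
      unfolding \<psi>(2) \<phi>(2) quot_module_simps(2)[OF MC UC \<psi>(1) \<phi>(1)] E[OF \<psi>(1)] E[OF \<phi>(1)]
        E[OF Z.M.a_closed[OF \<psi>(1) \<phi>(1)]]
        quot_module_simps(2)[OF MA UA T\<psi> linmap_closed[OF T \<phi>(1)]] linmap_add[OF T \<psi>(1) \<phi>(1)] ..
  qed
qed

lemma (in short_exact) Ext_map_injective:
  assumes N: "module R N" and K: "i = 0 \<or> ext_zero R K N (i - 1)"
    and X: "X \<in> carrier (Ext R i C N)" and z: "Ext_map R i B N \<pi> X = \<zero>\<^bsub>Ext R i B N\<^esub>"
  shows "X = \<zero>\<^bsub>Ext R i C N\<^esub>"
proof -
  note MB = module_cocycle_module[OF B N, of i] and UB = submodule_coboundaries[OF B N, of i]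
  note MC = module_cocycle_module[OF C N, of i] and UC = submodule_coboundaries[OF C N, of i]
  from X obtain \<psi> where \<psi>: "\<psi> \<in> carrier (cocycle_module R C N i)"
    "X = coboundaries R C N i +>\<^bsub>cocycle_module R C N i\<^esub> \<psi>" unfolding Ext_eq_quot by (rule quot_moduleE)
  then have \<psi>': "\<psi> \<in> cocycles R C N i" "cocyc R C N i \<psi>" by (auto simp: cocycle_module_simps cocycles_iff)
  let ?\<phi> = "\<lambda>u\<in>carrier (res_module R B i). \<psi> (res_map R \<pi> u)"
  have \<phi>: "?\<phi> \<in> carrier (cocycle_module R B N i)"
    unfolding cocycle_module_simps by (rule restrict_cocycles[OF B cocyc_pullback[OF res_map_lift \<psi>'(2)]])
  have "?\<phi> \<in> coboundaries R B N i"
    using z unfolding \<psi>(2) Ext_map_rcos[OF B C N \<pi> \<psi>'(1)] Ext_eq_quot quot_map_eq_zero_iff[OF MB UB \<phi>] .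
  then have "cobd R B N i (\<lambda>u. \<psi> (res_map R \<pi> u))"
    by (simp add: coboundaries_iff[OF B N] cong: cobd_cong)
  from ext_injective[OF N K \<psi>'(2) this] have "\<psi> \<in> coboundaries R C N i"
    using \<psi>'(1) by (simp add: coboundaries_iff[OF C N] cocycles_iff)
  then show ?thesis unfolding \<psi>(2) Ext_eq_quot quot_map_eq_zero_iff[OF MC UC \<psi>(1)] .
qed

section \<open>Powers of an ideal\<close>

lemma ideal_pow_Suc: "I [^]\<^bsub>ideals_set R\<^esub> Suc q = ideal_prod R (I [^]\<^bsub>ideals_set R\<^esub> q) I"
  and ideal_pow_0: "I [^]\<^bsub>ideals_set R\<^esub> (0 :: nat) = carrier R"
  by (simp_all add: nat_pow_def ideals_set_def)

lemma ideal_pow_ideal: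
  assumes "cring R" "ideal I R"
  shows "ideal (I [^]\<^bsub>ideals_set R\<^esub> (q :: nat)) R"
proof -
  interpret cring R by fact
  show ?thesis
  proof (induction q)
    case 0
    show ?case unfolding ideal_pow_0 by (rule oneideal)
  next
    case (Suc q)
    show ?case unfolding ideal_pow_Suc by (rule ideal_prod_is_ideal[OF Suc assms(2)])
  qed
qed

lemma ideal_pow_decreasing:
  assumes "cring R" "ideal I R"
  shows "I [^]\<^bsub>ideals_set R\<^esub> Suc q \<subseteq> I [^]\<^bsub>ideals_set R\<^esub> q" "I [^]\<^bsub>ideals_set R\<^esub> Suc q \<subseteq> I"
proof -
  interpret cring R by fact
  show "I [^]\<^bsub>ideals_set R\<^esub> Suc q \<subseteq> I [^]\<^bsub>ideals_set R\<^esub> q" "I [^]\<^bsub>ideals_set R\<^esub> Suc q \<subseteq> I"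
    using ideal_prod_inter[OF ideal_pow_ideal[OF assms, of q] assms(2)] unfolding ideal_pow_Suc by auto
qed

text \<open>A prime ideal that contains a product of ideals contains a factor. The bound on q comes
  from I^0 = R; it makes the projection of M/I^qM onto M/IM available.\<close>

lemma primeideal_contains_pow:
  assumes "cring R" "ideal I R" "primeideal P R" "I [^]\<^bsub>ideals_set R\<^esub> (q :: nat) \<subseteq> P"
  shows "I \<subseteq> P" "q \<noteq> 0"
proof -
  interpret cring R by fact
  interpret P: primeideal P R by fact
  have ne: "\<not> carrier R \<subseteq> P" using P.I_notcarr P.a_subset by blast
  show "q \<noteq> 0"
  proof
    assume q: "q = 0"
    show False using assms(4) ne unfolding q ideal_pow_0 by blast
  qed
  show "I \<subseteq> P" using assms(4)
  proof (induction q)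
    case 0
    then show ?case using ne unfolding ideal_pow_0 by blast
  next
    case (Suc q)
    then show ?case
      using primeideal_divides_ideal_prod[OF assms(3) ideal_pow_ideal[OF assms(1,2), of q] assms(2)]
      unfolding ideal_pow_Suc by blast
  qed
qed

section \<open>Spans and the submodules I^q M\<close>

lemma submodule_mod_span:
  assumes "module R M" "S \<subseteq> carrier M"
  shows "submodule (mod_span R M S) R M"
proof -
  interpret M: module R M by fact
  have "carrier M \<in> {U. submodule U R M \<and> S \<subseteq> U}" using assms(2) M.carrier_is_submodule by simp
  then show ?thesis
    unfolding submodule_iff[OF assms(1)] mod_span_def using submodule_props[OF assms(1)] by blast
qed

context
  fixes R :: "('r, 'x) ring_scheme" and I
  assumes R: "cring R" and I: "ideal I R"
begin

lemma ideal_pow_carrier: "I [^]\<^bsub>ideals_set R\<^esub> (q :: nat) \<subseteq> carrier R"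
  using ideal.Icarr[OF ideal_pow_ideal[OF R I]] by blast

lemma submodule_ideal_pow_mod:
  assumes "module R M"
  shows "submodule (ideal_pow_mod R I M q) R M"
proof -
  interpret M: module R M by fact
  show ?thesis
    unfolding ideal_pow_mod_def ideal_smult_def
    using ideal_pow_carrier[of q] by (intro submodule_mod_span[OF assms]) auto
qed

lemma ideal_pow_mod_smult:
  "a \<in> I [^]\<^bsub>ideals_set R\<^esub> q \<Longrightarrow> x \<in> carrier M \<Longrightarrow> a \<odot>\<^bsub>M\<^esub> x \<in> ideal_pow_mod R I M q"
  unfolding ideal_pow_mod_def ideal_smult_def mod_span_def by blast

lemma ideal_pow_mod_minimal:
  assumes "submodule V R M" "\<And>a x. a \<in> I [^]\<^bsub>ideals_set R\<^esub> q \<Longrightarrow> x \<in> carrier M \<Longrightarrow> a \<odot>\<^bsub>M\<^esub> x \<in> V"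
  shows "ideal_pow_mod R I M q \<subseteq> V"
  unfolding ideal_pow_mod_def ideal_smult_def mod_span_def using assms by blast

lemma ideal_pow_mod_decreasing:
  assumes "module R M"
  shows "ideal_pow_mod R I M (Suc q) \<subseteq> ideal_pow_mod R I M q"
  by (rule ideal_pow_mod_minimal[OF submodule_ideal_pow_mod[OF assms] ideal_pow_mod_smult])
    (use ideal_pow_decreasing(1)[OF R I] in blast)

lemma ideal_pow_mod_antimono:
  assumes "module R M" "p \<le> q"
  shows "ideal_pow_mod R I M q \<subseteq> ideal_pow_mod R I M p"
  using lift_Suc_antimono_le[of "ideal_pow_mod R I M", OF ideal_pow_mod_decreasing[OF assms(1)] assms(2)] .

lemma quot_pow_annihilated:
  assumes M: "module R M" and a: "a \<in> I [^]\<^bsub>ideals_set R\<^esub> q"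
    and C: "C \<in> carrier (quot_module M (ideal_pow_mod R I M q))"
  shows "a \<odot>\<^bsub>quot_module M (ideal_pow_mod R I M q)\<^esub> C = \<zero>\<^bsub>quot_module M (ideal_pow_mod R I M q)\<^esub>"
proof -
  interpret M: module R M by fact
  note V = submodule_ideal_pow_mod[OF M, of q]
  have aR: "a \<in> carrier R" using ideal_pow_carrier a by blast
  from C obtain x where x: "x \<in> carrier M" "C = ideal_pow_mod R I M q +>\<^bsub>M\<^esub> x" by (rule quot_moduleE)
  show ?thesis
    unfolding x(2) quot_module_simps(3)[OF M V aR x(1)]
      quot_map_eq_zero_iff[OF M V M.smult_closed[OF aR x(1)]]
    by (rule ideal_pow_mod_smult[OF a x(1)])
qed

end

lemma fg_sub_quot:
  assumes M: "module R M" and U: "submodule U R M" and fg: "fg_sub R M (carrier M)"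
  shows "fg_sub R (quot_module M U) (carrier (quot_module M U))"
proof -
  have "(\<lambda>x. U +>\<^bsub>M\<^esub> x) ` carrier M = carrier (quot_module M U)"
    by (auto simp only: quot_module_carrier)
  then show ?thesis using fg_sub_image[OF M module_quot_module[OF M U] linmap_quot[OF M U] fg] by simp
qed

lemma fg_sub_ring_module:
  assumes "cring R" "noetherian_ring R"
  shows "fg_sub R (ring_module R) (carrier (ring_module R))"
proof -
  interpret cring R by fact
  show ?thesis using noetherian_fg_sub[OF assms oneideal] by simp
qed

section \<open>Local cohomology\<close>

text \<open>Vanishing is tested on cyclic modules killed by a power of I, so one element type
  suffices; \<open>ext_zero_torsion\<close> extends it to finitely generated modules of any
  type.\<close>

definition torsion_ext_zero ::
    "('r, 'x) ring_scheme \<Rightarrow> 'r set \<Rightarrow> ('r, 'n, 'z) module_scheme \<Rightarrow> nat \<Rightarrow> bool" where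
  "torsion_ext_zero R I N i \<longleftrightarrow> (\<forall>J (q :: nat). submodule J R (ring_module R) \<longrightarrow>
     I [^]\<^bsub>ideals_set R\<^esub> q \<subseteq> J \<longrightarrow> ext_zero R (quot_module (ring_module R) J) N i)"

locale torsion_setting =
  fixes R :: "('r, 'x) ring_scheme" and I :: "'r set" and N :: "('r, 'n, 'z) module_scheme"
  assumes R: "cring R" "noetherian_ring R" and I: "ideal I R" and N: "module R N"
begin

lemma RM: "module R (ring_module R)"
  by (rule module_ring_module[OF R(1)])

text \<open>Intended for kernels of projections: a submodule of a finitely generated module over a
  Noetherian ring is finitely generated, which reduces the claim to
  \<open>ext_zero_fg\<close>.\<close>

lemma ext_zero_torsion:
  assumes T: "torsion_ext_zero R I N i" and B: "module R B" and fg: "fg_sub R B (carrier B)"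
    and ann: "\<And>a x. a \<in> I [^]\<^bsub>ideals_set R\<^esub> (q :: nat) \<Longrightarrow> x \<in> carrier B \<Longrightarrow> a \<odot>\<^bsub>B\<^esub> x = \<zero>\<^bsub>B\<^esub>"
    and U: "submodule U R B"
  shows "ext_zero R (B\<lparr>carrier := U\<rparr>) N i"
proof (rule ext_zero_fg[OF N B _ ideal_pow_carrier[OF R(1) I, of q]])
  show "fg_sub R B U" by (rule fg_sub_noetherian[OF R(2) B fg U submodule_props(1)[OF B U]])
  show "ext_zero R (quot_module (ring_module R) J) N i"
    if "submodule J R (ring_module R)" "I [^]\<^bsub>ideals_set R\<^esub> q \<subseteq> J" for J
    using T that by (auto simp only: torsion_ext_zero_def)
  show "a \<odot>\<^bsub>B\<^esub> x = \<zero>\<^bsub>B\<^esub>" if "a \<in> I [^]\<^bsub>ideals_set R\<^esub> q" "x \<in> U" for a x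
    using ann[OF that(1)] that(2) submodule_props(1)[OF B U] by blast
qed

abbreviation "mod_pow M q \<equiv> quot_module M (ideal_pow_mod R I M q)"

lemma module_mod_pow: "module R M \<Longrightarrow> module R (mod_pow M q)"
  by (rule module_quot_module[OF _ submodule_ideal_pow_mod[OF R(1) I]])

lemma ext_zero_sub_mod_pow:
  assumes T: "i = 0 \<or> torsion_ext_zero R I N (i - 1)"
    and M: "module R M" and fg: "fg_sub R M (carrier M)" and U: "submodule U R (mod_pow M q)"
  shows "i = 0 \<or> ext_zero R ((mod_pow M q)\<lparr>carrier := U\<rparr>) N (i - 1)"
proof (cases "i = 0")
  case False
  then have "torsion_ext_zero R I N (i - 1)" using T by simp
  from ext_zero_torsion[OF this module_mod_pow[OF M]
      fg_sub_quot[OF M submodule_ideal_pow_mod[OF R(1) I M] fg]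
      quot_pow_annihilated[OF R(1) I M] U]
  show ?thesis by blast
qed simp

text \<open>The kernel of M/I^(q+1)M -> M/I^qM is finitely generated and killed by I^(q+1), so
  Ext^(i-1) vanishes on it (if i > 0) and the transition map in degree i is injective.\<close>

lemma injective_system_Ext:
  assumes T: "i = 0 \<or> torsion_ext_zero R I N (i - 1)"
    and M: "module R M" and fg: "fg_sub R M (carrier M)"
  shows "injective_system R (\<lambda>q. Ext R i (mod_pow M q) N)
    (\<lambda>q. Ext_map R i (mod_pow M (Suc q)) N (\<lambda>C. ideal_pow_mod R I M q <+>\<^bsub>M\<^esub> C))"
proof (rule injective_system.intro)
  fix q
  let ?U = "ideal_pow_mod R I M (Suc q)" and ?V = "ideal_pow_mod R I M q"
  note U = submodule_ideal_pow_mod[OF R(1) I M, of "Suc q"]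
    and V = submodule_ideal_pow_mod[OF R(1) I M, of q]
    and UV = ideal_pow_mod_decreasing[OF R(1) I M, of q]
  interpret S: short_exact R "mod_pow M (Suc q)" "mod_pow M q" "\<lambda>C. ?V <+>\<^bsub>M\<^esub> C"
    by (rule short_exact_quot_quot(1)[OF M U V UV])
  show "module R (Ext R i (mod_pow M q) N)" by (rule module_Ext[OF S.C N])
  show "linmap R (Ext R i (mod_pow M q) N) (Ext R i (mod_pow M (Suc q)) N)
      (Ext_map R i (mod_pow M (Suc q)) N (\<lambda>C. ?V <+>\<^bsub>M\<^esub> C))"
    by (rule linmap_Ext_map[OF S.B S.C N S.\<pi>])
  show "x = \<zero>\<^bsub>Ext R i (mod_pow M q) N\<^esub>"
    if "x \<in> carrier (Ext R i (mod_pow M q) N)"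
      "Ext_map R i (mod_pow M (Suc q)) N (\<lambda>C. ?V <+>\<^bsub>M\<^esub> C) x = \<zero>\<^bsub>Ext R i (mod_pow M (Suc q)) N\<^esub>" for x
    by (rule S.Ext_map_injective[OF N ext_zero_sub_mod_pow[OF T M fg S.ker_submodule] that])
qed

text \<open>Beyond the terms of the system: R/J with J containing I^q is a quotient of R/I^q whose
  kernel is again finitely generated torsion, so Ext^i(R/J, N) embeds in Ext^i(R/I^q, N) =
  0.\<close>

lemma torsion_ext_zero_step:
  assumes T: "i = 0 \<or> torsion_ext_zero R I N (i - 1)"
    and H: "\<not> nonzero_module (local_cohomology R I i N)"
  shows "torsion_ext_zero R I N i"
  unfolding torsion_ext_zero_def
proof (intro allI impI)
  fix J and q :: nat
  assume J: "submodule J R (ring_module R)" and qJ: "I [^]\<^bsub>ideals_set R\<^esub> q \<subseteq> J"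
  note fg = fg_sub_ring_module[OF R]
  let ?V = "ideal_pow_mod R I (ring_module R) q"
  have V: "submodule ?V R (ring_module R)" by (rule submodule_ideal_pow_mod[OF R(1) I RM])
  interpret IS: injective_system R "\<lambda>q. Ext R i (mod_pow (ring_module R) q) N"
    "\<lambda>q. Ext_map R i (mod_pow (ring_module R) (Suc q)) N (\<lambda>C. ideal_pow_mod R I (ring_module R) q <+>\<^bsub>ring_module R\<^esub> C)"
    by (rule injective_system_Ext[OF T RM fg])
  have "carrier (Ext R i (mod_pow (ring_module R) q) N) = {\<zero>\<^bsub>Ext R i (mod_pow (ring_module R) q) N\<^esub>}"
    by (rule IS.direct_limit_trivial[OF H[unfolded local_cohomology_def gen_local_cohomology_def]])
  then have ez: "ext_zero R (mod_pow (ring_module R) q) N i" by (rule ext_zero_trivial_Ext[OF module_mod_pow[OF RM] N])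
  \<comment> \<open>\<open>?V\<close> is the submodule I^q R spanned by products, not literally the
    ideal power, so its inclusion in J is checked on products.\<close>
  have VJ: "?V \<subseteq> J"
  proof (rule ideal_pow_mod_minimal[OF R(1) I J])
    interpret cring R by (rule R(1))
    fix a x assume a: "a \<in> I [^]\<^bsub>ideals_set R\<^esub> q" and x: "x \<in> carrier (ring_module R)"
    have "x \<otimes>\<^bsub>R\<^esub> a \<in> J" using submodule_props(4)[OF RM J, of x a] x a qJ by auto
    then show "a \<odot>\<^bsub>ring_module R\<^esub> x \<in> J"
      using x a qJ submodule_props(1)[OF RM J] by (auto simp: m_comm subset_iff)
  qed
  interpret S: short_exact R "mod_pow (ring_module R) q" "quot_module (ring_module R) J"
    "\<lambda>C. J <+>\<^bsub>ring_module R\<^esub> C"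
    by (rule short_exact_quot_quot(1)[OF RM V J VJ])
  show "ext_zero R (quot_module (ring_module R) J) N i"
    unfolding ext_zero_def
  proof (intro allI impI)
    fix f assume f: "cocyc R (quot_module (ring_module R) J) N i f"
    have "cobd R (mod_pow (ring_module R) q) N i (\<lambda>v. f (res_map R (\<lambda>C. J <+>\<^bsub>ring_module R\<^esub> C) v))"
      using ez cocyc_pullback[OF S.res_map_lift f] by (simp add: ext_zero_def)
    then show "cobd R (quot_module (ring_module R) J) N i f"
      by (rule S.ext_injective[OF N ext_zero_sub_mod_pow[OF T RM fg S.ker_submodule] f])
  qed
qed

lemma torsion_ext_zero_below:
  assumes "\<And>j. j < c \<Longrightarrow> \<not> nonzero_module (local_cohomology R I j N)"
  shows "i < c \<Longrightarrow> torsion_ext_zero R I N i"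
proof (induction i)
  case 0
  then show ?case using assms by (intro torsion_ext_zero_step) auto
next
  case (Suc i)
  then show ?case using assms by (intro torsion_ext_zero_step) auto
qed

text \<open>
  Adjoining \<open>aA\<close> to a submodule \<open>U\<close> gives a quotient \<open>(U + aA)/U \<cong> A/V\<close>. The class on it
  that lifts the restriction of \<open>g\<close> to \<open>U + aA\<close> pulls back, along \<open>a : A \<rightarrow> U + aA\<close>, to \<open>a\<close> times
  the class of \<open>g\<close>, which is zero.
\<close>

lemma cobd_on_multiples:
  assumes A: "module R A" and T: "\<And>U. submodule U R A \<Longrightarrow> c = 0 \<or> ext_zero R (A\<lparr>carrier := U\<rparr>) N (c - 1)"
    and g: "cocyc R A N c g" and Ig: "\<And>a. a \<in> I \<Longrightarrow> cobd R A N c (\<lambda>u. a \<odot>\<^bsub>N\<^esub> g u)"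
    and J: "fg_sub R (ring_module R) J" "J \<subseteq> I"
  shows "\<exists>U. submodule U R A \<and> (\<forall>b\<in>J. \<forall>z\<in>carrier A. b \<odot>\<^bsub>A\<^esub> z \<in> U) \<and> cobd R (A\<lparr>carrier := U\<rparr>) N c g"
  using J
proof induction
  case zero
  interpret A: module R A by fact
  have Z: "submodule {\<zero>\<^bsub>A\<^esub>} R A" by (rule submodule_zero[OF A])
  have "ext_zero R (A\<lparr>carrier := {\<zero>\<^bsub>A\<^esub>}\<rparr>) N c"
    by (rule ext_zero_trivial[OF module_submodule[OF A Z] N]) simp
  then have "cobd R (A\<lparr>carrier := {\<zero>\<^bsub>A\<^esub>}\<rparr>) N c g"
    using cocyc_submodule[OF A Z g] by (simp add: ext_zero_def)
  then show ?case using Z by (intro exI[of _ "{\<zero>\<^bsub>A\<^esub>}"]) simp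
next
  case (adjoin J a)
  interpret A: module R A by fact
  interpret N: module R N by (rule N)
  have a: "a \<in> carrier R" using adjoin(2) by simp
  note J = submodule_props[OF RM fg_sub_submodule[OF RM adjoin(1)], simplified]
  have sub: "l \<oplus>\<^bsub>R\<^esub> r \<otimes>\<^bsub>R\<^esub> a \<in> I" if "l \<in> J" "r \<in> carrier R" for l r
    using adjoin.prems that by auto
  have "J \<subseteq> I"
  proof
    fix l assume l: "l \<in> J"
    then have "l = l \<oplus>\<^bsub>R\<^esub> \<zero>\<^bsub>R\<^esub> \<otimes>\<^bsub>R\<^esub> a" using J(1) a by auto
    then show "l \<in> I" using sub[OF l A.R.zero_closed] by simp
  qed
  then obtain U where U: "submodule U R A" "\<And>b z. b \<in> J \<Longrightarrow> z \<in> carrier A \<Longrightarrow> b \<odot>\<^bsub>A\<^esub> z \<in> U"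
    "cobd R (A\<lparr>carrier := U\<rparr>) N c g" using adjoin.IH by blast
  have aI: "a \<in> I" using sub[OF J(2) A.R.one_closed] a by simp
  note U' = submodule_props[OF A U(1)]
  let ?\<alpha> = "\<lambda>z. a \<odot>\<^bsub>A\<^esub> z"
  let ?W = "{u \<oplus>\<^bsub>A\<^esub> a \<odot>\<^bsub>A\<^esub> z | u z. u \<in> U \<and> z \<in> carrier A}"
  let ?V = "{z \<in> carrier A. a \<odot>\<^bsub>A\<^esub> z \<in> U}"
  let ?\<pi> = "coset_preimage A A ?\<alpha> U"
  have \<alpha>: "linmap R A A ?\<alpha>" by (rule linmap_smult_self[OF A a])
  have W: "submodule ?W R A" by (rule submodule_image_plus[OF A A \<alpha> U(1)])
  have V: "submodule ?V R A" by (rule submodule_vimage[OF A A \<alpha> U(1)])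
  note se = short_exact_adjoin[OF A A \<alpha> U(1)]
  interpret S: short_exact R "A\<lparr>carrier := ?W\<rparr>" "quot_module A ?V" ?\<pi> by (rule se(1))
  interpret S': short_exact R A "quot_module A ?V" "\<lambda>z. ?V +>\<^bsub>A\<^esub> z" by (rule short_exact_quot(1)[OF A V])
  have gW: "cocyc R (A\<lparr>carrier := ?W\<rparr>) N c g" by (rule cocyc_submodule[OF A W g])
  have "cobd R S.K N c g" using U(3) se(2) by simp
  from S.ext_exact_middle[OF N gW this] obtain g' where
    g': "cocyc R (quot_module A ?V) N c g'"
    and gg': "cobd R (A\<lparr>carrier := ?W\<rparr>) N c (\<lambda>v. g v \<ominus>\<^bsub>N\<^esub> g' (res_map R ?\<pi> v))" by blast
  have \<alpha>W: "linmap R A (A\<lparr>carrier := ?W\<rparr>) ?\<alpha>"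
  proof (rule linmap_into_sub[OF \<alpha>])
    fix z assume z: "z \<in> carrier A"
    then have "a \<odot>\<^bsub>A\<^esub> z = \<zero>\<^bsub>A\<^esub> \<oplus>\<^bsub>A\<^esub> a \<odot>\<^bsub>A\<^esub> z" using a by simp
    then show "a \<odot>\<^bsub>A\<^esub> z \<in> ?W" using z U'(2) by blast
  qed
  note \<mu> = chain_lift_res_map[OF A S.B \<alpha>W]
  have gc: "g u \<in> carrier N" if "u \<in> carrier (res_module R A c)" for u
    by (rule linmap_closed[OF cocyc_linmap[OF g] that])
  \<comment> \<open>\<open>res_map\<close> of multiplication by a and scalar multiplication by a on
    chains lift the same map of A, so the pullback of g is cohomologous to a g, a coboundary by
    assumption.\<close>
  have g\<mu>: "cobd R A N c (\<lambda>u. g (res_map R ?\<alpha> u))"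
  proof -
    have "cobd R A N c (\<lambda>u. g (res_map R ?\<alpha> u) \<ominus>\<^bsub>N\<^esub> g (a \<odot>\<^bsub>res_module R A c\<^esub> u))"
      by (rule cocyc_lift_unique[OF A A N chain_lift_res_map[OF A A \<alpha>] chain_lift_smult[OF A a] g])
    moreover have ga: "g (a \<odot>\<^bsub>res_module R A c\<^esub> u) = a \<odot>\<^bsub>N\<^esub> g u" if "u \<in> carrier (res_module R A c)" for u
      by (rule linmap_smult[OF cocyc_linmap[OF g] a that])
    ultimately have *: "cobd R A N c (\<lambda>u. g (res_map R ?\<alpha> u) \<ominus>\<^bsub>N\<^esub> a \<odot>\<^bsub>N\<^esub> g u)"
      by (simp del: res_module_simps cong: cobd_cong)
    have "cobd R A N c (\<lambda>u. g (res_map R ?\<alpha> u)) \<longleftrightarrow> cobd R A N c (\<lambda>u. a \<odot>\<^bsub>N\<^esub> g u)"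
      by (rule cobd_diff_cancel[OF N A _ _ *])
        (use gc a linmap_closed[OF linmap_res_map[OF A A \<alpha>]] in auto)
    then show ?thesis using Ig[OF aI] by blast
  qed
  have c1: "g' w \<in> carrier N" if "w \<in> carrier (res_module R (quot_module A ?V) c)" for w
    by (rule linmap_closed[OF cocyc_linmap[OF g'] that])
  have c2: "res_map R ?\<pi> (res_map R ?\<alpha> u) \<in> carrier (res_module R (quot_module A ?V) c)"
    if "u \<in> carrier (res_module R A c)" for u
    by (rule linmap_closed[OF chain_liftD(1)[OF S.res_map_lift] linmap_closed[OF chain_liftD(1)[OF \<mu>] that]])
  have c3: "res_map R (\<lambda>z. ?V +>\<^bsub>A\<^esub> z) u \<in> carrier (res_module R (quot_module A ?V) c)"
    if "u \<in> carrier (res_module R A c)" for u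
    by (rule linmap_closed[OF chain_liftD(1)[OF S'.res_map_lift] that])
  have "cobd R A N c (\<lambda>u. g (res_map R ?\<alpha> u) \<ominus>\<^bsub>N\<^esub> g' (res_map R ?\<pi> (res_map R ?\<alpha> u)))"
    by (rule cobd_pullback[OF N A S.B \<mu> gg'])
  from cobd_diff_cancel[OF N A _ _ this] g\<mu>
  have 1: "cobd R A N c (\<lambda>u. g' (res_map R ?\<pi> (res_map R ?\<alpha> u)))"
    using gc linmap_closed[OF linmap_res_map[OF A A \<alpha>]] c1 c2 by blast
  \<comment> \<open>The composite A -> U + aA -> A/V is the projection, so g' may be pulled back
    along either lift.\<close>
  have "res_lift R A (quot_module A ?V) (\<lambda>z. ?V +>\<^bsub>A\<^esub> z) (\<lambda>n u. res_map R ?\<pi> (res_map R ?\<alpha> u))"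
    by (rule chain_lift_cong[OF chain_lift_comp[OF A \<mu> S.res_map_lift] A]) (rule se(3))
  from cocyc_lift_unique[OF A S.C N this S'.res_map_lift g']
  have 2: "cobd R A N c (\<lambda>u. g' (res_map R ?\<pi> (res_map R ?\<alpha> u)) \<ominus>\<^bsub>N\<^esub> g' (res_map R (\<lambda>z. ?V +>\<^bsub>A\<^esub> z) u))" .
  have "cobd R A N c (\<lambda>u. g' (res_map R (\<lambda>z. ?V +>\<^bsub>A\<^esub> z) u))"
    using cobd_diff_cancel[OF N A _ _ 2] 1 c1 c2 c3 by blast
  \<comment> \<open>Ext^c(A/V, N) -> Ext^c(A, N) is injective by the assumption on submodules of A,
    so the class of g' is itself zero.\<close>
  then have g'0: "cobd R (quot_module A ?V) N c g'"
    by (rule S'.ext_injective[OF N T[OF S'.ker_submodule] g'])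
  have 3: "cobd R (A\<lparr>carrier := ?W\<rparr>) N c (\<lambda>v. g' (res_map R ?\<pi> v))"
    by (rule cobd_pullback[OF N S.B S.C S.res_map_lift g'0])
  have "cobd R (A\<lparr>carrier := ?W\<rparr>) N c g"
    using cobd_diff_cancel[OF N S.B linmap_closed[OF cocyc_linmap[OF gW]] cobd_closed[OF S.B 3] gg'] 3 by blast
  moreover have "b \<odot>\<^bsub>A\<^esub> z \<in> ?W"
    if b: "b \<in> {l \<oplus>\<^bsub>ring_module R\<^esub> r \<odot>\<^bsub>ring_module R\<^esub> a | l r. l \<in> J \<and> r \<in> carrier R}" and z: "z \<in> carrier A" for b z
  proof -
    obtain l r where lr: "b = l \<oplus>\<^bsub>R\<^esub> r \<otimes>\<^bsub>R\<^esub> a" "l \<in> J" "r \<in> carrier R" using b by auto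
    have "b \<odot>\<^bsub>A\<^esub> z = l \<odot>\<^bsub>A\<^esub> z \<oplus>\<^bsub>A\<^esub> a \<odot>\<^bsub>A\<^esub> (r \<odot>\<^bsub>A\<^esub> z)"
      using lr J(1) a z by (simp add: A.smult_l_distr A.smult_assoc1[symmetric] A.R.m_comm subset_iff)
    then show ?thesis using U(2)[OF lr(2) z] A.smult_closed[OF lr(3) z] by blast
  qed
  ultimately show ?case using W by (intro exI[of _ ?W]) blast
qed

theorem Ass_gen_local_cohomology:
  assumes T: "c = 0 \<or> torsion_ext_zero R I N (c - 1)"
    and M: "module R M" and fg: "fg_sub R M (carrier M)"
  shows "Ass R (gen_local_cohomology R I c M N) \<subseteq> Ass R (Ext R c (mod_pow M 1) N)"
proof
  interpret N: module R N by (rule N)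
  interpret IS: injective_system R "\<lambda>q. Ext R c (mod_pow M q) N"
    "\<lambda>q. Ext_map R c (mod_pow M (Suc q)) N (\<lambda>C. ideal_pow_mod R I M q <+>\<^bsub>M\<^esub> C)"
    by (rule injective_system_Ext[OF T M fg])
  fix P assume "P \<in> Ass R (gen_local_cohomology R I c M N)"
  then obtain q where "P \<in> Ass R (Ext R c (mod_pow M q) N)"
    unfolding gen_local_cohomology_def using IS.Ass_direct_limit by blast
  let ?A = "mod_pow M q" and ?C = "mod_pow M 1"
  have A: "module R ?A" and C: "module R ?C" by (rule module_mod_pow[OF M])+
  have Pq: "P \<in> Ass_rel R (cocycle_module R ?A N c) (coboundaries R ?A N c)"
    using \<open>P \<in> Ass R (Ext R c ?A N)\<close> Ass_Ext[OF A N] by simp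
  have mem: "r \<odot>\<^bsub>cocycle_module R B N c\<^esub> f \<in> coboundaries R B N c \<longleftrightarrow> cobd R B N c (\<lambda>u. r \<odot>\<^bsub>N\<^esub> f u)"
    if "module R B" for B :: "('r, 'm set) module" and r f
    unfolding cocycle_module_simps coboundaries_iff[OF that N] by (simp cong: cobd_cong)
  from Pq obtain g where P: "primeideal P R" and g0: "g \<in> cocycles R ?A N c"
    and Pg: "P = {r \<in> carrier R. cobd R ?A N c (\<lambda>u. r \<odot>\<^bsub>N\<^esub> g u)}"
    unfolding Ass_rel_def cocycle_module_simps(1) mem[OF A] by blast
  have g: "cocyc R ?A N c g" using g0 by (simp add: cocycles_iff)
  have gc: "g u \<in> carrier N" if "u \<in> carrier (res_module R ?A c)" for u
    by (rule linmap_closed[OF cocyc_linmap[OF g] that])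
  have "I [^]\<^bsub>ideals_set R\<^esub> q \<subseteq> P"
  proof
    fix a assume a: "a \<in> I [^]\<^bsub>ideals_set R\<^esub> q"
    then have aR: "a \<in> carrier R" using ideal_pow_carrier[OF R(1) I] by blast
    interpret A: exact_complex R "res_module R ?A" "boundary R" "augmentation R ?A" ?A
      by (rule exact_complex_res[OF A])
    \<comment> \<open>Multiplication by an element a of I^q is zero on M/I^qM, so scalar
      multiplication by a on chains lifts the zero map, and a g is a coboundary.\<close>
    have "res_lift R ?A ?A (\<lambda>_. \<zero>\<^bsub>?A\<^esub>) (\<lambda>n u. a \<odot>\<^bsub>res_module R ?A n\<^esub> u)"
      by (rule chain_lift_cong[OF chain_lift_smult[OF A aR] A]) (rule quot_pow_annihilated[OF R(1) I M a])
    from A.cobd_null[OF A N this cocyc_linmap[OF g] cocyc_boundary[OF g]]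
    have "cobd R ?A N c (\<lambda>u. g (a \<odot>\<^bsub>res_module R ?A c\<^esub> u))" .
    then have "cobd R ?A N c (\<lambda>u. a \<odot>\<^bsub>N\<^esub> g u)"
      using linmap_smult[OF cocyc_linmap[OF g] aR] by (simp del: res_module_simps cong: cobd_cong)
    then show "a \<in> P" using aR Pg by blast
  qed
  from primeideal_contains_pow[OF R(1) I P this] have IP: "I \<subseteq> P" and q: "1 \<le> q" by auto
  have T': "c = 0 \<or> ext_zero R (?A\<lparr>carrier := U\<rparr>) N (c - 1)" if "submodule U R ?A" for U
    by (rule ext_zero_sub_mod_pow[OF T M fg that])
  have Ig: "cobd R ?A N c (\<lambda>u. a \<odot>\<^bsub>N\<^esub> g u)" if "a \<in> I" for a using that IP Pg by blast
  obtain U where U: "submodule U R ?A" "\<And>b z. b \<in> I \<Longrightarrow> z \<in> carrier ?A \<Longrightarrow> b \<odot>\<^bsub>?A\<^esub> z \<in> U"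
    "cobd R (?A\<lparr>carrier := U\<rparr>) N c g"
    using cobd_on_multiples[OF A T' g Ig noetherian_fg_sub[OF R I] subset_refl] by blast
  note Vq = submodule_ideal_pow_mod[OF R(1) I M, of q] and V1 = submodule_ideal_pow_mod[OF R(1) I M, of 1]
  note Vq1 = ideal_pow_mod_antimono[OF R(1) I M q]
  let ?\<pi> = "\<lambda>C. ideal_pow_mod R I M 1 <+>\<^bsub>M\<^esub> C"
  note se = short_exact_quot_quot[OF M Vq V1 Vq1]
  interpret S: short_exact R ?A ?C ?\<pi> by (rule se(1))
  \<comment> \<open>\<open>U\<close> contains all b z with b in I, so its preimage in M contains IM;
    hence the kernel of M/I^qM -> M/IM lies in \<open>U\<close>, where g is a coboundary.\<close>
  have "ideal_pow_mod R I M 1 \<subseteq> {x \<in> carrier M. ideal_pow_mod R I M q +>\<^bsub>M\<^esub> x \<in> U}"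
  proof (rule ideal_pow_mod_minimal[OF R(1) I submodule_vimage[OF M A linmap_quot[OF M Vq] U(1)]])
    interpret M: module R M by fact
    fix a x assume a: "a \<in> I [^]\<^bsub>ideals_set R\<^esub> (1 :: nat)" and x: "x \<in> carrier M"
    have aI: "a \<in> I" using a ideal_pow_decreasing(2)[OF R(1) I, of 0] by auto
    then have aR: "a \<in> carrier R" using ideal.Icarr[OF I] by blast
    have "a \<odot>\<^bsub>?A\<^esub> (ideal_pow_mod R I M q +>\<^bsub>M\<^esub> x) \<in> U" by (rule U(2)[OF aI quot_module_closed[OF x]])
    then show "a \<odot>\<^bsub>M\<^esub> x \<in> {x \<in> carrier M. ideal_pow_mod R I M q +>\<^bsub>M\<^esub> x \<in> U}"
      using quot_module_simps(3)[OF M Vq aR x] M.smult_closed[OF aR x] by simp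
  qed
  then have kerU: "S.ker \<subseteq> U" unfolding se(2) by blast
  have "submodule S.ker R (?A\<lparr>carrier := U\<rparr>)"
    using S.ker_submodule kerU unfolding submodule_iff[OF A] submodule_iff[OF module_submodule[OF A U(1)]] by simp
  from cobd_submodule[OF N module_submodule[OF A U(1)] this U(3)]
  have "cobd R S.K N c g" by simp
  from S.ext_exact_middle[OF N g this] obtain g' where
    g': "cocyc R ?C N c g'" and gg': "cobd R ?A N c (\<lambda>v. g v \<ominus>\<^bsub>N\<^esub> g' (res_map R ?\<pi> v))" by blast
  have rc: "res_map R ?\<pi> v \<in> carrier (res_module R ?C c)" if "v \<in> carrier (res_module R ?A c)" for v
    by (rule linmap_closed[OF chain_liftD(1)[OF S.res_map_lift] that])
  have g'c: "g' w \<in> carrier N" if "w \<in> carrier (res_module R ?C c)" for w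
    by (rule linmap_closed[OF cocyc_linmap[OF g'] that])
  \<comment> \<open>g is cohomologous to the pullback of g', and Ext^c(M/IM, N) -> Ext^c(M/I^qM, N)
    is injective, so the two classes have the same annihilator.\<close>
  have "cobd R ?A N c (\<lambda>u. r \<odot>\<^bsub>N\<^esub> g u) \<longleftrightarrow> cobd R ?C N c (\<lambda>u. r \<odot>\<^bsub>N\<^esub> g' u)" if r: "r \<in> carrier R" for r
  proof -
    have "cobd R ?A N c (\<lambda>v. r \<odot>\<^bsub>N\<^esub> (g v \<ominus>\<^bsub>N\<^esub> g' (res_map R ?\<pi> v)))" by (rule cobd_smult[OF N gg' r])
    then have *: "cobd R ?A N c (\<lambda>v. r \<odot>\<^bsub>N\<^esub> g v \<ominus>\<^bsub>N\<^esub> r \<odot>\<^bsub>N\<^esub> g' (res_map R ?\<pi> v))"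
      using N.smult_diff[OF r gc g'c[OF rc]] by (simp cong: cobd_cong)
    have "cobd R ?A N c (\<lambda>u. r \<odot>\<^bsub>N\<^esub> g u) \<longleftrightarrow> cobd R ?A N c (\<lambda>u. r \<odot>\<^bsub>N\<^esub> g' (res_map R ?\<pi> u))"
      by (rule cobd_diff_cancel[OF N A _ _ *]) (use r gc g'c rc in auto)
    also have "\<dots> \<longleftrightarrow> cobd R ?C N c (\<lambda>u. r \<odot>\<^bsub>N\<^esub> g' u)"
    proof
      have rg': "cocyc R ?C N c (\<lambda>u. r \<odot>\<^bsub>N\<^esub> g' u)"
        using g' r by (auto simp: cocyc_def intro: linmap_scale[OF N])
      show "cobd R ?A N c (\<lambda>u. r \<odot>\<^bsub>N\<^esub> g' (res_map R ?\<pi> u)) \<Longrightarrow> cobd R ?C N c (\<lambda>u. r \<odot>\<^bsub>N\<^esub> g' u)"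
        by (rule S.ext_injective[OF N T'[OF S.ker_submodule] rg'])
    qed (rule cobd_pullback[OF N A C S.res_map_lift])
    finally show ?thesis .
  qed
  then have Pg': "P = {r \<in> carrier R. cobd R ?C N c (\<lambda>u. r \<odot>\<^bsub>N\<^esub> g' u)}" unfolding Pg by blast
  let ?g = "restrict g' (carrier (res_module R ?C c))"
  have "cobd R ?C N c (\<lambda>u. r \<odot>\<^bsub>N\<^esub> ?g u) \<longleftrightarrow> cobd R ?C N c (\<lambda>u. r \<odot>\<^bsub>N\<^esub> g' u)" for r
    by (rule cobd_cong) simp
  then have "P = {r \<in> carrier R. r \<odot>\<^bsub>cocycle_module R ?C N c\<^esub> ?g \<in> coboundaries R ?C N c}"
    unfolding mem[OF C] using Pg' by simp
  moreover have "?g \<in> carrier (cocycle_module R ?C N c)"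
    unfolding cocycle_module_simps by (rule restrict_cocycles[OF C g'])
  ultimately show "P \<in> Ass R (Ext R c ?C N)" unfolding Ass_Ext[OF C N] Ass_rel_def using P by blast
qed

end

text \<open>The infimum and supremum of the empty set differ, so equality of depth and cohomological
  dimension forces a nonzero local cohomology module; the common value is then its degree, and
  nothing lies below it.\<close>

lemma Cohen_Macaulay_concentrated:
  assumes "Cohen_Macaulay_wrt R I N"
  obtains c where "cd_wrt R I N = ereal (real c)"
    "\<And>j. j < c \<Longrightarrow> \<not> nonzero_module (local_cohomology R I j N)"
proof -
  let ?S = "{ereal (real i) | i. nonzero_module (local_cohomology R I i N)}"
  have eq: "Inf ?S = Sup ?S"
    using assms by (simp add: Cohen_Macaulay_wrt_def depth_wrt_def cd_wrt_def)
  have "?S \<noteq> {}"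
  proof
    assume "?S = {}"
    with eq show False by (simp only: Inf_empty Sup_empty) (simp add: top_ereal_def bot_ereal_def)
  qed
  then obtain c where c: "nonzero_module (local_cohomology R I c N)" by blast
  then have cS: "ereal (real c) \<in> ?S" by blast
  have "Inf ?S \<le> ereal (real c)" "ereal (real c) \<le> Sup ?S"
    by (rule Inf_lower[OF cS], rule Sup_upper[OF cS])
  then have e: "Inf ?S = ereal (real c)" "Sup ?S = ereal (real c)" using eq by auto
  show thesis
  proof (rule that)
    show "cd_wrt R I N = ereal (real c)" unfolding cd_wrt_def by (rule e(2))
    fix j assume j: "j < c"
    show "\<not> nonzero_module (local_cohomology R I j N)"
    proof
      assume "nonzero_module (local_cohomology R I j N)"
      then have "ereal (real j) \<in> ?S" by blast
      from Inf_lower[OF this] show False using e(1) j by simp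
    qed
  qed
qed

theorem corollary2p14:
  fixes R :: "('r, 'x) ring_scheme"
    and M :: "('r, 'm, 'y) module_scheme"
    and N :: "('r, 'n, 'z) module_scheme"
  assumes "cring R" and "noetherian_ring R" and "\<one>\<^bsub>R\<^esub> \<noteq> \<zero>\<^bsub>R\<^esub>"
    and "ideal I R" and "I \<noteq> carrier R"
    and "weakly_Laskerian R N"
    and "fin_gen_module R M"
    and "Cohen_Macaulay_wrt R I N"
    and "cd_wrt R I N = 0 \<or> cd_wrt R I N \<ge> max 1 (h_inv R I M N)"
  shows "\<exists>c :: nat. cd_wrt R I N = ereal (real c) \<and>
           finite (Ass R (gen_local_cohomology R I c M N))"
proof -
  obtain c where cd: "cd_wrt R I N = ereal (real c)"
    and H: "\<And>j. j < c \<Longrightarrow> \<not> nonzero_module (local_cohomology R I j N)"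
    using Cohen_Macaulay_concentrated[OF assms(8)] by blast
  have N: "module R N" using assms(6) by (simp add: weakly_Laskerian_def)
  have M: "module R M" using assms(7) by (simp add: fin_gen_module_def)
  have fg: "fg_sub R M (carrier M)" by (rule fg_sub_carrier[OF assms(7)])
  interpret torsion_setting R I N by (rule torsion_setting.intro) (rule assms N)+
  have "torsion_ext_zero R I N (c - 1)" if "c \<noteq> 0"
    by (rule torsion_ext_zero_below[of c, OF H]) (use that in simp_all)
  then have "c = 0 \<or> torsion_ext_zero R I N (c - 1)" by blast
  from Ass_gen_local_cohomology[OF this M fg]
  have sub: "Ass R (gen_local_cohomology R I c M N) \<subseteq> Ass R (Ext R c (mod_pow M 1) N)" .
  let ?C = "mod_pow M 1"
  have C: "module R ?C" by (rule module_mod_pow[OF M])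
  have fgC: "fg_sub R ?C (carrier ?C)"
    by (rule fg_sub_quot[OF M submodule_ideal_pow_mod[OF assms(1,4) M] fg])
  \<comment> \<open>The filtration is applied to M/IM as a submodule of itself, for which the change
    of carrier is void.\<close>
  have "wl_ext R (?C\<lparr>carrier := carrier ?C\<rparr>) N c"
    by (rule wl_ext_fg[OF N C wl_ext_cyclic[OF assms(1,2,6)] fgC])
  then have "finite (Ass_rel R (cocycle_module R ?C N c) (coboundaries R ?C N c))"
    using submodule_coboundaries[OF C N] by (simp add: wl_def)
  then have "finite (Ass R (Ext R c ?C N))" by (simp only: Ass_Ext[OF C N])
  with sub cd show ?thesis using finite_subset by blast
qed

end
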